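(* Assume Assumption 1. If $\hat w$ is a weak minimum of problem (P), then $$\max_{\lambda\in\Lambda}\Omega[\lambda](z,v)\ge0\qquad\text{for all }(z,v)\in\mathcal C_2 .$$
   Context: Standing setting. Fix $T>0$, integers $n,m\ge1$, $d_\varphi,d_\eta\ge0$ and $x_0\in\mathbb R^n$. Write $\mathcal U:=L_\infty(0,T;\mathbb R^m)$, $\mathcal X:=W^1_\infty(0,T;\mathbb R^n)$, and for $1\le p\le\infty$, $\mathcal U_p:=L_p(0,T;\mathbb R^m)$, $\mathcal X_p:=W^1_p(0,T;\mathbb R^n)$. Let $f_0,\dots,f_m:\mathbb R^n\to\mathbb R^n$ be $C^2$ and $\varphi_0,\dots,\varphi_{d_\varphi},\eta_1,\dots,\eta_{d_\eta}:\mathbb R^n\to\mathbb R$ twice differentiable. Problem (P): minimize $\varphi_0(x(T))$ over $(x,u)\in\mathcal X\times\mathcal U$ subject to $\dot x(t)=\sum_{i=0}^m u_i(t)f_i(x(t))$ a.e. (with $u_0\equiv1$), $x(0)=x_0$; $u(t)\ge0$ componentwise a.e.; $\varphi_i(x(T))\le0$ ($1\le i\le d_\varphi$); $\eta_j(x(T))=0$ ($1\le j\le d_\eta$). A point satisfying all these is feasible. $\hat w=(\hat x,\hat u)$ is a fixed feasible point with $\varphi_i(\hat x(T))=0$ for all $i=0,\dots,d_\varphi$. $\hat w$ is a weak minimum if there is $\varepsilon>0$ such that $\varphi_0(\hat x(T))\le\varphi_0(x(T))$ for every feasible $(x,u)$ with $\|x-\hat x\|_\infty<\varepsilon$ and $\|u-\hat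 u\|_\infty<\varepsilon$. Multipliers. For $\alpha\in\mathbb R^{d_\varphi+1}$, $\beta\in\mathbb R^{d_\eta}$ and Lipschitz $\psi:[0,T]\to\mathbb R^{n,*}$ (row vectors), put $\lambda=(\alpha,\beta,\psi)$, $H[\lambda](x,u,t):=\psi(t)\sum_{i=0}^m u_if_i(x)$, $\ell[\lambda](q):=\sum_{i=0}^{d_\varphi}\alpha_i\varphi_i(q)+\sum_{j=1}^{d_\eta}\beta_j\eta_j(q)$. Derivatives of $H[\lambda]$ written without arguments are evaluated at $(\hat x(t),\hat u(t),t)$. $\Lambda$ is the set of $\lambda$ with $|\alpha|+|\beta|=1$, $\alpha\ge0$, $-\dot\psi(t)=H_x[\lambda](t)$ a.e., $\psi(T)=\ell'[\lambda](\hat x(T))$, and $H[\lambda](\hat x(t),\hat u(t),t)=\min_{v\in\mathbb R^m_+}H[\lambda](\hat x(t),v,t)$ for a.e. $t$. Active sets. For $i=1,\dots,m$: $I_0^i:=\{t\in[0,T]:\max_{\lambda\in\Lambda}H_{u_i}[\lambda](t)>0\}$, $I_+^i:=[0,T]\setminus I_0^i$. Assumption 1: for each $i$, $I_0^i=\{t:\hat u_i(t)=0\}$ up to a null set. Linearization. $A(t):=\sum_{i=0}^m\hat u_i(t)f_i'(\hat x(t))$, $B(t)v:=\sum_{i=1}^m v_if_i(\hat x(t))$. (LE): $\dot z=Az+Bv$ a.e., $z(0)=0$. (LC): $\varphi_i'(\hat x(T))z(T)\le0$ for $i=0,\dots,d_\varphi$, $\eta_j'(\hat x(T))z(T)=0$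 for $j=1,\dots,d_\eta$. $\mathcal C_2:=\{(z,v)\in\mathcal X_2\times\mathcal U_2:\ v_i=0\text{ a.e. on }I_0^i\ (i=1,\dots,m),\ \text{(LE), (LC) hold}\}$. Second variation: $\Omega[\lambda](z,v):=\tfrac12\ell''[\lambda](\hat x(T))(z(T),z(T))+\tfrac12\int_0^T\big[(H_{xx}[\lambda](t)z,z)+2(H_{ux}[\lambda](t)z,v)\big]dt$. *)

theory Defs
  imports "HOL-Analysis.Analysis" "HOL-Probability.Essential_Supremum"
begin

text \<open>Function spaces on [0,T]. Elements of L_p are represented by (measurable)
representatives; Sobolev functions W^1_p are the functions x with
x t = x 0 + integral of an L_p function w over [0,t].\<close>

definition Linf_on :: "real \<Rightarrow> (real \<Rightarrow> 'a::euclidean_space) \<Rightarrow> bool" where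
  "Linf_on T u \<longleftrightarrow> u \<in> borel_measurable (lebesgue_on {0..T}) \<and>
     (\<exists>C. AE t in lebesgue_on {0..T}. norm (u t) \<le> C)"

definition L2_on :: "real \<Rightarrow> (real \<Rightarrow> 'a::euclidean_space) \<Rightarrow> bool" where
  "L2_on T u \<longleftrightarrow> u \<in> borel_measurable (lebesgue_on {0..T}) \<and>
     integrable (lebesgue_on {0..T}) (\<lambda>t. (norm (u t))\<^sup>2)"

definition W1inf_on :: "real \<Rightarrow> (real \<Rightarrow> 'a::euclidean_space) \<Rightarrow> bool" where
  "W1inf_on T x \<longleftrightarrow> (\<exists>w. Linf_on T w \<and> (\<forall>t\<in>{0..T}. x t = x 0 + integral {0..t} w))"

definition W12_on :: "real \<Rightarrow> (real \<Rightarrow> 'a::euclidean_space) \<Rightarrow> bool" where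
  "W12_on T x \<longleftrightarrow> (\<exists>w. L2_on T w \<and> (\<forall>t\<in>{0..T}. x t = x 0 + integral {0..t} w))"

text \<open>Dynamics  sum_{i=0}^m u_i f_i(x) with u_0 = 1.\<close>
definition dyn :: "((real^'n) \<Rightarrow> (real^'n)) \<Rightarrow> ('m::finite \<Rightarrow> (real^'n) \<Rightarrow> (real^'n))
    \<Rightarrow> (real^'n) \<Rightarrow> (real^'m) \<Rightarrow> (real^'n)" where
  "dyn f0 f x u = f0 x + (\<Sum>i\<in>UNIV. (u $ i) *\<^sub>R f i x)"

definition feasible :: "real \<Rightarrow> (real^'n) \<Rightarrow> ((real^'n) \<Rightarrow> (real^'n)) \<Rightarrow> ('m::finite \<Rightarrow> (real^'n) \<Rightarrow> (real^'n))
   \<Rightarrow> nat \<Rightarrow> (nat \<Rightarrow> (real^'n) \<Rightarrow> real) \<Rightarrow> nat \<Rightarrow> (nat \<Rightarrow> (real^'n) \<Rightarrow> real)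
   \<Rightarrow> (real \<Rightarrow> (real^'n)) \<Rightarrow> (real \<Rightarrow> (real^'m)) \<Rightarrow> bool" where
  "feasible T x0 f0 f d\<phi> \<phi> d\<eta> \<eta> x u \<longleftrightarrow>
     W1inf_on T x \<and> Linf_on T u \<and>
     (AE t in lebesgue_on {0..T}. (x has_vector_derivative dyn f0 f (x t) (u t)) (at t within {0..T})) \<and>
     x 0 = x0 \<and>
     (AE t in lebesgue_on {0..T}. \<forall>i. 0 \<le> u t $ i) \<and>
     (\<forall>i\<in>{1..d\<phi>}. \<phi> i (x T) \<le> 0) \<and>
     (\<forall>j\<in>{1..d\<eta>}. \<eta> j (x T) = 0)"

definition weak_min :: "real \<Rightarrow> (real^'n) \<Rightarrow> ((real^'n) \<Rightarrow> (real^'n)) \<Rightarrow> ('m::finite \<Rightarrow> (real^'n) \<Rightarrow> (real^'n))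
   \<Rightarrow> nat \<Rightarrow> (nat \<Rightarrow> (real^'n) \<Rightarrow> real) \<Rightarrow> nat \<Rightarrow> (nat \<Rightarrow> (real^'n) \<Rightarrow> real)
   \<Rightarrow> (real \<Rightarrow> (real^'n)) \<Rightarrow> (real \<Rightarrow> (real^'m)) \<Rightarrow> bool" where
  "weak_min T x0 f0 f d\<phi> \<phi> d\<eta> \<eta> xh uh \<longleftrightarrow>
     feasible T x0 f0 f d\<phi> \<phi> d\<eta> \<eta> xh uh \<and>
     (\<exists>\<epsilon>>0. \<forall>x u. feasible T x0 f0 f d\<phi> \<phi> d\<eta> \<eta> x u
        \<and> (SUP t\<in>{0..T}. norm (x t - xh t)) < \<epsilon>
        \<and> esssup (lebesgue_on {0..T}) (\<lambda>t. ereal (norm (u t - uh t))) < ereal \<epsilon>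
        \<longrightarrow> \<phi> 0 (xh T) \<le> \<phi> 0 (x T))"

definition Amat :: "((real^'n) \<Rightarrow> (real^'n) \<Rightarrow>\<^sub>L (real^'n)) \<Rightarrow> ('m::finite \<Rightarrow> (real^'n) \<Rightarrow> (real^'n) \<Rightarrow>\<^sub>L (real^'n))
   \<Rightarrow> (real \<Rightarrow> (real^'n)) \<Rightarrow> (real \<Rightarrow> (real^'m)) \<Rightarrow> real \<Rightarrow> (real^'n) \<Rightarrow> (real^'n)" where
  "Amat f0' f' xh uh t z = blinfun_apply (f0' (xh t)) z
      + (\<Sum>i\<in>UNIV. (uh t $ i) *\<^sub>R blinfun_apply (f' i (xh t)) z)"

definition Bmat :: "('m::finite \<Rightarrow> (real^'n) \<Rightarrow> (real^'n)) \<Rightarrow> (real \<Rightarrow> (real^'n)) \<Rightarrow> real \<Rightarrow> (real^'m) \<Rightarrow> (real^'n)" where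
  "Bmat f xh t v = (\<Sum>i\<in>UNIV. (v $ i) *\<^sub>R f i (xh t))"

text \<open>Multipliers lambda = (alpha, beta, psi); alpha indexed by 0..d_phi, beta by 1..d_eta
(entries outside these ranges are fixed to 0); psi a row vector represented as a vector
acting by inner product.\<close>
type_synonym 'n mult = "(nat \<Rightarrow> real) \<times> (nat \<Rightarrow> real) \<times> (real \<Rightarrow> (real^'n))"

definition lprime :: "nat \<Rightarrow> (nat \<Rightarrow> (real^'n) \<Rightarrow> (real^'n) \<Rightarrow>\<^sub>L real) \<Rightarrow> nat \<Rightarrow> (nat \<Rightarrow> (real^'n) \<Rightarrow> (real^'n) \<Rightarrow>\<^sub>L real)
   \<Rightarrow> (nat \<Rightarrow> real) \<Rightarrow> (nat \<Rightarrow> real) \<Rightarrow> (real^'n) \<Rightarrow> (real^'n) \<Rightarrow> real" where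
  "lprime d\<phi> \<phi>' d\<eta> \<eta>' \<alpha> \<beta> q z =
     (\<Sum>i\<le>d\<phi>. \<alpha> i * blinfun_apply (\<phi>' i q) z) + (\<Sum>j\<in>{1..d\<eta>}. \<beta> j * blinfun_apply (\<eta>' j q) z)"

definition lsecond :: "nat \<Rightarrow> (nat \<Rightarrow> (real^'n) \<Rightarrow> (real^'n) \<Rightarrow>\<^sub>L (real^'n) \<Rightarrow>\<^sub>L real) \<Rightarrow> nat
   \<Rightarrow> (nat \<Rightarrow> (real^'n) \<Rightarrow> (real^'n) \<Rightarrow>\<^sub>L (real^'n) \<Rightarrow>\<^sub>L real)
   \<Rightarrow> (nat \<Rightarrow> real) \<Rightarrow> (nat \<Rightarrow> real) \<Rightarrow> (real^'n) \<Rightarrow> (real^'n) \<Rightarrow> (real^'n) \<Rightarrow> real" where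
  "lsecond d\<phi> \<phi>'' d\<eta> \<eta>'' \<alpha> \<beta> q z1 z2 =
     (\<Sum>i\<le>d\<phi>. \<alpha> i * blinfun_apply (blinfun_apply (\<phi>'' i q) z1) z2)
   + (\<Sum>j\<in>{1..d\<eta>}. \<beta> j * blinfun_apply (blinfun_apply (\<eta>'' j q) z1) z2)"

definition Lam :: "real \<Rightarrow> ((real^'n) \<Rightarrow> (real^'n)) \<Rightarrow> ('m::finite \<Rightarrow> (real^'n) \<Rightarrow> (real^'n))
   \<Rightarrow> ((real^'n) \<Rightarrow> (real^'n) \<Rightarrow>\<^sub>L (real^'n)) \<Rightarrow> ('m \<Rightarrow> (real^'n) \<Rightarrow> (real^'n) \<Rightarrow>\<^sub>L (real^'n))
   \<Rightarrow> nat \<Rightarrow> (nat \<Rightarrow> (real^'n) \<Rightarrow> (real^'n) \<Rightarrow>\<^sub>L real) \<Rightarrow> nat \<Rightarrow> (nat \<Rightarrow> (real^'n) \<Rightarrow> (real^'n) \<Rightarrow>\<^sub>L real)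
   \<Rightarrow> (real \<Rightarrow> (real^'n)) \<Rightarrow> (real \<Rightarrow> (real^'m)) \<Rightarrow> 'n mult set" where
  "Lam T f0 f f0' f' d\<phi> \<phi>' d\<eta> \<eta>' xh uh = {(\<alpha>, \<beta>, \<psi>).
     (\<Sum>i\<le>d\<phi>. \<bar>\<alpha> i\<bar>) + (\<Sum>j\<in>{1..d\<eta>}. \<bar>\<beta> j\<bar>) = 1 \<and>
     (\<forall>i\<le>d\<phi>. 0 \<le> \<alpha> i) \<and> (\<forall>i>d\<phi>. \<alpha> i = 0) \<and> (\<forall>j. j \<notin> {1..d\<eta>} \<longrightarrow> \<beta> j = 0) \<and>
     (\<exists>L. L-lipschitz_on {0..T} \<psi>) \<and>
     (AE t in lebesgue_on {0..T}. \<exists>w. (\<psi> has_vector_derivative w) (at t within {0..T})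
         \<and> (\<forall>z. w \<bullet> z = - (\<psi> t \<bullet> Amat f0' f' xh uh t z))) \<and>
     (\<forall>z. \<psi> T \<bullet> z = lprime d\<phi> \<phi>' d\<eta> \<eta>' \<alpha> \<beta> (xh T) z) \<and>
     (AE t in lebesgue_on {0..T}. \<forall>v. (\<forall>i. 0 \<le> v $ i) \<longrightarrow>
         \<psi> t \<bullet> dyn f0 f (xh t) (uh t) \<le> \<psi> t \<bullet> dyn f0 f (xh t) v)}"

text \<open>I_0^i = {t in [0,T]. max over Lambda of H_{u_i}[lambda](t) > 0}; H_{u_i} = psi(t) f_i(xh t).\<close>
definition I0 :: "real \<Rightarrow> 'n mult set \<Rightarrow> ('m \<Rightarrow> (real^'n) \<Rightarrow> (real^'n)) \<Rightarrow> (real \<Rightarrow> (real^'n)) \<Rightarrow> 'm \<Rightarrow> real set" where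
  "I0 T Lm f xh i = {t \<in> {0..T}. \<exists>(\<alpha>, \<beta>, \<psi>)\<in>Lm. 0 < \<psi> t \<bullet> f i (xh t)}"

definition C2 :: "real \<Rightarrow> 'n mult set \<Rightarrow> ('m::finite \<Rightarrow> (real^'n) \<Rightarrow> (real^'n))
   \<Rightarrow> ((real^'n) \<Rightarrow> (real^'n) \<Rightarrow>\<^sub>L (real^'n)) \<Rightarrow> ('m \<Rightarrow> (real^'n) \<Rightarrow> (real^'n) \<Rightarrow>\<^sub>L (real^'n))
   \<Rightarrow> nat \<Rightarrow> (nat \<Rightarrow> (real^'n) \<Rightarrow> (real^'n) \<Rightarrow>\<^sub>L real) \<Rightarrow> nat \<Rightarrow> (nat \<Rightarrow> (real^'n) \<Rightarrow> (real^'n) \<Rightarrow>\<^sub>L real)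
   \<Rightarrow> (real \<Rightarrow> (real^'n)) \<Rightarrow> (real \<Rightarrow> (real^'m))
   \<Rightarrow> ((real \<Rightarrow> (real^'n)) \<times> (real \<Rightarrow> (real^'m))) set" where
  "C2 T Lm f f0' f' d\<phi> \<phi>' d\<eta> \<eta>' xh uh = {(z, v).
     W12_on T z \<and> L2_on T v \<and>
     (\<forall>i. AE t in lebesgue_on {0..T}. t \<in> I0 T Lm f xh i \<longrightarrow> v t $ i = 0) \<and>
     (AE t in lebesgue_on {0..T}.
        (z has_vector_derivative (Amat f0' f' xh uh t (z t) + Bmat f xh t (v t))) (at t within {0..T})) \<and>
     z 0 = 0 \<and>
     (\<forall>i\<le>d\<phi>. blinfun_apply (\<phi>' i (xh T)) (z T) \<le> 0) \<and>
     (\<forall>j\<in>{1..d\<eta>}. blinfun_apply (\<eta>' j (xh T)) (z T) = 0)}"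

definition Omega :: "real \<Rightarrow> ('m::finite \<Rightarrow> (real^'n) \<Rightarrow> (real^'n) \<Rightarrow>\<^sub>L (real^'n))
   \<Rightarrow> ((real^'n) \<Rightarrow> (real^'n) \<Rightarrow>\<^sub>L (real^'n) \<Rightarrow>\<^sub>L (real^'n)) \<Rightarrow> ('m \<Rightarrow> (real^'n) \<Rightarrow> (real^'n) \<Rightarrow>\<^sub>L (real^'n) \<Rightarrow>\<^sub>L (real^'n))
   \<Rightarrow> nat \<Rightarrow> (nat \<Rightarrow> (real^'n) \<Rightarrow> (real^'n) \<Rightarrow>\<^sub>L (real^'n) \<Rightarrow>\<^sub>L real) \<Rightarrow> nat
   \<Rightarrow> (nat \<Rightarrow> (real^'n) \<Rightarrow> (real^'n) \<Rightarrow>\<^sub>L (real^'n) \<Rightarrow>\<^sub>L real)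
   \<Rightarrow> (real \<Rightarrow> (real^'n)) \<Rightarrow> (real \<Rightarrow> (real^'m)) \<Rightarrow> 'n mult \<Rightarrow> (real \<Rightarrow> (real^'n)) \<Rightarrow> (real \<Rightarrow> (real^'m)) \<Rightarrow> real" where
  "Omega T f' f0'' f'' d\<phi> \<phi>'' d\<eta> \<eta>'' xh uh lm z v = (case lm of (\<alpha>, \<beta>, \<psi>) \<Rightarrow>
     (1/2) * lsecond d\<phi> \<phi>'' d\<eta> \<eta>'' \<alpha> \<beta> (xh T) (z T) (z T)
   + (1/2) * integral {0..T} (\<lambda>t.
        \<psi> t \<bullet> (blinfun_apply (blinfun_apply (f0'' (xh t)) (z t)) (z t)
            + (\<Sum>i\<in>UNIV. (uh t $ i) *\<^sub>R blinfun_apply (blinfun_apply (f'' i (xh t)) (z t)) (z t)))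
      + 2 * (\<Sum>i\<in>UNIV. v t $ i * (\<psi> t \<bullet> blinfun_apply (f' i (xh t)) (z t)))))"

end

(* Perturb the control to u + eps*v + eps^2*w, where (z, v) is a critical direction and w may point
   inwards wherever u vanishes.  To second order the endpoint moves by eps*z(T) + eps^2*(s + y(T)),
   where s collects the quadratic terms and y(T) ranges over the convex cone reachable by the
   linearized system.  Separating the resulting second-order increments of the constraints and of
   the cost from 0 in finite dimension leaves two cases.  A supporting functional yields, through
   the adjoint equation, a multiplier lambda with Omega[lambda](z, v) >= 0.  Otherwise 0 is an
   interior point; a partition of unity then turns the choice of w into a continuous function of the
   desired increment, and Brouwer's theorem absorbs the o(eps^2) errors and produces a feasible
   trajectory of smaller cost, contradicting weak minimality.

   The direction v is only in L2 and may be large where u is small.  It is first replaced by a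
   truncated direction with exactly the same endpoint z(T), so that the first-order conditions
   survive.  If the gradients of the equality constraints are dependent, a coefficient vector beta
   of a dependence or its negative, with alpha = 0 and psi = 0, is already a suitable multiplier. *)
theory Submission
  imports Defs
begin

text \<open>Everything rests on the dynamics being affine in the control: the second-order source
  \<open>Qm\<close> then contains the control direction only linearly, and the endpoint s(T) it
  produces depends on v continuously in L1. An L1 approximation of v therefore suffices, and
  truncation provides one, because Assumption 1 makes v_i vanish almost everywhere on the set where
  u_i = 0. The exact endpoint z(T) can be kept because attainable endpoints form a linear subspace
  of a finite-dimensional space.

  The cone of inward w is chosen for its dual. Nonnegativity of a functional on it says, after
  passing to the adjoint \<psi>, that \<psi> . f_i >= 0 everywhere and u_i (\<psi> . f_i) = 0 almost
  everywhere, which is the minimum condition for an H affine in the control. The same adjoint turns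
  the functional of s(T) into the integral part of Omega.

  States and adjoints are handled as solutions of integral equations, and u is a representative that
  is bounded and nonnegative at every time; almost-everywhere derivatives occur only on entering and
  leaving the definitions of the problem.\<close>

section \<open>Integral equations\<close>

text \<open>Bridges two languages for null sets: the problem is stated with \<open>AE\<close>, while
  the spike lemmas for the gauge integral want an explicit \<open>negligible\<close> exceptional
  set.\<close>

lemma AE_lebesgue_on_iff_negligible:
  fixes S :: "'a::euclidean_space set"
  assumes "S \<in> sets lebesgue"
  shows "(AE t in lebesgue_on S. P t) \<longleftrightarrow> (\<exists>N. negligible N \<and> (\<forall>t\<in>S - N. P t))"
proof -
  have "(AE t in lebesgue_on S. P t) \<longleftrightarrow> (AE t in lebesgue. t \<in> S \<longrightarrow> P t)"
    using assms by (subst AE_restrict_space_iff) auto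
  also have "\<dots> \<longleftrightarrow> (\<exists>N. negligible N \<and> (\<forall>t\<in>S - N. P t))"
  proof
    assume "AE t in lebesgue. t \<in> S \<longrightarrow> P t"
    then obtain N where "N \<in> null_sets lebesgue" "{t \<in> space lebesgue. \<not> (t \<in> S \<longrightarrow> P t)} \<subseteq> N"
      by (auto simp: eventually_ae_filter)
    then show "\<exists>N. negligible N \<and> (\<forall>t\<in>S - N. P t)"
      by (intro exI[of _ N]) (auto simp: negligible_iff_null_sets)
  next
    assume "\<exists>N. negligible N \<and> (\<forall>t\<in>S - N. P t)"
    then obtain N where "negligible N" "\<forall>t\<in>S - N. P t" by blast
    then show "AE t in lebesgue. t \<in> S \<longrightarrow> P t"
      by (intro AE_I'[of N]) (auto simp: negligible_iff_null_sets)
  qed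
  finally show ?thesis .
qed

text \<open>The left quotient at x is the right quotient of the reflected function at - x, so
  Lebesgue's differentiation theorem for right intervals is applied twice and the second exceptional
  set is reflected back.\<close>

lemma indefinite_integral_right_left_deriv:
  fixes f :: "real \<Rightarrow> 'a::euclidean_space"
  assumes f: "\<And>a b. f integrable_on {a..b}"
  obtains N where "negligible N"
    "\<And>x e. x \<notin> N \<Longrightarrow> 0 < e \<Longrightarrow> \<exists>d>0. \<forall>h. 0 < h \<and> h < d \<longrightarrow>
        norm (integral {x..x+h} f - h *\<^sub>R f x) \<le> e * h \<and> norm (integral {x-h..x} f - h *\<^sub>R f x) \<le> e * h"
proof -
  have key: "\<exists>N. negligible N \<and> (\<forall>x e. x \<notin> N \<longrightarrow> 0 < e \<longrightarrow> (\<exists>d>0. \<forall>h. 0 < h \<and> h < d \<longrightarrow>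
        norm (integral {x..x+h} g - h *\<^sub>R g x) \<le> e * h))"
    if g: "\<And>a b. g integrable_on {a..b}" for g :: "real \<Rightarrow> 'a"
  proof -
    obtain N where N: "negligible N" "\<And>x e. \<lbrakk>x \<notin> N; 0 < e\<rbrakk> \<Longrightarrow> \<exists>d>0. \<forall>h. 0 < h \<and> h < d \<longrightarrow>
                norm(integral (cbox x (x + h *\<^sub>R One)) g /\<^sub>R h ^ DIM(real) - g x) < e"
      using integrable_ccontinuous_explicit[of g] g by (metis cbox_interval)
    show ?thesis
    proof (intro exI[of _ N] conjI allI impI N(1))
      fix x e :: real assume "x \<notin> N" "0 < e"
      from N(2)[OF this] obtain d where d: "d > 0" "\<And>h. 0 < h \<and> h < d \<Longrightarrow>
                norm(integral {x..x + h} g /\<^sub>R h - g x) < e" by auto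
      show "\<exists>d>0. \<forall>h. 0 < h \<and> h < d \<longrightarrow> norm (integral {x..x+h} g - h *\<^sub>R g x) \<le> e * h"
      proof (intro exI[of _ d] conjI allI impI d(1))
        fix h assume h: "0 < h \<and> h < d"
        have "integral {x..x+h} g - h *\<^sub>R g x = h *\<^sub>R (integral {x..x + h} g /\<^sub>R h - g x)"
          using h by (simp add: scaleR_diff_right)
        then have "norm (integral {x..x+h} g - h *\<^sub>R g x) = h * norm (integral {x..x + h} g /\<^sub>R h - g x)"
          using h by simp
        also have "\<dots> \<le> h * e" using d(2)[OF h] h by (intro mult_left_mono) auto
        finally show "norm (integral {x..x+h} g - h *\<^sub>R g x) \<le> e * h" by (simp add: mult.commute)
      qed
    qed
  qed
  obtain N1 where N1: "negligible N1" "\<And>x e. x \<notin> N1 \<Longrightarrow> 0 < e \<Longrightarrow> (\<exists>d>0. \<forall>h. 0 < h \<and> h < d \<longrightarrow>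
        norm (integral {x..x+h} f - h *\<^sub>R f x) \<le> e * h)"
    using key[OF f] by blast
  have "(\<lambda>x. f (- x)) integrable_on {a..b}" for a b
    using Henstock_Kurzweil_Integration.integrable_reflect_real[where f=f and a="-b" and b="-a"] f by simp
  from key[OF this] obtain N2 where N2: "negligible N2" "\<And>x e. x \<notin> N2 \<Longrightarrow> 0 < e \<Longrightarrow> (\<exists>d>0. \<forall>h. 0 < h \<and> h < d \<longrightarrow>
        norm (integral {x..x+h} (\<lambda>x. f (-x)) - h *\<^sub>R f (-x)) \<le> e * h)"
    by blast
  have neg: "negligible (uminus ` N2)"
    by (intro negligible_differentiable_image_negligible[OF order_refl N2(1)] linear_imp_differentiable_on linear_uminus) 
  show thesis
  proof (rule that)
    show "negligible (N1 \<union> uminus ` N2)" using N1(1) neg by (rule negligible_Un)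
    fix x e :: real assume x: "x \<notin> N1 \<union> uminus ` N2" and e: "0 < e"
    then have "- x \<notin> N2" by (metis UnCI image_eqI minus_minus)
    with N2(2)[OF this e] obtain d2 where d2: "d2 > 0" "\<And>h. 0 < h \<and> h < d2 \<Longrightarrow>
        norm (integral {-x..-x+h} (\<lambda>x. f (-x)) - h *\<^sub>R f x) \<le> e * h" by auto
    obtain d1 where d1: "d1 > 0" "\<And>h. 0 < h \<and> h < d1 \<Longrightarrow>
        norm (integral {x..x+h} f - h *\<^sub>R f x) \<le> e * h" using N1(2)[of x e] x e by auto
    have "integral {-x..-x+h} (\<lambda>x. f (-x)) = integral {x-h..x} f" for h
      using Henstock_Kurzweil_Integration.integral_reflect_real[where f=f and a="x-h" and b=x] by (simp add: algebra_simps)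
    then show "\<exists>d>0. \<forall>h. 0 < h \<and> h < d \<longrightarrow>
        norm (integral {x..x+h} f - h *\<^sub>R f x) \<le> e * h \<and> norm (integral {x-h..x} f - h *\<^sub>R f x) \<le> e * h"
      using d1 d2 by (intro exI[of _ "min d1 d2"]) auto
  qed
qed

text \<open>Extending f by zero makes the integrals over all intervals exist, as the two-sided
  estimate demands. Only points of \<open>{a..b}\<close> are compared with t, so the artificial
  values outside never enter.\<close>

lemma indefinite_integral_has_vector_derivative_ae:
  fixes f :: "real \<Rightarrow> 'a::euclidean_space"
  assumes f: "f integrable_on {a..b}"
  obtains N where "negligible N"
    "\<And>t. t \<in> {a..b} - N \<Longrightarrow> ((\<lambda>t. integral {a..t} f) has_vector_derivative f t) (at t within {a..b})"
proof -
  define g where "g t = (if t \<in> {a..b} then f t else 0)" for t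
  have "g integrable_on UNIV" unfolding g_def using f integrable_restrict_UNIV by blast
  then have gi: "g integrable_on {c..d}" for c d
    using integrable_on_subinterval by (metis subset_UNIV)
  obtain N where N: "negligible N" "\<And>x e. x \<notin> N \<Longrightarrow> 0 < e \<Longrightarrow> \<exists>d>0. \<forall>h. 0 < h \<and> h < d \<longrightarrow>
        norm (integral {x..x+h} g - h *\<^sub>R g x) \<le> e * h \<and> norm (integral {x-h..x} g - h *\<^sub>R g x) \<le> e * h"
    using indefinite_integral_right_left_deriv[OF gi] by blast
  show thesis
  proof (rule that[OF N(1)])
    fix t assume t: "t \<in> {a..b} - N"
    have eq: "integral {c..d} g = integral {c..d} f" if "a \<le> c" "d \<le> b" for c d
      by (rule integral_cong) (use that in \<open>auto simp: g_def\<close>)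
    have "\<exists>d>0. \<forall>y\<in>{a..b}. norm (y - t) < d \<longrightarrow>
         norm (integral {a..y} f - integral {a..t} f - (y - t) *\<^sub>R f t) \<le> e * norm (y - t)" if e: "e > 0" for e
    proof -
      obtain d where d: "d > 0" "\<And>h. 0 < h \<and> h < d \<Longrightarrow>
        norm (integral {t..t+h} g - h *\<^sub>R g t) \<le> e * h \<and> norm (integral {t-h..t} g - h *\<^sub>R g t) \<le> e * h"
        using N(2)[of t e] t e by blast
      show ?thesis
      proof (intro exI[of _ d] conjI ballI impI d(1))
        fix y assume y: "y \<in> {a..b}" "norm (y - t) < d"
        consider "y = t" | "y > t" | "y < t" by linarith
        then show "norm (integral {a..y} f - integral {a..t} f - (y - t) *\<^sub>R f t) \<le> e * norm (y - t)"
        proof cases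
          case 1 then show ?thesis by simp
        next
          case 2
          have "integral {a..t} f + integral {t..y} f = integral {a..y} f"
            using f t y 2 by (intro Henstock_Kurzweil_Integration.integral_combine) (auto intro: integrable_on_subinterval)
          moreover have "integral {t..y} g = integral {t..y} f" using t y by (intro eq) auto
          moreover have "norm (integral {t..y} g - (y - t) *\<^sub>R g t) \<le> e * (y - t)"
            using d(2)[of "y - t"] 2 y t by auto
          ultimately have "norm (integral {a..y} f - integral {a..t} f - (y - t) *\<^sub>R f t) \<le> e * (y - t)"
            using t by (metis Diff_iff add_diff_cancel_left' g_def)
          then show ?thesis using 2 by simp
        next
          case 3
          have "integral {a..y} f + integral {y..t} f = integral {a..t} f"
            using f t y 3 by (intro Henstock_Kurzweil_Integration.integral_combine) (auto intro: integrable_on_subinterval)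
          moreover have "integral {y..t} g = integral {y..t} f" using t y by (intro eq) auto
          moreover have "norm (integral {y..t} g - (t - y) *\<^sub>R g t) \<le> e * (t - y)"
            using d(2)[of "t - y"] 3 y t by auto
          moreover have "- (P - Q - (y - t) *\<^sub>R f t) = R - (t - y) *\<^sub>R f t"
            if "P + R = Q" for P Q R :: 'a
            using that by (auto simp: algebra_simps)
          ultimately have "norm (- (integral {a..y} f - integral {a..t} f - (y - t) *\<^sub>R f t)) \<le> e * (t - y)"
            using t by (metis Diff_iff g_def)
          then show ?thesis using 3 by (simp only: norm_minus_cancel) simp
        qed
      qed
    qed
    then show "((\<lambda>t. integral {a..t} f) has_vector_derivative f t) (at t within {a..b})"
      unfolding has_vector_derivative_def has_derivative_within_alt
      by (auto intro: bounded_linear_scaleR_left)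
  qed
qed

text \<open>Integrating the weight exp (k s) gains a factor 1 / k; this gain drives both the
  Gronwall estimate and the contraction below.\<close>

lemma integral_scaled_exp_le:
  fixes k :: real
  assumes "0 < k" "0 \<le> t" "0 \<le> m"
  shows "integral {0..t} (\<lambda>s. m * exp (k * s)) \<le> m * exp (k * t) / k"
proof -
  have "((\<lambda>s. m * exp (k * s)) has_integral (m * exp (k * t) / k - m * exp (k * 0) / k)) {0..t}"
    using assms by (intro fundamental_theorem_of_calculus)
      (auto intro!: derivative_eq_intros simp: has_real_derivative_iff_has_vector_derivative[symmetric])
  then have "integral {0..t} (\<lambda>s. m * exp (k * s)) = m * exp (k * t) / k - m / k"
    by (subst integral_unique) auto
  then show ?thesis using assms by simp
qed

text \<open>Let m be the maximum of exp (-k t) e(t). With the weight k = 2 L the integral term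
  returns at most m / 2, so m is at most 2 a. This is where the factor 2 and the exponent 2 L T come
  from.\<close>

lemma gronwall_bound:
  fixes e :: "real \<Rightarrow> real"
  assumes "0 \<le> L" "0 \<le> a" "0 \<le> T" and cont: "continuous_on {0..T} e"
    and le: "\<And>t. t \<in> {0..T} \<Longrightarrow> e t \<le> a + L * integral {0..t} e"
    and t: "t \<in> {0..T}"
  shows "e t \<le> 2 * a * exp (2 * L * T)"
proof (cases "L = 0")
  case True
  then show ?thesis using le[OF t] \<open>0 \<le> a\<close> by simp
next
  case False
  define k where "k = 2 * L"
  have k: "k > 0" using False assms by (simp add: k_def)
  have "continuous_on {0..T} (\<lambda>t. exp (-k * t) * e t)" by (intro continuous_intros cont)
  then obtain t0 where t0: "t0 \<in> {0..T}" and max: "\<And>s. s \<in> {0..T} \<Longrightarrow> exp (-k * s) * e s \<le> exp (-k * t0) * e t0"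
    using continuous_attains_sup[of "{0..T}"] assms(3) by fastforce
  define m where "m = exp (-k * t0) * e t0"
  have es: "e s \<le> max m 0 * exp (k * s)" if "s \<in> {0..T}" for s
  proof -
    have "e s = exp (k * s) * (exp (-k * s) * e s)" by (simp add: mult.assoc[symmetric] exp_add[symmetric])
    also have "\<dots> \<le> exp (k * s) * max m 0" using max[OF that] by (intro mult_left_mono) (auto simp: m_def)
    finally show ?thesis by (simp add: mult.commute)
  qed
  have "m \<le> 2 * a"
  proof (cases "m \<le> 0")
    case True then show ?thesis using assms by linarith
  next
    case False
    have "integral {0..t0} e \<le> integral {0..t0} (\<lambda>s. m * exp (k * s))"
      using False es t0
      by (intro integral_le integrable_continuous_real continuous_intros continuous_on_subset[OF cont]) fastforce+
    also have "\<dots> \<le> m * exp (k * t0) / k" using k t0 False by (intro integral_scaled_exp_le) auto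
    finally have "e t0 \<le> a + L * (m * exp (k * t0) / k)"
      using le[OF t0] mult_left_mono[OF _ \<open>0 \<le> L\<close>] by fastforce
    also have "L * (m * exp (k * t0) / k) = m * exp (k * t0) / 2" using k by (simp add: k_def)
    finally have "exp (-k * t0) * e t0 \<le> exp (-k * t0) * (a + m * exp (k * t0) / 2)" by simp
    then have "m \<le> exp (-k * t0) * a + m / 2"
      by (simp add: m_def algebra_simps exp_minus)
    moreover have "exp (-k * t0) * a \<le> 1 * a" using t0 k \<open>0 \<le> a\<close> by (intro mult_right_mono) auto
    ultimately show ?thesis by simp
  qed
  then have "max m 0 \<le> 2 * a" using assms by simp
  then have "e t \<le> 2 * a * exp (k * t)" using es[OF t] by (meson exp_ge_zero mult_right_mono order_trans)
  also have "\<dots> \<le> 2 * a * exp (k * T)" using k t assms by (intro mult_left_mono) auto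
  finally show ?thesis by (simp add: k_def)
qed

text \<open>Banach's fixed point theorem in the weighted norm sup exp (-k t) |x t|. The substitution
  x t = exp (k t) y t turns it into the plain supremum norm of bounded continuous functions, and the
  integral operator becomes Lipschitz with constant L / k.\<close>

lemma integral_equation_exists:
  fixes g :: "real \<Rightarrow> 'a::euclidean_space \<Rightarrow> 'a"
  assumes "0 \<le> T" "0 \<le> L"
    and int: "\<And>x. continuous_on {0..T} x \<Longrightarrow> (\<lambda>s. g s (x s)) integrable_on {0..T}"
    and lip: "\<And>s x y. s \<in> {0..T} \<Longrightarrow> norm (g s x - g s y) \<le> L * norm (x - y)"
  obtains x where "continuous_on {0..T} x"
    "\<And>t. t \<in> {0..T} \<Longrightarrow> x t = x0 + integral {0..t} (\<lambda>s. g s (x s))"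
proof -
  \<comment> \<open>The \<open>+ 1\<close> keeps k positive when L = 0, while the contraction factor
    L / k stays at most 1/2.\<close>
  define k where "k = 2 * (L + 1)"
  have k: "k > 0" using assms by (simp add: k_def)
  \<comment> \<open>Clamping time to \<open>{0..T}\<close> lets the fixed point live on the whole
    real line, as the type of bounded continuous functions requires.\<close>
  define c where "c t = max 0 (min T t)" for t
  have c: "c t \<in> {0..T}" "continuous_on UNIV c" for t
    using \<open>0 \<le> T\<close> by (auto simp: c_def intro!: continuous_intros)
  define X where "X y t = x0 + integral {0..t} (\<lambda>s. g s (exp (k * s) *\<^sub>R apply_bcontfun y s))" for y t
  have gi: "(\<lambda>s. g s (exp (k * s) *\<^sub>R apply_bcontfun y s)) integrable_on {0..T}" for y
    by (intro int continuous_intros) auto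
  then have gi': "(\<lambda>s. g s (exp (k * s) *\<^sub>R apply_bcontfun y s)) integrable_on {0..t}" if "t \<in> {0..T}" for y t
    using that by (intro integrable_on_subinterval[OF gi]) auto
  have X: "continuous_on {0..T} (X y)" for y
    unfolding X_def by (intro continuous_intros indefinite_integral_continuous_1 gi)
  define F where "F y = Bcontfun (\<lambda>t. exp (- k * c t) *\<^sub>R X y (c t))" for y
  have "(\<lambda>t. exp (- k * c t) *\<^sub>R X y (c t)) \<in> bcontfun" for y
  proof -
    have "compact ((\<lambda>t. exp (- k * t) *\<^sub>R X y t) ` {0..T})"
      by (intro compact_continuous_image continuous_intros X) auto
    then have "bounded ((\<lambda>t. exp (- k * t) *\<^sub>R X y t) ` {0..T})" by (rule compact_imp_bounded)
    then have "bounded (range (\<lambda>t. exp (- k * c t) *\<^sub>R X y (c t)))"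
      by (rule bounded_subset) (use c in auto)
    moreover have "continuous_on UNIV (\<lambda>t. X y (c t))"
      by (rule continuous_on_compose2[OF X c(2)]) (use c in auto)
    then have "continuous_on UNIV (\<lambda>t. exp (- k * c t) *\<^sub>R X y (c t))"
      by (intro continuous_intros c(2))
    ultimately show ?thesis by (simp add: bcontfun_def)
  qed
  then have F: "apply_bcontfun (F y) t = exp (- k * c t) *\<^sub>R X y (c t)" for y t
    unfolding F_def by (subst Bcontfun_inverse) auto
  have "dist (F y) (F z) \<le> 1/2 * dist y z" for y z
  proof (rule dist_bound)
    fix t
    define t' where "t' = c t"
    have t': "t' \<in> {0..T}" using c by (simp add: t'_def)
    have "X y t' - X z t' = integral {0..t'} (\<lambda>s. g s (exp (k * s) *\<^sub>R apply_bcontfun y s) - g s (exp (k * s) *\<^sub>R apply_bcontfun z s))"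
      unfolding X_def by (subst Henstock_Kurzweil_Integration.integral_diff) (auto intro: gi'[OF t'])
    also have "norm \<dots> \<le> integral {0..t'} (\<lambda>s. (L * dist y z) * exp (k * s))"
    proof (rule Henstock_Kurzweil_Integration.integral_norm_bound_integral)
      show "(\<lambda>s. L * dist y z * exp (k * s)) integrable_on {0..t'}"
        by (intro integrable_continuous_real continuous_intros)
      fix s assume s: "s \<in> {0..t'}"
      have "norm (g s (exp (k * s) *\<^sub>R apply_bcontfun y s) - g s (exp (k * s) *\<^sub>R apply_bcontfun z s))
         \<le> L * norm (exp (k * s) *\<^sub>R apply_bcontfun y s - exp (k * s) *\<^sub>R apply_bcontfun z s)"
        using s t' by (intro lip) auto
      also have "\<dots> = L * (exp (k * s) * dist (apply_bcontfun y s) (apply_bcontfun z s))"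
        by (simp add: scaleR_diff_right[symmetric] dist_norm)
      also have "\<dots> \<le> L * (exp (k * s) * dist y z)"
        by (intro mult_left_mono dist_bounded) (use \<open>0 \<le> L\<close> in auto)
      finally show "norm (g s (exp (k * s) *\<^sub>R apply_bcontfun y s) - g s (exp (k * s) *\<^sub>R apply_bcontfun z s))
         \<le> L * dist y z * exp (k * s)" by (simp add: algebra_simps)
    qed (intro Henstock_Kurzweil_Integration.integrable_diff gi'[OF t'])
    also have "\<dots> \<le> (L * dist y z) * exp (k * t') / k"
      using k t' assms by (intro integral_scaled_exp_le) auto
    finally have "exp (- k * t') * norm (X y t' - X z t') \<le> exp (- k * t') * ((L * dist y z) * exp (k * t') / k)"
      by (rule mult_left_mono) simp
    also have "\<dots> = L / k * dist y z" by (simp add: exp_minus)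
    also have "\<dots> \<le> 1 / 2 * dist y z"
      using assms by (intro mult_right_mono) (auto simp: k_def field_simps)
    finally show "dist (apply_bcontfun (F y) t) (apply_bcontfun (F z) t) \<le> 1/2 * dist y z"
      by (simp add: F dist_norm scaleR_diff_right[symmetric] t'_def)
  qed
  then obtain y where y: "F y = y" using banach_fix_type[of "1/2" F] by auto
  define x where "x t = exp (k * t) *\<^sub>R apply_bcontfun y t" for t
  have yc: "continuous_on {0..T} x" unfolding x_def by (intro continuous_intros) auto
  show thesis
  proof (rule that[OF yc])
    fix t assume t: "t \<in> {0..T}"
    then have "c t = t" by (auto simp: c_def)
    then have "x t = X y t" using F[of y t] unfolding y x_def
      by (simp add: mult.assoc[symmetric] exp_add[symmetric])
    then show "x t = x0 + integral {0..t} (\<lambda>s. g s (x s))" by (simp add: X_def x_def)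
  qed
qed


(* A substitute for differentiating absolutely continuous functions: increments of D that are o(1)
   relative to those of an accumulated mass M add up to zero. *)
lemma telescoping_bound_eq_zero:
  fixes D M :: "real \<Rightarrow> real"
  assumes "0 \<le> T" 
    and D: "\<And>e. 0 < e \<Longrightarrow> \<exists>d>0. \<forall>s t. 0 \<le> s \<longrightarrow> s \<le> t \<longrightarrow> t \<le> T \<longrightarrow> t - s < d \<longrightarrow> \<bar>D t - D s\<bar> \<le> e * (M t - M s)"
    and M: "M 0 \<le> M T"
  shows "D T = D 0"
proof -
  have "\<bar>D T - D 0\<bar> \<le> e * (M T - M 0)" if e: "0 < e" for e
  proof -
    obtain d where d: "d > 0" "\<And>s t. 0 \<le> s \<Longrightarrow> s \<le> t \<Longrightarrow> t \<le> T \<Longrightarrow> t - s < d \<Longrightarrow> \<bar>D t - D s\<bar> \<le> e * (M t - M s)"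
      using D[OF e] by blast
    obtain n :: nat where n: "T / d < real n" using reals_Archimedean2 by blast
    then have n0: "n > 0" using \<open>0 \<le> T\<close> d(1) by (cases n) (auto simp: divide_less_0_iff)
    define p where "p i = real i * T / real n" for i :: nat
    have p: "p 0 = 0" "p n = T" using n0 by (auto simp: p_def)
    have "\<bar>D (p (Suc i)) - D (p i)\<bar> \<le> e * (M (p (Suc i)) - M (p i))" if "i < n" for i
    proof (rule d(2))
      show "0 \<le> p i" using \<open>0 \<le> T\<close> by (simp add: p_def)
      show "p i \<le> p (Suc i)" using \<open>0 \<le> T\<close> by (simp add: p_def divide_right_mono mult_right_mono)
      have "real (Suc i) * T \<le> real n * T" using that \<open>0 \<le> T\<close> by (intro mult_right_mono) auto
      then show "p (Suc i) \<le> T" using n0 by (simp add: p_def field_simps)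
      show "p (Suc i) - p i < d" using n n0 d(1) by (simp add: p_def field_simps)
    qed
    then have "(\<Sum>i<n. \<bar>D (p (Suc i)) - D (p i)\<bar>) \<le> (\<Sum>i<n. e * (M (p (Suc i)) - M (p i)))"
      by (intro sum_mono) auto
    moreover have "\<bar>\<Sum>i<n. D (p (Suc i)) - D (p i)\<bar> \<le> (\<Sum>i<n. \<bar>D (p (Suc i)) - D (p i)\<bar>)"
      by (rule sum_abs)
    ultimately show ?thesis using p
      by (simp add: sum_distrib_left[symmetric] sum_lessThan_telescope[of "\<lambda>i. D (p i)"] sum_lessThan_telescope[of "\<lambda>i. M (p i)"])
  qed
  note le = this
  have "\<bar>D T - D 0\<bar> \<le> 0"
  proof (rule field_le_epsilon)
    fix e :: real assume "0 < e"
    have "\<bar>D T - D 0\<bar> \<le> e / (M T - M 0 + 1) * (M T - M 0)"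
      using M \<open>0 < e\<close> by (intro le) auto
    also have "\<dots> \<le> e" using M \<open>0 < e\<close> by (simp add: field_simps)
    finally show "\<bar>D T - D 0\<bar> \<le> 0 + e" by simp
  qed
  then show ?thesis by simp
qed

lemma absolutely_integrable_continuous_inner:
  fixes a G :: "real \<Rightarrow> 'a::euclidean_space"
  assumes "continuous_on {0..T} G" "a absolutely_integrable_on {0..T}"
  shows "(\<lambda>t. G t \<bullet> a t) absolutely_integrable_on {0..T}"
  using assms
  by (intro absolutely_integrable_bounded_measurable_product[of inner])
     (auto simp: bilinear_conv_bounded_bilinear bounded_bilinear_inner
       intro!: continuous_imp_measurable_on_sets_lebesgue compact_imp_bounded compact_continuous_image)

text \<open>D is F . G minus the running integral. On a short interval F t . G t - F s . G s is the
  integral of G t . a + F s . b with frozen factors. Freezing them costs at most the oscillation of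
  F and G times the mass of |a| + |b|, so the increments of D are small relative to those of
  M.\<close>

lemma integral_by_parts_inner:
  fixes F G a b :: "real \<Rightarrow> 'a::euclidean_space"
  assumes T: "0 \<le> T" and a: "a absolutely_integrable_on {0..T}" and b: "b absolutely_integrable_on {0..T}"
    and F: "\<And>t. t \<in> {0..T} \<Longrightarrow> F t = F 0 + integral {0..t} a"
    and G: "\<And>t. t \<in> {0..T} \<Longrightarrow> G t = G 0 + integral {0..t} b"
  shows "integral {0..T} (\<lambda>t. G t \<bullet> a t + F t \<bullet> b t) = F T \<bullet> G T - F 0 \<bullet> G 0"
proof -
  have ai: "a integrable_on {0..T}" and bi: "b integrable_on {0..T}"
    using a b by (auto simp: absolutely_integrable_on_def)
  have Fc: "continuous_on {0..T} F"
    by (rule continuous_on_eq[OF _ F[symmetric]]) (auto intro!: continuous_intros indefinite_integral_continuous_1 ai)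
  have Gc: "continuous_on {0..T} G"
    by (rule continuous_on_eq[OF _ G[symmetric]]) (auto intro!: continuous_intros indefinite_integral_continuous_1 bi)
  have ga: "(\<lambda>t. G t \<bullet> a t) integrable_on {0..T}" and fb: "(\<lambda>t. F t \<bullet> b t) integrable_on {0..T}"
    using absolutely_integrable_continuous_inner[OF Gc a] absolutely_integrable_continuous_inner[OF Fc b]
    by (auto simp: absolutely_integrable_on_def)
  have nab: "(\<lambda>t. norm (a t) + norm (b t)) integrable_on {0..T}"
    using a b by (auto simp: absolutely_integrable_on_def intro!: Henstock_Kurzweil_Integration.integrable_add)
  define M where "M t = integral {0..t} (\<lambda>t. norm (a t) + norm (b t))" for t
  define I where "I t = integral {0..t} (\<lambda>t. G t \<bullet> a t + F t \<bullet> b t)" for t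
  have Ii: "(\<lambda>t. G t \<bullet> a t + F t \<bullet> b t) integrable_on {0..T}"
    by (intro Henstock_Kurzweil_Integration.integrable_add ga fb)
  define D where "D t = F t \<bullet> G t - I t" for t
  have "D T = D 0"
  proof (rule telescoping_bound_eq_zero[where M=M, OF T])
    show "M 0 \<le> M T" unfolding M_def by (simp add: Henstock_Kurzweil_Integration.integral_nonneg nab)
    fix e :: real assume e: "0 < e"
    have "uniformly_continuous_on {0..T} F" "uniformly_continuous_on {0..T} G"
      using Fc Gc by (auto intro: compact_uniformly_continuous)
    then obtain d1 d2 where d1: "d1 > 0" "\<And>s t. s \<in> {0..T} \<Longrightarrow> t \<in> {0..T} \<Longrightarrow> \<bar>t - s\<bar> < d1 \<Longrightarrow> norm (F t - F s) < e"
      and d2: "d2 > 0" "\<And>s t. s \<in> {0..T} \<Longrightarrow> t \<in> {0..T} \<Longrightarrow> \<bar>t - s\<bar> < d2 \<Longrightarrow> norm (G t - G s) < e"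
      using e unfolding uniformly_continuous_on_def dist_norm real_norm_def by metis
    show "\<exists>d>0. \<forall>s t. 0 \<le> s \<longrightarrow> s \<le> t \<longrightarrow> t \<le> T \<longrightarrow> t - s < d \<longrightarrow> \<bar>D t - D s\<bar> \<le> e * (M t - M s)"
    proof (intro exI[of _ "min d1 d2"] conjI allI impI)
      show "0 < min d1 d2" using d1 d2 by simp
      fix s t assume st: "0 \<le> s" "s \<le> t" "t \<le> T" "t - s < min d1 d2"
      have split: "integral {0..t} f = integral {0..s} f + integral {s..t} f"
        if "f integrable_on {0..T}" for f :: "real \<Rightarrow> 'b::euclidean_space"
        using st integrable_on_subinterval[OF that, of 0 t]
        by (subst Henstock_Kurzweil_Integration.integral_combine) auto
      have sub: "f integrable_on {s..t}" if "f integrable_on {0..T}" for f :: "real \<Rightarrow> 'b::euclidean_space"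
        by (rule integrable_on_subinterval[OF that]) (use st in auto)
      have Fd: "F t - F s = integral {s..t} a" and Gd: "G t - G s = integral {s..t} b"
        using F[of t] F[of s] G[of t] G[of s] st split[OF ai] split[OF bi] by auto
      have e1: "integral {s..t} (\<lambda>r. G t \<bullet> a r) = G t \<bullet> (F t - F s)"
        unfolding Fd using sub[OF ai] by (metis integral_linear[OF _ bounded_linear_inner_right, unfolded o_def])
      have e2: "integral {s..t} (\<lambda>r. F s \<bullet> b r) = F s \<bullet> (G t - G s)"
        unfolding Gd using sub[OF bi] by (metis integral_linear[OF _ bounded_linear_inner_right, unfolded o_def])
      have i1: "(\<lambda>r. G t \<bullet> a r) integrable_on {s..t}" "(\<lambda>r. F s \<bullet> b r) integrable_on {s..t}"
        using sub[OF ai] sub[OF bi] by (auto intro!: integrable_linear[OF _ bounded_linear_inner_right, unfolded o_def])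
      have "D t - D s = F t \<bullet> G t - F s \<bullet> G s - integral {s..t} (\<lambda>t. G t \<bullet> a t + F t \<bullet> b t)"
        unfolding D_def I_def split[OF Ii] by simp
      also have "F t \<bullet> G t - F s \<bullet> G s = G t \<bullet> (F t - F s) + F s \<bullet> (G t - G s)"
        by (simp add: inner_diff_right inner_commute)
      also have "\<dots> = integral {s..t} (\<lambda>r. G t \<bullet> a r + F s \<bullet> b r)"
        unfolding e1[symmetric] e2[symmetric] by (rule Henstock_Kurzweil_Integration.integral_add[symmetric, OF i1])
      also have "\<dots> - integral {s..t} (\<lambda>t. G t \<bullet> a t + F t \<bullet> b t)
          = integral {s..t} (\<lambda>r. (G t \<bullet> a r + F s \<bullet> b r) - (G r \<bullet> a r + F r \<bullet> b r))"
        by (rule Henstock_Kurzweil_Integration.integral_diff[symmetric])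
          (intro Henstock_Kurzweil_Integration.integrable_add i1 sub[OF Ii])+
      also have "norm \<dots> \<le> integral {s..t} (\<lambda>r. e * (norm (a r) + norm (b r)))"
      proof (rule Henstock_Kurzweil_Integration.integral_norm_bound_integral)
        show "(\<lambda>r. (G t \<bullet> a r + F s \<bullet> b r) - (G r \<bullet> a r + F r \<bullet> b r)) integrable_on {s..t}"
          by (intro Henstock_Kurzweil_Integration.integrable_diff Henstock_Kurzweil_Integration.integrable_add[OF i1] sub[OF Ii])
        show "(\<lambda>r. e * (norm (a r) + norm (b r))) integrable_on {s..t}"
          using sub[OF nab] by (rule integrable_on_mult_right)
        fix r assume r: "r \<in> {s..t}"
        have "norm ((G t \<bullet> a r + F s \<bullet> b r) - (G r \<bullet> a r + F r \<bullet> b r)) = norm ((G t - G r) \<bullet> a r + (F s - F r) \<bullet> b r)"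
          by (simp add: inner_diff_left)
        also have "\<dots> \<le> norm (G t - G r) * norm (a r) + norm (F s - F r) * norm (b r)"
          by (intro norm_triangle_mono) (auto simp: Cauchy_Schwarz_ineq2)
        also have "\<dots> \<le> e * norm (a r) + e * norm (b r)"
          using d1(2)[of r s] d2(2)[of r t] st r by (intro add_mono mult_right_mono) (auto simp: less_imp_le)
        finally show "norm ((G t \<bullet> a r + F s \<bullet> b r) - (G r \<bullet> a r + F r \<bullet> b r)) \<le> e * (norm (a r) + norm (b r))"
          by (simp add: algebra_simps)
      qed
      also have "\<dots> = e * (M t - M s)" unfolding M_def split[OF nab] by simp
      finally show "\<bar>D t - D s\<bar> \<le> e * (M t - M s)" by simp
    qed
  qed
  then show ?thesis by (simp add: D_def I_def)
qed

section \<open>Theorems of the alternative, a finite partition of unity, and uniform second-order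
  Taylor remainders\<close>

section \<open>Convex alternatives and Taylor expansions\<close>

text \<open>Separates the closed negative quadrant \<open>Q\<close> from the set \<open>S\<close> of
  pairs strictly above some value (g x, h x). A normal that is bounded above on \<open>Q\<close> has
  nonnegative entries, and normalising them gives s and t.\<close>

lemma convex_alternative_two:
  fixes g h :: "'a::real_vector \<Rightarrow> real"
  assumes R: "convex R" and g: "convex_on R g" and h: "convex_on R h"
    and none: "\<And>x. x \<in> R \<Longrightarrow> g x < 0 \<Longrightarrow> h x < 0 \<Longrightarrow> False"
  obtains s t where "0 \<le> s" "0 \<le> t" "s + t = 1" "\<And>x. x \<in> R \<Longrightarrow> 0 \<le> s * g x + t * h x"
proof (cases "R = {}")
  case True
  then show thesis using that[of 1 0] by auto
next
  case False
  define S where "S = {(a, b). \<exists>x\<in>R. g x < a \<and> h x < b}"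
  define Q where "Q = {(a::real, b::real). a \<le> 0 \<and> b \<le> 0}"
  have "convex S"
    unfolding convex_alt
  proof (intro ballI allI impI)
    fix p q :: "real \<times> real" and u :: real
    assume "p \<in> S" "q \<in> S" and u: "0 \<le> u \<and> u \<le> 1"
    then obtain x y where x: "x \<in> R" "g x < fst p" "h x < snd p" and y: "y \<in> R" "g y < fst q" "h y < snd q"
      unfolding S_def by (auto simp: case_prod_beta)
    define w where "w = (1 - u) *\<^sub>R x + u *\<^sub>R y"
    have "w \<in> R" using R x y u by (auto simp: w_def convex_alt)
    have lt: "(1 - u) * a + u * b < (1 - u) * c + u * d" if "a < c" "b < d" for a b c d :: real
    proof (cases "u = 0")
      case False
      then have "(1 - u) * a \<le> (1 - u) * c" "u * b < u * d" using that u by (auto intro: mult_left_mono)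
      then show ?thesis by linarith
    qed (use that in auto)
    have "g w \<le> (1 - u) * g x + u * g y" unfolding w_def using convex_onD[OF g, of u x y] x y u by auto
    then have 1: "g w < fst ((1 - u) *\<^sub>R p + u *\<^sub>R q)" using lt[OF x(2) y(2)] by simp
    have "h w \<le> (1 - u) * h x + u * h y" unfolding w_def using convex_onD[OF h, of u x y] x y u by auto
    then have 2: "h w < snd ((1 - u) *\<^sub>R p + u *\<^sub>R q)" using lt[OF x(3) y(3)] by simp
    show "(1 - u) *\<^sub>R p + u *\<^sub>R q \<in> S" unfolding S_def using 1 2 \<open>w \<in> R\<close> by (auto simp: case_prod_beta)
  qed
  moreover have "convex Q"
    unfolding convex_alt Q_def by (auto intro!: add_nonpos_nonpos mult_nonneg_nonpos)
  moreover have "S \<noteq> {}"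
  proof -
    obtain x where "x \<in> R" using False by blast
    then have "(g x + 1, h x + 1) \<in> S" unfolding S_def by force
    then show ?thesis by blast
  qed
  moreover have Q0: "(0, 0) \<in> Q" unfolding Q_def by simp
  moreover have "Q \<inter> S = {}" using none unfolding Q_def S_def by fastforce
  ultimately obtain m c where m: "m \<noteq> 0" "\<forall>p\<in>Q. m \<bullet> p \<le> c" "\<forall>p\<in>S. c \<le> m \<bullet> p"
    using separating_hyperplane_sets[of Q S] by blast
  obtain s t where st: "m = (s, t)" by (cases m)
  have c0: "0 \<le> c" using m(2) Q0 by (auto simp: st)
  have nn: "0 \<le> v" if "\<And>n::nat. v * (- real n) \<le> c" for v
  proof (rule ccontr)
    assume "\<not> 0 \<le> v"
    then obtain n :: nat where "c / - v < real n" using reals_Archimedean2 by blast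
    then have "c < v * - real n" using \<open>\<not> 0 \<le> v\<close> by (simp add: field_simps)
    then show False using that[of n] by simp
  qed
  have s0: "0 \<le> s" using m(2)[rule_format, of "(- real n, 0)" for n] by (intro nn) (auto simp: Q_def st)
  have t0: "0 \<le> t" using m(2)[rule_format, of "(0, - real n)" for n] by (intro nn) (auto simp: Q_def st)
  have pos: "0 < s + t" using m(1) s0 t0 by (auto simp: st add_nonneg_eq_0_iff less_le zero_prod_def)
  have ge: "0 \<le> s * g x + t * h x" if "x \<in> R" for x
  proof (rule field_le_epsilon)
    fix e :: real assume "0 < e"
    \<comment> \<open>Raising both values by k puts the pair into \<open>S\<close>, where the
      inequalities are strict; the price (s + t) k is exactly e.\<close>
    define k where "k = e / (s + t)"
    have "k > 0" using \<open>0 < e\<close> pos by (simp add: k_def)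
    then have "(g x + k, h x + k) \<in> S" unfolding S_def using that by force
    then have "c \<le> s * (g x + k) + t * (h x + k)" using m(3) by (auto simp: st)
    also have "\<dots> = s * g x + t * h x + (s + t) * k" by (simp add: algebra_simps)
    also have "(s + t) * k = e" using pos by (simp add: k_def)
    finally show "0 \<le> s * g x + t * h x + e" using c0 by simp
  qed
  show thesis
  proof (rule that[of "s / (s + t)" "t / (s + t)"])
    show "s / (s + t) + t / (s + t) = 1" using pos by (simp add: add_divide_distrib[symmetric])
    fix x assume "x \<in> R"
    have "s / (s + t) * g x + t / (s + t) * h x = (s * g x + t * h x) / (s + t)"
      by (simp add: add_divide_distrib)
    then show "0 \<le> s / (s + t) * g x + t / (s + t) * h x" using ge[OF \<open>x \<in> R\<close>] pos by simp
  qed (use s0 t0 in auto)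
qed

text \<open>Induction on I. On the part \<open>R'\<close> of R where g k is negative the induction
  hypothesis merges the remaining functions into one convex h. Then g k and h are never negative
  together, and the case of two functions finishes.\<close>

lemma convex_alternative:
  fixes g :: "'i \<Rightarrow> 'a::real_vector \<Rightarrow> real"
  assumes "finite I" "I \<noteq> {}" "convex R" "\<And>i. i \<in> I \<Longrightarrow> convex_on R (g i)"
    and "\<And>x. x \<in> R \<Longrightarrow> \<exists>i\<in>I. 0 \<le> g i x"
  shows "\<exists>\<alpha>. (\<forall>i\<in>I. 0 \<le> \<alpha> i) \<and> sum \<alpha> I = 1 \<and> (\<forall>x\<in>R. 0 \<le> (\<Sum>i\<in>I. \<alpha> i * g i x))"
  using assms
proof (induction I arbitrary: R rule: finite_ne_induct)
  case (singleton k)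
  then show ?case by (intro exI[of _ "\<lambda>_. 1"]) auto
next
  case (insert k I)
  define R' where "R' = {x \<in> R. g k x < 0}"
  have gk: "convex_on R (g k)" using insert.prems by simp
  have R': "convex R'" 
    unfolding convex_alt
  proof (intro ballI allI impI)
    fix x y u assume xy: "x \<in> R'" "y \<in> R'" and u: "0 \<le> (u::real) \<and> u \<le> 1"
    have "g k ((1 - u) *\<^sub>R x + u *\<^sub>R y) \<le> (1 - u) * g k x + u * g k y"
      using convex_onD[OF gk, of u x y] xy u by (auto simp: R'_def)
    also have "\<dots> < 0"
    proof (cases "u = 0")
      case False
      then have "u * g k y < 0" "(1 - u) * g k x \<le> 0" 
        using xy u unfolding R'_def by (auto intro: mult_pos_neg mult_nonneg_nonpos)
      then show ?thesis by linarith
    qed (use xy in \<open>auto simp: R'_def\<close>)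
    finally show "(1 - u) *\<^sub>R x + u *\<^sub>R y \<in> R'"
      using xy u insert.prems(1) by (auto simp: R'_def convex_alt)
  qed
  have "\<exists>\<alpha>. (\<forall>i\<in>I. 0 \<le> \<alpha> i) \<and> sum \<alpha> I = 1 \<and> (\<forall>x\<in>R'. 0 \<le> (\<Sum>i\<in>I. \<alpha> i * g i x))"
  proof (rule insert.IH[OF R'])
    show "convex_on R' (g i)" if "i \<in> I" for i
      by (rule convex_on_subset[of R]) (use insert.prems(2) that R' in \<open>auto simp: R'_def\<close>)
    show "\<exists>i\<in>I. 0 \<le> g i x" if "x \<in> R'" for x
      using insert.prems(3)[of x] that by (auto simp: R'_def)
  qed
  then obtain \<alpha> where \<alpha>: "\<forall>i\<in>I. 0 \<le> \<alpha> i" "sum \<alpha> I = 1" "\<forall>x\<in>R'. 0 \<le> (\<Sum>i\<in>I. \<alpha> i * g i x)" by blast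
  define h where "h x = (\<Sum>i\<in>I. \<alpha> i * g i x)" for x
  have h: "convex_on R h"
  proof (rule convex_onI[OF _ insert.prems(1)])
    fix u :: real and x y assume u: "0 < u" "u < 1" and xy: "x \<in> R" "y \<in> R"
    have "h ((1 - u) *\<^sub>R x + u *\<^sub>R y) \<le> (\<Sum>i\<in>I. \<alpha> i * ((1 - u) * g i x + u * g i y))"
      unfolding h_def
    proof (intro sum_mono mult_left_mono)
      fix i assume "i \<in> I"
      then show "g i ((1 - u) *\<^sub>R x + u *\<^sub>R y) \<le> (1 - u) * g i x + u * g i y"
        using convex_onD[OF insert.prems(2)[of i], of u x y] u xy by auto
    qed (use \<alpha> in auto)
    also have "\<dots> = (1 - u) * h x + u * h y"
      by (simp add: h_def distrib_left sum.distrib sum_distrib_left mult_ac)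
    finally show "h ((1 - u) *\<^sub>R x + u *\<^sub>R y) \<le> (1 - u) * h x + u * h y" .
  qed
  obtain s t where st: "0 \<le> s" "0 \<le> t" "s + t = 1" "\<And>x. x \<in> R \<Longrightarrow> 0 \<le> s * g k x + t * h x"
  proof (rule convex_alternative_two[OF insert.prems(1) gk h])
    show False if "x \<in> R" "g k x < 0" "h x < 0" for x
      using \<alpha>(3) that by (force simp: h_def R'_def)
  qed blast
  have ne: "i \<noteq> k" if "i \<in> I" for i using that insert by blast
  show ?case
  proof (intro exI[of _ "\<lambda>i. if i = k then s else t * \<alpha> i"] conjI ballI)
    show "0 \<le> (if i = k then s else t * \<alpha> i)" if "i \<in> insert k I" for i using that st \<alpha> by auto
    have "sum (\<lambda>i. if i = k then s else t * \<alpha> i) I = t * sum \<alpha> I"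
      unfolding sum_distrib_left by (intro sum.cong) (auto dest: ne)
    then show "sum (\<lambda>i. if i = k then s else t * \<alpha> i) (insert k I) = 1" using insert \<alpha>(2) st by simp
    fix x assume "x \<in> R"
    have "(\<Sum>i\<in>I. (if i = k then s else t * \<alpha> i) * g i x) = t * h x"
      unfolding sum_distrib_left h_def by (intro sum.cong) (auto dest: ne)
    then show "0 \<le> (\<Sum>i\<in>insert k I. (if i = k then s else t * \<alpha> i) * g i x)"
      using insert st(4)[OF \<open>x \<in> R\<close>] by simp
  qed
qed

text \<open>A convex set with empty interior lies in a hyperplane, and one of the two normals has
  the right sign on it. Otherwise 0 is separated from the interior, and the inequality passes to its
  closure, which contains \<open>C\<close>.\<close>

lemma convex_supporting_functional_if_not_interior:
  fixes C :: "'a::euclidean_space set"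
  assumes C: "convex C" and 0: "0 \<notin> interior C"
  obtains m where "m \<noteq> 0" "\<And>x. x \<in> C \<Longrightarrow> 0 \<le> m \<bullet> x"
proof (cases "interior C = {}")
  case True
  then obtain a b where ab: "a \<noteq> 0" "C \<subseteq> {x. a \<bullet> x = b}" using empty_interior_subset_hyperplane C by metis
  show thesis
  proof (cases "b \<ge> 0")
    case True then show ?thesis using ab by (intro that[of a]) auto
  next
    case False then show ?thesis using ab by (intro that[of "-a"]) auto
  qed
next
  case False
  then obtain a b where ab: "a \<noteq> 0" "\<forall>x\<in>{0}. a \<bullet> x \<le> b" "\<forall>x\<in>interior C. a \<bullet> x \<ge> b"
    using separating_hyperplane_sets[of "{0}" "interior C"] C 0 by auto
  have "closure (interior C) \<subseteq> {x. a \<bullet> x \<ge> b}"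
    by (intro closure_minimal closed_halfspace_ge) (use ab in auto)
  then have "C \<subseteq> {x. a \<bullet> x \<ge> b}" using convex_closure_interior[OF C False] closure_subset by blast
  then show thesis using ab by (intro that[of a]) force+
qed

text \<open>a i and b j stand for the gradients of the inequality and equality constraints at the
  endpoint, c i and d j for the second-order terms that do not depend on the choice of \<rho>. Since
  R is a cone, the affine inequality delivered by separation splits into a homogeneous one on R and
  one for the constants alone.\<close>

lemma cone_constraint_alternative:
  fixes R :: "'a::euclidean_space set" and a :: "'i \<Rightarrow> 'a" and b :: "'j \<Rightarrow> 'a"
  assumes I: "finite I" "I \<noteq> {}" and J: "finite J"
    and R: "convex R" "0 \<in> R" "\<And>x t. x \<in> R \<Longrightarrow> 0 \<le> t \<Longrightarrow> t *\<^sub>R x \<in> R"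
  obtains
    (multiplier) \<alpha> \<beta> where "\<forall>i\<in>I. 0 \<le> \<alpha> i" "(\<Sum>i\<in>I. \<bar>\<alpha> i\<bar>) + (\<Sum>j\<in>J. \<bar>\<beta> j\<bar>) = 1"
      "\<And>\<rho>. \<rho> \<in> R \<Longrightarrow> 0 \<le> (\<Sum>i\<in>I. \<alpha> i * (a i \<bullet> \<rho>)) + (\<Sum>j\<in>J. \<beta> j * (b j \<bullet> \<rho>))"
      "0 \<le> (\<Sum>i\<in>I. \<alpha> i * c i) + (\<Sum>j\<in>J. \<beta> j * d j)"
  | (interior) r where "0 < r" "\<And>p. norm p \<le> r \<Longrightarrow> \<exists>\<rho>\<in>R. \<exists>\<kappa>. (\<forall>j\<in>J. b j \<bullet> \<kappa> = 0) \<and>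
      (\<Sum>j\<in>J. (b j \<bullet> \<rho> + d j) *\<^sub>R b j) + \<kappa> = p \<and> (\<forall>i\<in>I. a i \<bullet> \<rho> + c i \<le> - r)"
proof -
  (* The equality increments are encoded as vectors in the span of the b j; the free component
     \<kappa> orthogonal to it allows C to have interior points. *)
  define C where "C = {(y, \<tau>). \<exists>\<rho>\<in>R. \<exists>\<kappa>. (\<forall>j\<in>J. b j \<bullet> \<kappa> = 0) \<and>
      y = (\<Sum>j\<in>J. (b j \<bullet> \<rho> + d j) *\<^sub>R b j) + \<kappa> \<and> (\<forall>i\<in>I. a i \<bullet> \<rho> + c i \<le> \<tau>)}"
  show thesis
  proof (cases "(0, 0) \<in> interior C")
    case True
    then obtain e where e: "e > 0" "ball (0, 0) e \<subseteq> C" using mem_interior by blast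
    show thesis
    proof (rule interior[of "e / 3"])
      show "0 < e / 3" using e by simp
      fix p :: 'a assume p: "norm p \<le> e / 3"
      have "norm (p, - (e / 3)) \<le> norm p + norm (- (e / 3))" by (rule norm_Pair_le)
      also have "\<dots> < e" using p e by simp
      finally have "(p, - (e / 3)) \<in> C" using e(2) by (force simp: zero_prod_def[symmetric] dist_norm)
      then show "\<exists>\<rho>\<in>R. \<exists>\<kappa>. (\<forall>j\<in>J. b j \<bullet> \<kappa> = 0) \<and>
      (\<Sum>j\<in>J. (b j \<bullet> \<rho> + d j) *\<^sub>R b j) + \<kappa> = p \<and> (\<forall>i\<in>I. a i \<bullet> \<rho> + c i \<le> - (e / 3))"
        unfolding C_def by auto
    qed
  next
    case False
    have "convex C"
      unfolding convex_alt
    proof (intro ballI allI impI)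
      fix p q :: "'a \<times> real" and u :: real
      assume "p \<in> C" "q \<in> C" and u: "0 \<le> u \<and> u \<le> 1"
      then obtain x \<kappa> y \<kappa>' where x: "x \<in> R" "\<forall>j\<in>J. b j \<bullet> \<kappa> = 0" "fst p = (\<Sum>j\<in>J. (b j \<bullet> x + d j) *\<^sub>R b j) + \<kappa>" "\<forall>i\<in>I. a i \<bullet> x + c i \<le> snd p"
       and y: "y \<in> R" "\<forall>j\<in>J. b j \<bullet> \<kappa>' = 0" "fst q = (\<Sum>j\<in>J. (b j \<bullet> y + d j) *\<^sub>R b j) + \<kappa>'" "\<forall>i\<in>I. a i \<bullet> y + c i \<le> snd q"
        unfolding C_def by (auto simp: case_prod_beta)
      define w where "w = (1 - u) *\<^sub>R x + u *\<^sub>R y"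
      have "w \<in> R" using R(1) x y u by (auto simp: w_def convex_alt)
      moreover have "\<forall>j\<in>J. b j \<bullet> ((1 - u) *\<^sub>R \<kappa> + u *\<^sub>R \<kappa>') = 0" using x y by (simp add: inner_add_right)
      moreover have "fst ((1 - u) *\<^sub>R p + u *\<^sub>R q) = (\<Sum>j\<in>J. (b j \<bullet> w + d j) *\<^sub>R b j) + ((1 - u) *\<^sub>R \<kappa> + u *\<^sub>R \<kappa>')"
      proof -
        have "(b j \<bullet> w + d j) *\<^sub>R b j = (1 - u) *\<^sub>R (b j \<bullet> x + d j) *\<^sub>R b j + u *\<^sub>R (b j \<bullet> y + d j) *\<^sub>R b j" for j
          by (simp add: w_def inner_add_right algebra_simps)
        then have "(\<Sum>j\<in>J. (b j \<bullet> w + d j) *\<^sub>R b j) = (1 - u) *\<^sub>R (\<Sum>j\<in>J. (b j \<bullet> x + d j) *\<^sub>R b j) + u *\<^sub>R (\<Sum>j\<in>J. (b j \<bullet> y + d j) *\<^sub>R b j)"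
          by (simp add: sum.distrib scaleR_sum_right)
        then show ?thesis using x y by (simp add: scaleR_add_right)
      qed
      moreover have "\<forall>i\<in>I. a i \<bullet> w + c i \<le> snd ((1 - u) *\<^sub>R p + u *\<^sub>R q)"
      proof
        fix i assume "i \<in> I"
        have "a i \<bullet> w + c i = (1 - u) * (a i \<bullet> x + c i) + u * (a i \<bullet> y + c i)"
          by (simp add: w_def inner_add_right algebra_simps)
        also have "\<dots> \<le> (1 - u) * snd p + u * snd q" using x y u \<open>i \<in> I\<close>
          by (intro add_mono mult_left_mono) auto
        finally show "a i \<bullet> w + c i \<le> snd ((1 - u) *\<^sub>R p + u *\<^sub>R q)" by simp
      qed
      ultimately show "(1 - u) *\<^sub>R p + u *\<^sub>R q \<in> C" unfolding C_def case_prod_beta mem_Collect_eq by blast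
    qed
    then obtain m where m: "m \<noteq> 0" "\<And>x. x \<in> C \<Longrightarrow> 0 \<le> m \<bullet> x"
      using convex_supporting_functional_if_not_interior[of C] False by (metis zero_prod_def)
    obtain \<mu> \<sigma> where ms: "m = (\<mu>, \<sigma>)" by (cases m)
    have ge: "0 \<le> \<mu> \<bullet> (\<Sum>j\<in>J. (b j \<bullet> \<rho> + d j) *\<^sub>R b j) + \<mu> \<bullet> \<kappa> + \<sigma> * \<tau>"
      if "\<rho> \<in> R" "\<forall>j\<in>J. b j \<bullet> \<kappa> = 0" "\<forall>i\<in>I. a i \<bullet> \<rho> + c i \<le> \<tau>" for \<rho> \<kappa> \<tau>
      using m(2)[of "((\<Sum>j\<in>J. (b j \<bullet> \<rho> + d j) *\<^sub>R b j) + \<kappa>, \<tau>)"] that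
      by (auto simp: C_def ms inner_add_right)
    have nonneg: "0 \<le> v" if "\<And>n. 0 \<le> n \<Longrightarrow> 0 \<le> K + n * v" for K v :: real
    proof (rule ccontr)
      assume "\<not> 0 \<le> v"
      then have v: "v < 0" by simp
      then have "0 \<le> (\<bar>K\<bar> + 1) / - v" by (intro divide_nonneg_pos) auto
      moreover have "(\<bar>K\<bar> + 1) / - v * v = - (\<bar>K\<bar> + 1)" using v by simp
      ultimately show False using that[of "(\<bar>K\<bar> + 1) / - v"] by linarith
    qed
    \<comment> \<open>A value of \<tau> that is admissible for \<rho> = 0. Raising it, or adding
      multiples of an orthogonal \<kappa>, stays inside \<open>C\<close>; this yields the signs of
      \<sigma> and of \<mu> . \<kappa>.\<close>
    define \<tau>0 where "\<tau>0 = Max ((\<lambda>i. c i) ` I)"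
    have \<tau>0: "\<forall>i\<in>I. a i \<bullet> 0 + c i \<le> \<tau>0" unfolding \<tau>0_def using I by auto
    have \<sigma>: "0 \<le> \<sigma>"
    proof (rule nonneg)
      fix n :: real assume "0 \<le> n"
      then show "0 \<le> \<mu> \<bullet> (\<Sum>j\<in>J. (b j \<bullet> 0 + d j) *\<^sub>R b j) + \<sigma> * \<tau>0 + n * \<sigma>"
        using ge[of 0 0 "\<tau>0 + n"] R(2) \<tau>0 by (fastforce simp: algebra_simps)
    qed
    have perp: "\<mu> \<bullet> \<kappa> \<ge> 0" if "\<forall>j\<in>J. b j \<bullet> \<kappa> = 0" for \<kappa>
    proof (rule nonneg)
      fix n :: real
      show "0 \<le> \<mu> \<bullet> (\<Sum>j\<in>J. (b j \<bullet> 0 + d j) *\<^sub>R b j) + \<sigma> * \<tau>0 + n * (\<mu> \<bullet> \<kappa>)"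
        using ge[of 0 "n *\<^sub>R \<kappa>" "\<tau>0"] R(2) \<tau>0 that by (auto simp: algebra_simps)
    qed
    define \<beta> where "\<beta> j = \<mu> \<bullet> b j" for j
    have ge': "0 \<le> (\<Sum>j\<in>J. \<beta> j * (b j \<bullet> \<rho> + d j)) + \<sigma> * \<tau>"
      if "\<rho> \<in> R" "\<forall>i\<in>I. a i \<bullet> \<rho> + c i \<le> \<tau>" for \<rho> \<tau>
      using ge[of \<rho> 0 \<tau>] that by (simp add: inner_sum_right \<beta>_def mult.commute)
    have "\<exists>\<alpha>. (\<forall>i\<in>I. 0 \<le> \<alpha> i) \<and> 0 < (\<Sum>i\<in>I. \<bar>\<alpha> i\<bar>) + (\<Sum>j\<in>J. \<bar>\<beta> j\<bar>) \<and>
      (\<forall>\<rho>\<in>R. 0 \<le> (\<Sum>i\<in>I. \<alpha> i * (a i \<bullet> \<rho> + c i)) + (\<Sum>j\<in>J. \<beta> j * (b j \<bullet> \<rho> + d j)))"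
    proof (cases "\<sigma> = 0")
      case True
      \<comment> \<open>With \<sigma> = 0 the normal acts on the equality part only. If every
        \<beta> j vanished, - \<mu> would itself be an admissible \<kappa>, whence \<mu> = 0 and m =
        0.\<close>
      have "\<exists>j\<in>J. \<beta> j \<noteq> 0"
      proof (rule ccontr)
        assume "\<not> (\<exists>j\<in>J. \<beta> j \<noteq> 0)"
        then have "\<mu> \<bullet> (- \<mu>) \<ge> 0" by (intro perp) (auto simp: \<beta>_def inner_commute)
        then have "\<mu> = 0" using inner_ge_zero[of \<mu>] by simp
        then show False using m(1) True by (simp add: ms zero_prod_def)
      qed
      then obtain j where "j \<in> J" "0 < \<bar>\<beta> j\<bar>" by auto
      then have "0 < (\<Sum>j\<in>J. \<bar>\<beta> j\<bar>)" by (intro sum_pos2[OF J]) auto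
      moreover have "0 \<le> (\<Sum>j\<in>J. \<beta> j * (b j \<bullet> \<rho> + d j))" if "\<rho> \<in> R" for \<rho>
      proof -
        have "\<forall>i\<in>I. a i \<bullet> \<rho> + c i \<le> Max ((\<lambda>i. a i \<bullet> \<rho> + c i) ` I)" using I by auto
        from ge'[OF that this] show ?thesis using True by simp
      qed
      ultimately show ?thesis by (intro exI[of _ "\<lambda>_. 0"]) auto
    next
      case False
      then have \<sigma>': "\<sigma> > 0" using \<sigma> by simp
      \<comment> \<open>The least admissible \<tau> is the largest inequality value, so for every
        \<rho> some g i is nonnegative. The g i are affine, and the alternative distributes \<sigma>
        over the inequalities as the weights \<sigma> \<alpha> i.\<close>
      define g where "g i \<rho> = \<sigma> * (a i \<bullet> \<rho> + c i) + (\<Sum>j\<in>J. \<beta> j * (b j \<bullet> \<rho> + d j))" for i \<rho>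
      have "\<exists>\<alpha>. (\<forall>i\<in>I. 0 \<le> \<alpha> i) \<and> sum \<alpha> I = 1 \<and> (\<forall>x\<in>R. 0 \<le> (\<Sum>i\<in>I. \<alpha> i * g i x))"
      proof (rule convex_alternative[OF I R(1)])
        fix i assume "i \<in> I"
        show "convex_on R (g i)"
        proof (rule convex_onI[OF _ R(1)])
          fix t :: real and x y assume "0 < t" "t < 1"
          have "\<beta> j * (b j \<bullet> ((1 - t) *\<^sub>R x + t *\<^sub>R y) + d j) = (1 - t) * (\<beta> j * (b j \<bullet> x + d j)) + t * (\<beta> j * (b j \<bullet> y + d j))" for j
            by (simp add: inner_add_right algebra_simps)
          then have "(\<Sum>j\<in>J. \<beta> j * (b j \<bullet> ((1 - t) *\<^sub>R x + t *\<^sub>R y) + d j)) = (1 - t) * (\<Sum>j\<in>J. \<beta> j * (b j \<bullet> x + d j)) + t * (\<Sum>j\<in>J. \<beta> j * (b j \<bullet> y + d j))"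
            by (simp add: sum.distrib sum_distrib_left)
          then have "g i ((1 - t) *\<^sub>R x + t *\<^sub>R y) = (1 - t) * g i x + t * g i y"
            unfolding g_def by (simp add: inner_add_right algebra_simps)
          then show "g i ((1 - t) *\<^sub>R x + t *\<^sub>R y) \<le> (1 - t) * g i x + t * g i y" by simp
        qed
      next
        fix \<rho> assume "\<rho> \<in> R"
        define \<tau> where "\<tau> = Max ((\<lambda>i. a i \<bullet> \<rho> + c i) ` I)"
        have "\<tau> \<in> (\<lambda>i. a i \<bullet> \<rho> + c i) ` I" unfolding \<tau>_def using I by (intro Max_in) auto
        then obtain i where "i \<in> I" "\<tau> = a i \<bullet> \<rho> + c i" by auto
        moreover have "\<forall>i\<in>I. a i \<bullet> \<rho> + c i \<le> \<tau>" using I by (auto simp: \<tau>_def)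
        ultimately show "\<exists>i\<in>I. 0 \<le> g i \<rho>" using ge'[OF \<open>\<rho> \<in> R\<close>, of \<tau>] by (auto simp: g_def add.commute)
      qed
      then obtain \<alpha> where \<alpha>: "\<forall>i\<in>I. 0 \<le> \<alpha> i" "sum \<alpha> I = 1" "\<forall>x\<in>R. 0 \<le> (\<Sum>i\<in>I. \<alpha> i * g i x)" by blast
      have "(\<Sum>i\<in>I. \<bar>\<sigma> * \<alpha> i\<bar>) = \<sigma> * sum \<alpha> I"
        unfolding sum_distrib_left using \<alpha>(1) \<sigma> by (intro sum.cong) auto
      then have p: "0 < (\<Sum>i\<in>I. \<bar>\<sigma> * \<alpha> i\<bar>) + (\<Sum>j\<in>J. \<bar>\<beta> j\<bar>)"
        using \<alpha>(2) \<sigma>' by (simp add: add_pos_nonneg sum_nonneg)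
      have "(\<Sum>i\<in>I. \<alpha> i * g i x) = (\<Sum>i\<in>I. \<sigma> * \<alpha> i * (a i \<bullet> x + c i)) + (\<Sum>j\<in>J. \<beta> j * (b j \<bullet> x + d j))" for x
      proof -
        have "(\<Sum>i\<in>I. \<alpha> i * g i x) = (\<Sum>i\<in>I. \<sigma> * \<alpha> i * (a i \<bullet> x + c i)) + (\<Sum>i\<in>I. \<alpha> i * (\<Sum>j\<in>J. \<beta> j * (b j \<bullet> x + d j)))"
          unfolding g_def by (simp add: distrib_left sum.distrib mult_ac)
        also have "(\<Sum>i\<in>I. \<alpha> i * (\<Sum>j\<in>J. \<beta> j * (b j \<bullet> x + d j))) = (\<Sum>j\<in>J. \<beta> j * (b j \<bullet> x + d j))"
          using \<alpha>(2) by (simp add: sum_distrib_right[symmetric])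
        finally show ?thesis .
      qed
      then show ?thesis using \<alpha> p \<sigma> by (intro exI[of _ "\<lambda>i. \<sigma> * \<alpha> i"]) auto
    qed
    then obtain \<alpha> where \<alpha>: "\<forall>i\<in>I. 0 \<le> \<alpha> i" and N0: "0 < (\<Sum>i\<in>I. \<bar>\<alpha> i\<bar>) + (\<Sum>j\<in>J. \<bar>\<beta> j\<bar>)"
      and af: "\<And>\<rho>. \<rho>\<in>R \<Longrightarrow> 0 \<le> (\<Sum>i\<in>I. \<alpha> i * (a i \<bullet> \<rho> + c i)) + (\<Sum>j\<in>J. \<beta> j * (b j \<bullet> \<rho> + d j))" by blast
    define N where "N = (\<Sum>i\<in>I. \<bar>\<alpha> i\<bar>) + (\<Sum>j\<in>J. \<bar>\<beta> j\<bar>)"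
    have N: "N > 0" using N0 by (simp add: N_def)
    define K where "K = (\<Sum>i\<in>I. \<alpha> i * c i) + (\<Sum>j\<in>J. \<beta> j * d j)"
    define L where "L \<rho> = (\<Sum>i\<in>I. \<alpha> i * (a i \<bullet> \<rho>)) + (\<Sum>j\<in>J. \<beta> j * (b j \<bullet> \<rho>))" for \<rho>
    have af': "0 \<le> K + L \<rho>" if "\<rho> \<in> R" for \<rho>
      using af[OF that] by (simp add: K_def L_def distrib_left sum.distrib)
    have Lsc: "L (n *\<^sub>R \<rho>) = n * L \<rho>" for n \<rho>
      unfolding L_def by (simp add: distrib_left sum_distrib_left mult_ac)
    \<comment> \<open>A negative value of L would, after scaling \<rho> up within the cone, outweigh
      the constant K.\<close>
    have L: "0 \<le> L \<rho>" if "\<rho> \<in> R" for \<rho>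
    proof (rule nonneg)
      fix n :: real assume "0 \<le> n"
      then show "0 \<le> K + n * L \<rho>" using af'[of "n *\<^sub>R \<rho>"] R(3)[OF that] by (simp add: Lsc)
    qed
    show thesis
    proof (rule multiplier[of "\<lambda>i. \<alpha> i / N" "\<lambda>j. \<beta> j / N"])
      show "\<forall>i\<in>I. 0 \<le> \<alpha> i / N" using \<alpha> N by simp
      have "(\<Sum>i\<in>I. \<bar>\<alpha> i / N\<bar>) + (\<Sum>j\<in>J. \<bar>\<beta> j / N\<bar>) = N / N"
        using N unfolding N_def add_divide_distrib sum_divide_distrib by (simp flip: N_def)
      then show "(\<Sum>i\<in>I. \<bar>\<alpha> i / N\<bar>) + (\<Sum>j\<in>J. \<bar>\<beta> j / N\<bar>) = 1" using N by simp
      show "0 \<le> (\<Sum>i\<in>I. \<alpha> i / N * (a i \<bullet> \<rho>)) + (\<Sum>j\<in>J. \<beta> j / N * (b j \<bullet> \<rho>))" if "\<rho> \<in> R" for \<rho>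
        using L[OF that] N by (simp add: L_def sum_divide_distrib[symmetric] add_divide_distrib[symmetric])
      show "0 \<le> (\<Sum>i\<in>I. \<alpha> i / N * c i) + (\<Sum>j\<in>J. \<beta> j / N * d j)"
        using af'[OF R(2)] N by (simp add: K_def L_def sum_divide_distrib[symmetric] add_divide_distrib[symmetric])
    qed
  qed
qed

text \<open>Tent functions of radius \<delta> around a finite \<delta>-net, divided by their sum.
  Only net points within \<delta> of p carry weight, so the weighted mean of the net is within
  \<delta> of p. A choice made at finitely many points thereby becomes a family that is continuous
  in p.\<close>

lemma partition_of_unity_finite_net:
  fixes K :: "'a::real_normed_vector set"
  assumes K: "compact K" and \<delta>: "0 < \<delta>"
  obtains Q c where "finite Q" "Q \<subseteq> K" "\<And>q. continuous_on K (c q)"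
    "\<And>q p. p \<in> K \<Longrightarrow> 0 \<le> c q p" "\<And>p. p \<in> K \<Longrightarrow> (\<Sum>q\<in>Q. c q p) = (1::real)"
    "\<And>p. p \<in> K \<Longrightarrow> norm ((\<Sum>q\<in>Q. c q p *\<^sub>R q) - p) \<le> \<delta>"
proof -
  obtain Q where Q: "finite Q" "Q \<subseteq> K" "K \<subseteq> (\<Union>q\<in>Q. ball q \<delta>)"
    by (rule compactE_image[OF K, of K "\<lambda>q. ball q \<delta>"]) (use \<delta> in auto)
  define m where "m q p = max 0 (\<delta> - dist q p)" for q p :: 'a
  define S where "S p = (\<Sum>q\<in>Q. m q p)" for p
  have m0: "0 \<le> m q p" for q p by (simp add: m_def)
  have S: "S p > 0" if p: "p \<in> K" for p
  proof -
    obtain q where "q \<in> Q" "dist q p < \<delta>" using Q(3) p by auto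
    then show ?thesis unfolding S_def by (intro sum_pos2[OF Q(1)]) (auto simp: m_def)
  qed
  have one: "(\<Sum>q\<in>Q. m q p / S p) = 1" if "p \<in> K" for p
    using S[OF that] by (simp add: S_def sum_divide_distrib[symmetric])
  show thesis
  proof (rule that[of Q "\<lambda>q p. m q p / S p"])
    show "continuous_on K (\<lambda>p. m q p / S p)" for q
      unfolding m_def[abs_def] using S unfolding S_def m_def
      by (intro continuous_intros) (metis less_irrefl)
    fix p assume p: "p \<in> K"
    show "0 \<le> m q p / S p" for q using m0 S[OF p] by simp
    have "(\<Sum>q\<in>Q. (m q p / S p) *\<^sub>R q) - p = (\<Sum>q\<in>Q. (m q p / S p) *\<^sub>R (q - p))"
      using one[OF p] by (simp add: scaleR_diff_right sum_subtractf scaleR_sum_left[symmetric] del: scaleR_sum_left)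
    also have "norm \<dots> \<le> (\<Sum>q\<in>Q. (m q p / S p) * \<delta>)"
    proof (rule sum_norm_le)
      fix q assume "q \<in> Q"
      show "norm ((m q p / S p) *\<^sub>R (q - p)) \<le> (m q p / S p) * \<delta>"
      proof (cases "dist q p < \<delta>")
        case True
        then show ?thesis using m0[of q p] S[OF p] by (auto simp: dist_norm intro!: divide_right_mono mult_left_mono)
      qed (simp add: m_def)
    qed
    also have "\<dots> = \<delta>" unfolding sum_distrib_right[symmetric] one[OF p] by simp
    finally show "norm ((\<Sum>q\<in>Q. (m q p / S p) *\<^sub>R q) - p) \<le> \<delta>" .
  qed (use Q one in auto)
qed

text \<open>Asks only that f' be nearly linear along the segment from x to x + y, so that it serves
  both C2 fields uniformly over a ball and twice differentiable functions expanded at a single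
  point. It is the mean value inequality for h, whose derivative is the defect of that linear
  approximation applied to y.\<close>

lemma second_order_taylor_bound:
  fixes f :: "'a::real_normed_vector \<Rightarrow> 'b::real_normed_vector"
  assumes f: "\<And>x. (f has_derivative blinfun_apply (f' x)) (at x)"
    and le: "\<And>\<tau>. \<tau> \<in> {0..1} \<Longrightarrow> norm (f' (x + \<tau> *\<^sub>R y) - f' x - blinfun_apply H (\<tau> *\<^sub>R y)) \<le> \<delta> * norm (\<tau> *\<^sub>R y)"
    and \<delta>: "0 \<le> \<delta>"
  shows "norm (f (x + y) - f x - f' x y - (1/2) *\<^sub>R blinfun_apply (blinfun_apply H y) y) \<le> \<delta> * (norm y)\<^sup>2"
proof -
  define h where "h \<tau> = f (x + \<tau> *\<^sub>R y) - \<tau> *\<^sub>R f' x y - (\<tau>\<^sup>2 / 2) *\<^sub>R blinfun_apply (blinfun_apply H y) y" for \<tau> :: real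
  define h' where "h' \<tau> = blinfun_apply (f' (x + \<tau> *\<^sub>R y) - f' x - blinfun_apply H (\<tau> *\<^sub>R y)) y" for \<tau>
  have deriv: "(h has_vector_derivative h' \<tau>) (at \<tau> within {0..1})" for \<tau>
  proof -
    have "((\<lambda>\<tau>. x + \<tau> *\<^sub>R y) has_derivative (\<lambda>s. s *\<^sub>R y)) (at \<tau> within {0..1})"
      by (auto intro!: derivative_eq_intros)
    then have "((\<lambda>\<tau>. f (x + \<tau> *\<^sub>R y)) has_derivative (\<lambda>s. blinfun_apply (f' (x + \<tau> *\<^sub>R y)) (s *\<^sub>R y))) (at \<tau> within {0..1})"
      by (rule has_derivative_compose) (rule f)
    then have "((\<lambda>\<tau>. f (x + \<tau> *\<^sub>R y)) has_vector_derivative f' (x + \<tau> *\<^sub>R y) y) (at \<tau> within {0..1})"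
      by (simp add: has_vector_derivative_def blinfun.scaleR_right)
    moreover have "((\<lambda>\<tau>. \<tau>\<^sup>2 / 2) has_real_derivative \<tau>) (at \<tau> within {0..1})"
      by (auto intro!: derivative_eq_intros)
    ultimately show ?thesis unfolding h_def h'_def
      by (auto intro!: derivative_eq_intros simp: blinfun.diff_left blinfun.scaleR_left blinfun.scaleR_right)
  qed
  have "norm (h 1 - h 0) \<le> (\<delta> * (norm y)\<^sup>2) * norm (1 - 0 :: real)"
  proof (rule differentiable_bound[of "{0..1}" h "\<lambda>\<tau> s. s *\<^sub>R h' \<tau>"])
    show "(h has_derivative (\<lambda>s. s *\<^sub>R h' \<tau>)) (at \<tau> within {0..1})" for \<tau>
      using deriv[of \<tau>] by (simp add: has_vector_derivative_def)
    fix \<tau> :: real assume \<tau>: "\<tau> \<in> {0..1}"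
    have "norm (h' \<tau>) \<le> norm (f' (x + \<tau> *\<^sub>R y) - f' x - blinfun_apply H (\<tau> *\<^sub>R y)) * norm y"
      unfolding h'_def by (rule norm_blinfun)
    also have "\<dots> \<le> (\<delta> * norm (\<tau> *\<^sub>R y)) * norm y" by (intro mult_right_mono le \<tau>) auto
    also have "\<dots> = \<tau> * (\<delta> * (norm y)\<^sup>2)" using \<tau> by (simp add: power2_eq_square)
    also have "\<dots> \<le> 1 * (\<delta> * (norm y)\<^sup>2)" using \<tau> \<delta> by (intro mult_right_mono) auto
    finally have "norm (h' \<tau>) \<le> \<delta> * (norm y)\<^sup>2" by simp
    then show "onorm (\<lambda>s. s *\<^sub>R h' \<tau>) \<le> \<delta> * (norm y)\<^sup>2"
      by (intro onorm_le) (simp add: mult.commute mult_left_mono)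
  qed auto
  then show ?thesis by (simp add: h_def algebra_simps)
qed

text \<open>Uniform continuity of g' on the closed 1-neighbourhood of K makes the differentiability
  estimate uniform. It is meant for a first derivative in the role of g, to supply near linearity of
  that derivative over a whole ball.\<close>

lemma uniform_derivative_approx_on_compact:
  fixes g :: "'a::euclidean_space \<Rightarrow> 'b::real_normed_vector"
  assumes g: "\<And>x. (g has_derivative blinfun_apply (g' x)) (at x)" and cont: "continuous_on UNIV g'"
    and K: "compact K" and \<delta>: "0 < \<delta>"
  obtains r where "0 < r" "\<And>x y. x \<in> K \<Longrightarrow> norm y \<le> r \<Longrightarrow> norm (g (x + y) - g x - g' x y) \<le> \<delta> * norm y"
proof -
  define K' where "K' = {x + y |x y. x \<in> K \<and> y \<in> cball 0 1}"
  have "compact K'" unfolding K'_def by (intro compact_sums K) auto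
  then have "uniformly_continuous_on K' g'"
    by (intro compact_uniformly_continuous continuous_on_subset[OF cont]) auto
  then obtain r where r: "r > 0" "\<And>x y. x \<in> K' \<Longrightarrow> y \<in> K' \<Longrightarrow> dist y x < r \<Longrightarrow> dist (g' y) (g' x) < \<delta>"
    unfolding uniformly_continuous_on_def using \<delta> by metis
  show thesis
  proof (rule that[of "min 1 (r / 2)"])
    show "0 < min 1 (r / 2)" using r by simp
    fix x y :: 'a assume x: "x \<in> K" and y: "norm y \<le> min 1 (r / 2)"
    define S where "S = cball x (min 1 (r / 2))"
    have S: "z \<in> K'" if "z \<in> S" for z
      unfolding K'_def using x that by (intro CollectI exI[of _ x] exI[of _ "z - x"]) (auto simp: S_def dist_norm norm_minus_commute)
    have xS: "x \<in> S" using r by (simp add: S_def)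
    have "norm (g (x + y) - g x - g' x (x + y - x)) \<le> norm (x + y - x) * \<delta>"
    proof (rule differentiable_bound_linearization[where S=S])
      show "x + t *\<^sub>R (x + y - x) \<in> S" if t: "t \<in> {0..1}" for t
      proof -
        have "norm (t *\<^sub>R y) \<le> norm y" using t by (simp add: mult_left_le_one_le)
        then show ?thesis using y by (simp add: S_def dist_norm)
      qed
      show "(g has_derivative blinfun_apply (g' z)) (at z within S)" for z
        using g by (rule has_derivative_at_withinI)
      show "onorm (blinfun_apply (g' z) - blinfun_apply (g' x)) \<le> \<delta>" if "z \<in> S" for z
      proof -
        have "dist z x < r" using that r(1) by (auto simp: S_def dist_commute)
        then have "dist (g' z) (g' x) < \<delta>" using S xS that by (intro r(2)) auto
        then show ?thesis by (simp add: dist_norm norm_blinfun.rep_eq minus_blinfun.rep_eq fun_diff_def)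
      qed
    qed (rule xS)
    then show "norm (g (x + y) - g x - g' x y) \<le> \<delta> * norm y" by (simp add: mult.commute)
  qed
qed

text \<open>Taylor's formula at the increment y = \<epsilon> z + \<epsilon>^2 \<zeta>: the quadratic
  form at y is \<epsilon>^2 times that at z up to terms of order \<epsilon>^3. The bounds on z and
  \<zeta> make the remainder uniform.\<close>

lemma second_order_expansion:
  fixes f :: "'a::real_normed_vector \<Rightarrow> 'b::real_normed_vector"
  assumes f: "\<And>x. (f has_derivative blinfun_apply (f' x)) (at x)"
    and unif: "\<And>\<delta>. 0 < \<delta> \<Longrightarrow> \<exists>r>0. \<forall>x\<in>X. \<forall>y. norm y \<le> r \<longrightarrow>
        norm (f' (x + y) - f' x - blinfun_apply (f'' x) y) \<le> \<delta> * norm y"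
    and K: "\<And>x. x \<in> X \<Longrightarrow> norm (f'' x) \<le> K" and "0 < \<delta>" "0 \<le> M"
  obtains \<epsilon>0 where "0 < \<epsilon>0" "\<And>\<epsilon> x z \<zeta>. 0 < \<epsilon> \<Longrightarrow> \<epsilon> \<le> \<epsilon>0 \<Longrightarrow> x \<in> X \<Longrightarrow> norm z \<le> M \<Longrightarrow> norm \<zeta> \<le> M \<Longrightarrow>
     norm (f (x + \<epsilon> *\<^sub>R z + \<epsilon>\<^sup>2 *\<^sub>R \<zeta>) - f x - \<epsilon> *\<^sub>R f' x z - \<epsilon>\<^sup>2 *\<^sub>R (f' x \<zeta> + (1/2) *\<^sub>R f'' x z z)) \<le> \<delta> * \<epsilon>\<^sup>2"
proof -
  define K' where "K' = max K 0"
  have K': "0 \<le> K'" "\<And>x. x \<in> X \<Longrightarrow> norm (f'' x) \<le> K'" using K by (force simp: K'_def)+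
  \<comment> \<open>Since |y| is at most 2 M \<epsilon>, the Taylor error \<delta>' |y|^2 is at most
    4 M^2 \<delta>' \<epsilon>^2, which uses at most half of the allowance \<delta>
    \<epsilon>^2.\<close>
  define \<delta>' where "\<delta>' = \<delta> / (8 * M\<^sup>2 + 1)"
  have \<delta>': "0 < \<delta>'" using \<open>0 < \<delta>\<close> by (auto simp: \<delta>'_def intro!: divide_pos_pos add_nonneg_pos)
  obtain r where r: "r > 0" "\<And>x y. x \<in> X \<Longrightarrow> norm y \<le> r \<Longrightarrow>
        norm (f' (x + y) - f' x - blinfun_apply (f'' x) y) \<le> \<delta>' * norm y" using unif[OF \<delta>'] by blast
  \<comment> \<open>In order: \<epsilon>^2 is at most \<epsilon>; y stays within the radius r; the
    three cubic terms use at most the other half of the allowance.\<close>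
  define \<epsilon>0 where "\<epsilon>0 = min 1 (min (r / (2 * M + 1)) (\<delta> / (3 * K' * M\<^sup>2 + 1)))"
  have p1: "0 < 3 * K' * M\<^sup>2 + 1" using K'(1) by (intro add_nonneg_pos) auto
  have p2: "0 < 2 * M + 1" using \<open>0 \<le> M\<close> by simp
  show thesis
  proof (rule that[of \<epsilon>0])
    show "0 < \<epsilon>0" using r(1) p1 p2 \<open>0 < \<delta>\<close> by (simp add: \<epsilon>0_def)
    fix \<epsilon> :: real and x z \<zeta> :: 'a assume \<epsilon>: "0 < \<epsilon>" "\<epsilon> \<le> \<epsilon>0" and x: "x \<in> X" and z: "norm z \<le> M" "norm \<zeta> \<le> M"
    have \<epsilon>1: "\<epsilon> \<le> 1" "\<epsilon> \<le> r / (2 * M + 1)" "\<epsilon> \<le> \<delta> / (3 * K' * M\<^sup>2 + 1)" using \<epsilon> by (auto simp: \<epsilon>0_def)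
    have \<epsilon>2: "\<epsilon>\<^sup>2 \<le> \<epsilon>" using \<epsilon> \<epsilon>1 by (simp add: power2_eq_square)
    define y where "y = \<epsilon> *\<^sub>R z + \<epsilon>\<^sup>2 *\<^sub>R \<zeta>"
    have "norm y \<le> \<epsilon> * norm z + \<epsilon>\<^sup>2 * norm \<zeta>" unfolding y_def using \<epsilon> by (intro norm_triangle_le) simp
    also have "\<dots> \<le> \<epsilon> * M + \<epsilon> * M" using z \<epsilon> \<epsilon>2 \<open>0 \<le> M\<close> by (intro add_mono mult_mono) auto
    finally have y: "norm y \<le> 2 * M * \<epsilon>" by simp
    have "\<epsilon> * (2 * M + 1) \<le> r" using \<epsilon>1(2) p2 by (simp add: pos_le_divide_eq)
    then have yr: "norm y \<le> r" using y \<epsilon> by (simp add: algebra_simps)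
    have A: "norm (f (x + y) - f x - f' x y - (1/2) *\<^sub>R f'' x y y) \<le> \<delta>' * (norm y)\<^sup>2"
    proof (rule second_order_taylor_bound[OF f])
      fix \<tau> :: real assume \<tau>: "\<tau> \<in> {0..1}"
      have "norm (\<tau> *\<^sub>R y) \<le> norm y" using \<tau> by (simp add: mult_left_le_one_le)
      then show "norm (f' (x + \<tau> *\<^sub>R y) - f' x - blinfun_apply (f'' x) (\<tau> *\<^sub>R y)) \<le> \<delta>' * norm (\<tau> *\<^sub>R y)"
        using yr by (intro r(2) x) linarith
    qed (use \<delta>' in auto)
    have "(norm y)\<^sup>2 \<le> (2 * M * \<epsilon>)\<^sup>2" using y by (intro power_mono) auto
    then have "\<delta>' * (norm y)\<^sup>2 \<le> \<delta>' * (2 * M * \<epsilon>)\<^sup>2" using \<delta>' by simp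
    also have "\<dots> = (8 * M\<^sup>2 / (8 * M\<^sup>2 + 1)) * (\<delta> / 2 * \<epsilon>\<^sup>2)" by (simp add: \<delta>'_def power_mult_distrib divide_simps)
    also have "\<dots> \<le> 1 * (\<delta> / 2 * \<epsilon>\<^sup>2)" using \<open>0 < \<delta>\<close> by (intro mult_right_mono) (auto simp: divide_le_eq_1 add_nonneg_pos)
    finally have A': "\<delta>' * (norm y)\<^sup>2 \<le> \<delta> / 2 * \<epsilon>\<^sup>2" by simp
    define E :: 'b where "E = (\<epsilon>^3) *\<^sub>R (f'' x z \<zeta> + f'' x \<zeta> z + \<epsilon> *\<^sub>R f'' x \<zeta> \<zeta>)"
    have quad: "f'' x y y = \<epsilon>\<^sup>2 *\<^sub>R f'' x z z + E"
      unfolding y_def E_def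
      by (simp add: blinfun.add_left blinfun.add_right blinfun.scaleR_left blinfun.scaleR_right algebra_simps power2_eq_square power3_eq_cube)
    have bil: "norm (f'' x p q) \<le> K' * M\<^sup>2" if "norm p \<le> M" "norm q \<le> M" for p q
    proof -
      have "norm (f'' x p q) \<le> norm (f'' x p) * norm q" by (rule norm_blinfun)
      also have "\<dots> \<le> (norm (f'' x) * norm p) * norm q" by (intro mult_right_mono norm_blinfun) auto
      also have "\<dots> \<le> (K' * M) * M" using that K'(1) K'(2)[OF x] \<open>0 \<le> M\<close> by (intro mult_mono mult_nonneg_nonneg) auto
      finally show ?thesis by (simp add: power2_eq_square mult.assoc)
    qed
    have "norm E \<le> \<epsilon>^3 * (3 * (K' * M\<^sup>2))"
    proof -
      have "norm (\<epsilon> *\<^sub>R f'' x \<zeta> \<zeta>) \<le> 1 * (K' * M\<^sup>2)" using \<epsilon> \<epsilon>1 bil[OF z(2) z(2)] by (simp only: norm_scaleR, intro mult_mono) auto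
      then have "norm (f'' x z \<zeta> + f'' x \<zeta> z + \<epsilon> *\<^sub>R f'' x \<zeta> \<zeta>) \<le> K' * M\<^sup>2 + K' * M\<^sup>2 + K' * M\<^sup>2"
        using bil z by (intro norm_triangle_mono) auto
      then have "\<epsilon>^3 * norm (f'' x z \<zeta> + f'' x \<zeta> z + \<epsilon> *\<^sub>R f'' x \<zeta> \<zeta>) \<le> \<epsilon>^3 * (3 * (K' * M\<^sup>2))" using \<epsilon> by (intro mult_left_mono) auto
      then show ?thesis unfolding E_def using \<epsilon> by simp
    qed
    also have "\<dots> = \<epsilon>\<^sup>2 * (\<epsilon> * (3 * K' * M\<^sup>2))" by (simp add: power2_eq_square power3_eq_cube)
    also have "\<dots> \<le> \<epsilon>\<^sup>2 * \<delta>"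
    proof (rule mult_left_mono)
      have "\<epsilon> * (3 * K' * M\<^sup>2 + 1) \<le> \<delta>" using \<epsilon>1(3) p1 by (simp add: pos_le_divide_eq)
      then show "\<epsilon> * (3 * K' * M\<^sup>2) \<le> \<delta>" using \<epsilon> by (simp add: algebra_simps)
    qed simp
    finally have E: "norm ((1/2) *\<^sub>R E) \<le> \<delta> / 2 * \<epsilon>\<^sup>2" by (simp add: mult.commute)
    have "f (x + \<epsilon> *\<^sub>R z + \<epsilon>\<^sup>2 *\<^sub>R \<zeta>) - f x - \<epsilon> *\<^sub>R f' x z - \<epsilon>\<^sup>2 *\<^sub>R (f' x \<zeta> + (1/2) *\<^sub>R f'' x z z)
        = (f (x + y) - f x - f' x y - (1/2) *\<^sub>R f'' x y y) + (1/2) *\<^sub>R E"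
      unfolding quad unfolding y_def
      by (simp add: blinfun.add_right blinfun.scaleR_right algebra_simps)
    then show "norm (f (x + \<epsilon> *\<^sub>R z + \<epsilon>\<^sup>2 *\<^sub>R \<zeta>) - f x - \<epsilon> *\<^sub>R f' x z - \<epsilon>\<^sup>2 *\<^sub>R (f' x \<zeta> + (1/2) *\<^sub>R f'' x z z)) \<le> \<delta> * \<epsilon>\<^sup>2"
      using norm_triangle_mono[OF order_trans[OF A A'] E] by (simp only: distrib_right[symmetric] field_sum_of_halves)
  qed
qed

section \<open>Linear differential equations in integral form: bounds, adjoints, endpoint duality,
  attainable endpoints\<close>

section \<open>Linear systems\<close>

lemma absolutely_integrable_cmul:
  fixes f :: "'a::euclidean_space \<Rightarrow> 'b::euclidean_space"
  assumes "f absolutely_integrable_on S"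
  shows "(\<lambda>x. c *\<^sub>R f x) absolutely_integrable_on S"
  using absolutely_integrable_linear[OF assms bounded_linear_scaleR_right] by (simp add: o_def)

lemma has_integral_reflect_shift:
  fixes f :: "real \<Rightarrow> 'a::euclidean_space"
  assumes "(f has_integral I) {a..b}"
  shows "((\<lambda>s. f (T - s)) has_integral I) {T - b..T - a}"
proof -
  have "((\<lambda>x. f (- x)) has_integral I) {-b..-a}" using assms by simp
  from has_integral_shift_real_ivl[OF this, of "-T"] show ?thesis by (simp add: algebra_simps)
qed

text \<open>\<open>int\<close> expresses the measurability of t -> A t in the form in which integral
  equations consume it: continuous curves are sent to integrable ones.\<close>

locale linear_system =
  fixes T L :: real and A :: "real \<Rightarrow> 'a::euclidean_space \<Rightarrow> 'a"
  assumes T: "0 < T" and L: "0 \<le> L"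
    and lin: "\<And>t. t \<in> {0..T} \<Longrightarrow> linear (A t)"
    and bound: "\<And>t x. t \<in> {0..T} \<Longrightarrow> norm (A t x) \<le> L * norm x"
    and int: "\<And>x. continuous_on {0..T} x \<Longrightarrow> (\<lambda>t. A t (x t)) absolutely_integrable_on {0..T}"
begin

text \<open>Integral form of y' = A y + h with y 0 = 0. Integrability of h and continuity of y
  belong to the predicate so that solutions can be added, scaled and estimated without side
  conditions.\<close>

definition sol :: "(real \<Rightarrow> 'a) \<Rightarrow> (real \<Rightarrow> 'a) \<Rightarrow> bool" where
  "sol h y \<longleftrightarrow> h absolutely_integrable_on {0..T} \<and> continuous_on {0..T} y \<and>
     (\<forall>t\<in>{0..T}. y t = integral {0..t} (\<lambda>s. A s (y s) + h s))"

lemma solD: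
  assumes "sol h y"
  shows "h absolutely_integrable_on {0..T}" "continuous_on {0..T} y"
    "\<And>t. t \<in> {0..T} \<Longrightarrow> y t = integral {0..t} (\<lambda>s. A s (y s) + h s)"
  using assms unfolding sol_def by blast+

lemma sol_abs_int:
  assumes "sol h y" shows "(\<lambda>s. A s (y s) + h s) absolutely_integrable_on {0..T}"
  by (intro set_integral_add(1) int solD[OF assms])

lemma abs_int_sub:
  fixes f :: "real \<Rightarrow> 'b::euclidean_space"
  assumes "f absolutely_integrable_on {0..T}" "t \<in> {0..T}" shows "f integrable_on {0..t}"
proof -
  have "f integrable_on {0..T}" using assms by (simp add: absolutely_integrable_on_def)
  then show ?thesis by (rule integrable_on_subinterval) (use assms in auto)
qed

lemma norm_abs_int_sub:
  fixes f :: "real \<Rightarrow> 'b::euclidean_space"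
  assumes "f absolutely_integrable_on {0..T}" "t \<in> {0..T}" shows "(\<lambda>s. norm (f s)) integrable_on {0..t}"
    "integral {0..t} (\<lambda>s. norm (f s)) \<le> integral {0..T} (\<lambda>s. norm (f s))"
proof -
  have i: "(\<lambda>s. norm (f s)) integrable_on {0..T}" using assms by (simp add: absolutely_integrable_on_def)
  then show i2: "(\<lambda>s. norm (f s)) integrable_on {0..t}" by (rule integrable_on_subinterval) (use assms in auto)
  show "integral {0..t} (\<lambda>s. norm (f s)) \<le> integral {0..T} (\<lambda>s. norm (f s))"
    by (rule integral_subset_le) (use assms i i2 in auto)
qed

lemma sol_exists:
  assumes h: "h absolutely_integrable_on {0..T}"
  obtains y where "sol h y"
proof -
  obtain y where y: "continuous_on {0..T} y" "\<And>t. t \<in> {0..T} \<Longrightarrow> y t = 0 + integral {0..t} (\<lambda>s. A s (y s) + h s)"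
  proof (rule integral_equation_exists[of T L "\<lambda>s x. A s x + h s" 0])
    show "(\<lambda>s. A s (x s) + h s) integrable_on {0..T}" if "continuous_on {0..T} x" for x
      using int[OF that] h by (intro Henstock_Kurzweil_Integration.integrable_add) (auto simp: absolutely_integrable_on_def)
    show "norm (A s x + h s - (A s y + h s)) \<le> L * norm (x - y)" if "s \<in> {0..T}" for s x y
      using bound[OF that, of "x - y"] linear_diff[OF lin[OF that], of x y] by simp
  qed (use T L in auto)
  show thesis
    by (rule that[of y]) (use y h in \<open>simp only: sol_def add_0_left, blast\<close>)
qed

lemma sol_0: "sol (\<lambda>_. 0) (\<lambda>_. 0)"
proof -
  have "integral {0..t} (\<lambda>s. A s 0) = integral {0..t} (\<lambda>s. 0 :: 'a)" if "t \<in> {0..T}" for t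
    by (rule integral_cong) (use that linear_0[OF lin] in auto)
  then show ?thesis by (auto simp: sol_def)
qed

lemma sol_add:
  assumes "sol h y" "sol k z" shows "sol (\<lambda>t. h t + k t) (\<lambda>t. y t + z t)"
  unfolding sol_def
proof (intro conjI ballI)
  show "(\<lambda>t. h t + k t) absolutely_integrable_on {0..T}" by (intro set_integral_add(1) solD(1)[OF assms(1)] solD(1)[OF assms(2)])
  show "continuous_on {0..T} (\<lambda>t. y t + z t)" by (intro continuous_intros solD(2)[OF assms(1)] solD(2)[OF assms(2)])
  fix t assume t: "t \<in> {0..T}"
  have "integral {0..t} (\<lambda>s. A s (y s + z s) + (h s + k s)) = integral {0..t} (\<lambda>s. (A s (y s) + h s) + (A s (z s) + k s))"
    by (rule integral_cong) (use t linear_add[OF lin] in auto)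
  also have "\<dots> = y t + z t" unfolding solD(3)[OF assms(1) t] solD(3)[OF assms(2) t]
    by (rule Henstock_Kurzweil_Integration.integral_add[OF abs_int_sub[OF sol_abs_int[OF assms(1)] t] abs_int_sub[OF sol_abs_int[OF assms(2)] t]])
  finally show "y t + z t = integral {0..t} (\<lambda>s. A s (y s + z s) + (h s + k s))" by simp
qed

lemma sol_scaleR:
  assumes "sol h y" shows "sol (\<lambda>t. c *\<^sub>R h t) (\<lambda>t. c *\<^sub>R y t)"
  unfolding sol_def
proof (intro conjI ballI)
  show "(\<lambda>t. c *\<^sub>R h t) absolutely_integrable_on {0..T}" by (intro absolutely_integrable_cmul solD(1)[OF assms])
  show "continuous_on {0..T} (\<lambda>t. c *\<^sub>R y t)" by (intro continuous_intros solD(2)[OF assms])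
  fix t assume t: "t \<in> {0..T}"
  have "integral {0..t} (\<lambda>s. A s (c *\<^sub>R y s) + c *\<^sub>R h s) = integral {0..t} (\<lambda>s. c *\<^sub>R (A s (y s) + h s))"
    by (rule integral_cong) (use t linear_cmul[OF lin] in \<open>auto simp: scaleR_add_right\<close>)
  also have "\<dots> = c *\<^sub>R y t" unfolding solD(3)[OF assms t] by (rule integral_cmul)
  finally show "c *\<^sub>R y t = integral {0..t} (\<lambda>s. A s (c *\<^sub>R y s) + c *\<^sub>R h s)" by simp
qed

lemma sol_sum:
  assumes "finite Q" "\<And>q. q \<in> Q \<Longrightarrow> sol (h q) (y q)"
  shows "sol (\<lambda>t. \<Sum>q\<in>Q. c q *\<^sub>R h q t) (\<lambda>t. \<Sum>q\<in>Q. c q *\<^sub>R y q t)"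
  using assms
proof (induction Q rule: finite_induct)
  case (insert x Q)
  then have "sol (\<lambda>t. c x *\<^sub>R h x t + (\<Sum>q\<in>Q. c q *\<^sub>R h q t)) (\<lambda>t. c x *\<^sub>R y x t + (\<Sum>q\<in>Q. c q *\<^sub>R y q t))"
    by (intro sol_add sol_scaleR) auto
  then show ?case using insert by simp
qed (simp add: sol_0)

text \<open>Gronwall with the total mass of h as the constant term. Because only the L1 norm of the
  source appears, L1-close controls have uniformly close linearised states.\<close>

lemma sol_bound:
  assumes s: "sol h y" and t: "t \<in> {0..T}"
  shows "norm (y t) \<le> 2 * integral {0..T} (\<lambda>s. norm (h s)) * exp (2 * L * T)"
proof (rule gronwall_bound[where e="\<lambda>t. norm (y t)", OF L _ _ _ _ t])
  have h: "h absolutely_integrable_on {0..T}" and yc: "continuous_on {0..T} y"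
    and y: "\<And>t. t \<in> {0..T} \<Longrightarrow> y t = integral {0..t} (\<lambda>s. A s (y s) + h s)" using solD[OF s] by blast+
  show "0 \<le> integral {0..T} (\<lambda>s. norm (h s))" by (rule Henstock_Kurzweil_Integration.integral_nonneg) (use h in \<open>auto simp: absolutely_integrable_on_def\<close>)
  show "continuous_on {0..T} (\<lambda>t. norm (y t))" by (intro continuous_intros yc)
  fix t assume t: "t \<in> {0..T}"
  have yi: "(\<lambda>s. norm (y s)) integrable_on {0..t}"
    by (intro integrable_continuous_real continuous_intros continuous_on_subset[OF yc]) (use t in auto)
  have "norm (y t) = norm (integral {0..t} (\<lambda>s. A s (y s) + h s))" unfolding y[OF t] ..
  also have "\<dots> \<le> integral {0..t} (\<lambda>s. L * norm (y s) + norm (h s))"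
  proof (rule Henstock_Kurzweil_Integration.integral_norm_bound_integral)
    show "(\<lambda>s. A s (y s) + h s) integrable_on {0..t}" by (rule abs_int_sub[OF sol_abs_int[OF s] t])
    show "(\<lambda>s. L * norm (y s) + norm (h s)) integrable_on {0..t}"
      by (intro Henstock_Kurzweil_Integration.integrable_add integrable_on_mult_right yi norm_abs_int_sub[OF h t])
    show "norm (A r (y r) + h r) \<le> L * norm (y r) + norm (h r)" if "r \<in> {0..t}" for r
      using bound[of r "y r"] that t by (intro norm_triangle_mono) auto
  qed
  also have "\<dots> = L * integral {0..t} (\<lambda>s. norm (y s)) + integral {0..t} (\<lambda>s. norm (h s))"
    by (subst Henstock_Kurzweil_Integration.integral_add) (auto intro!: integrable_on_mult_right yi norm_abs_int_sub[OF h t])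
  also have "\<dots> \<le> integral {0..T} (\<lambda>s. norm (h s)) + L * integral {0..t} (\<lambda>s. norm (y s))"
    using norm_abs_int_sub(2)[OF h t] by simp
  finally show "norm (y t) \<le> integral {0..T} (\<lambda>s. norm (h s)) + L * integral {0..t} (\<lambda>s. norm (y s))" .
qed (use T in auto)

text \<open>The transpose of A t, written through the basis so that its integrability along a curve
  reduces to that of A t b for constant b.\<close>

definition adj :: "real \<Rightarrow> 'a \<Rightarrow> 'a" where
  "adj t p = (\<Sum>b\<in>Basis. (p \<bullet> A t b) *\<^sub>R b)"

lemma adj_inner: assumes "t \<in> {0..T}" shows "adj t p \<bullet> x = p \<bullet> A t x"
proof -
  have "p \<bullet> A t x = p \<bullet> A t (\<Sum>b\<in>Basis. (x \<bullet> b) *\<^sub>R b)" by (simp add: euclidean_representation)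
  also have "\<dots> = (\<Sum>b\<in>Basis. (x \<bullet> b) * (p \<bullet> A t b))"
    by (simp add: linear_sum[OF lin[OF assms]] linear_cmul[OF lin[OF assms]] inner_sum_right)
  also have "\<dots> = adj t p \<bullet> x"
    unfolding adj_def inner_sum_left by (intro sum.cong) (auto simp: inner_commute)
  finally show ?thesis by simp
qed

lemma adj_bound: assumes "t \<in> {0..T}" shows "norm (adj t p) \<le> (DIM('a) * L) * norm p"
proof -
  have "norm (adj t p) \<le> (\<Sum>b\<in>(Basis::'a set). L * norm p)"
    unfolding adj_def
  proof (rule sum_norm_le)
    fix b :: 'a assume b: "b \<in> Basis"
    have "\<bar>p \<bullet> A t b\<bar> \<le> norm p * norm (A t b)" by (rule Cauchy_Schwarz_ineq2)
    also have "\<dots> \<le> norm p * (L * norm b)" by (intro mult_left_mono bound assms) auto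
    finally show "norm ((p \<bullet> A t b) *\<^sub>R b) \<le> L * norm p" using b by (simp add: mult.commute)
  qed
  then show ?thesis by (simp add: mult.assoc)
qed

lemma adj_diff: "adj t p - adj t q = adj t (p - q)"
  by (simp add: adj_def inner_diff_left scaleR_diff_left sum_subtractf)

lemma adj_int:
  assumes "continuous_on {0..T} x" shows "(\<lambda>t. adj t (x t)) absolutely_integrable_on {0..T}"
  unfolding adj_def
proof (intro absolutely_integrable_sum finite_Basis)
  fix b :: 'a
  have "(\<lambda>t. x t \<bullet> A t b) absolutely_integrable_on {0..T}"
    by (intro absolutely_integrable_continuous_inner assms int continuous_intros)
  then show "(\<lambda>t. (x t \<bullet> A t b) *\<^sub>R b) absolutely_integrable_on {0..T}"
    by (rule absolutely_integrable_scaleR_right)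
qed

text \<open>The adjoint equation runs backwards from \<psi> T = c. Reversing time turns it into a
  forward integral equation, and splitting the integral at t rewrites the result with the initial
  value \<psi> 0.\<close>

lemma adjoint_exists:
  obtains \<psi> where "continuous_on {0..T} \<psi>" "\<psi> T = c"
    "\<And>t. t \<in> {0..T} \<Longrightarrow> \<psi> t = \<psi> 0 + integral {0..t} (\<lambda>s. - adj s (\<psi> s))"
proof -
  have refl: "continuous_on {0..T} (\<lambda>s. x (T - s))" if "continuous_on {0..T} x" for x :: "real \<Rightarrow> 'a"
    by (rule continuous_on_compose2[OF that]) (auto intro!: continuous_intros)
  obtain y where y: "continuous_on {0..T} y" "\<And>t. t \<in> {0..T} \<Longrightarrow> y t = c + integral {0..t} (\<lambda>s. adj (T - s) (y s))"
  proof (rule integral_equation_exists[of T "DIM('a) * L" "\<lambda>s x. adj (T - s) x" c])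
    show "(\<lambda>s. adj (T - s) (x s)) integrable_on {0..T}" if "continuous_on {0..T} x" for x
    proof -
      have "(\<lambda>s. adj s (x (T - s))) integrable_on {0..T}"
        using adj_int[OF refl[OF that]] by (simp add: absolutely_integrable_on_def)
      then obtain I where "((\<lambda>s. adj s (x (T - s))) has_integral I) {0..T}" by blast
      from has_integral_reflect_shift[OF this, of T] show ?thesis by (auto simp: integrable_on_def)
    qed
    show "norm (adj (T - s) x - adj (T - s) y) \<le> DIM('a) * L * norm (x - y)" if "s \<in> {0..T}" for s x y
      unfolding adj_diff by (rule adj_bound) (use that in auto)
  qed (use T L in auto)
  define \<psi> where "\<psi> t = y (T - t)" for t
  have \<psi>c: "continuous_on {0..T} \<psi>" unfolding \<psi>_def by (rule refl[OF y(1)])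
  have ai: "(\<lambda>s. adj s (\<psi> s)) integrable_on {0..T}" using adj_int[OF \<psi>c] by (simp add: absolutely_integrable_on_def)
  have eq: "\<psi> t = c + integral {t..T} (\<lambda>s. adj s (\<psi> s))" if t: "t \<in> {0..T}" for t
  proof -
    have "(\<lambda>s. adj s (\<psi> s)) integrable_on {t..T}" by (rule integrable_on_subinterval[OF ai]) (use t in auto)
    then have "((\<lambda>s. adj s (\<psi> s)) has_integral integral {t..T} (\<lambda>s. adj s (\<psi> s))) {t..T}" by (rule integrable_integral)
    from has_integral_reflect_shift[OF this, of T]
    have "integral {0..T - t} (\<lambda>s. adj (T - s) (y s)) = integral {t..T} (\<lambda>s. adj s (\<psi> s))"
      by (intro integral_unique) (simp add: \<psi>_def)
    then show ?thesis using y(2)[of "T - t"] t by (simp add: \<psi>_def)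
  qed
  show thesis
  proof (rule that[OF \<psi>c])
    show "\<psi> T = c" using eq[of T] T by simp
    fix t assume t: "t \<in> {0..T}"
    have "integral {0..t} (\<lambda>s. adj s (\<psi> s)) + integral {t..T} (\<lambda>s. adj s (\<psi> s)) = integral {0..T} (\<lambda>s. adj s (\<psi> s))"
      using t ai by (intro Henstock_Kurzweil_Integration.integral_combine) auto
    then show "\<psi> t = \<psi> 0 + integral {0..t} (\<lambda>s. - adj s (\<psi> s))"
      using eq[OF t] eq[of 0] T by (simp add: algebra_simps)
  qed
qed

text \<open>Formally (\<psi> . y)' = \<psi> . h, because the terms with A cancel by transposition,
  and y 0 = 0. This converts functionals of the endpoint into integrals against \<psi>.\<close>

lemma duality:
  assumes \<psi>: "continuous_on {0..T} \<psi>" "\<And>t. t \<in> {0..T} \<Longrightarrow> \<psi> t = \<psi> 0 + integral {0..t} (\<lambda>s. - adj s (\<psi> s))"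
    and s: "sol h y"
  shows "\<psi> T \<bullet> y T = integral {0..T} (\<lambda>t. \<psi> t \<bullet> h t)"
proof -
  have y0: "y 0 = 0" and y: "\<And>t. t \<in> {0..T} \<Longrightarrow> y t = integral {0..t} (\<lambda>s. A s (y s) + h s)"
    using solD(3)[OF s, of 0] solD(3)[OF s] T by auto
  have "(\<lambda>s. - adj s (\<psi> s)) absolutely_integrable_on {0..T}"
    using absolutely_integrable_cmul[OF adj_int[OF \<psi>(1)], of "-1"] by simp
  then have "integral {0..T} (\<lambda>t. y t \<bullet> - adj t (\<psi> t) + \<psi> t \<bullet> (A t (y t) + h t)) = \<psi> T \<bullet> y T - \<psi> 0 \<bullet> y 0"
  proof (rule integral_by_parts_inner[OF less_imp_le[OF T] _ sol_abs_int[OF s]])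
    show "y t = y 0 + integral {0..t} (\<lambda>s. A s (y s) + h s)" if "t \<in> {0..T}" for t
      unfolding y0 add_0_left by (rule y[OF that])
  qed (rule \<psi>(2))
  then have "\<psi> T \<bullet> y T = integral {0..T} (\<lambda>t. y t \<bullet> - adj t (\<psi> t) + \<psi> t \<bullet> (A t (y t) + h t))"
    unfolding y0 by simp
  also have "\<dots> = integral {0..T} (\<lambda>t. \<psi> t \<bullet> h t)"
  proof (rule integral_cong)
    fix t assume "t \<in> {0..T}"
    then have "y t \<bullet> adj t (\<psi> t) = \<psi> t \<bullet> A t (y t)" using adj_inner by (simp add: inner_commute)
    then show "y t \<bullet> - adj t (\<psi> t) + \<psi> t \<bullet> (A t (y t) + h t) = \<psi> t \<bullet> h t" by (simp add: inner_add_right)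
  qed
  finally show ?thesis .
qed

lemma adjoint_lipschitz:
  assumes \<psi>: "continuous_on {0..T} \<psi>" "\<And>t. t \<in> {0..T} \<Longrightarrow> \<psi> t = \<psi> 0 + integral {0..t} (\<lambda>s. - adj s (\<psi> s))"
  shows "\<exists>K. K-lipschitz_on {0..T} \<psi>"
proof -
  have "bounded (\<psi> ` {0..T})" using \<psi>(1) by (intro compact_imp_bounded compact_continuous_image) auto
  then obtain M where M: "M > 0" "\<And>t. t \<in> {0..T} \<Longrightarrow> norm (\<psi> t) \<le> M"
    unfolding bounded_pos by auto
  define K where "K = DIM('a) * L * M"
  have K: "0 \<le> K" using L M by (simp add: K_def)
  have ai: "(\<lambda>s. - adj s (\<psi> s)) integrable_on {0..T}" 
    using absolutely_integrable_cmul[OF adj_int[OF \<psi>(1)], of "-1"] by (simp add: absolutely_integrable_on_def)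
  have diff_eq: "P - Q = J" if "b + J = a" "P = z + a" "Q = z + b" for P Q J a b z :: 'a
    using that by auto
  have le: "norm (\<psi> t - \<psi> s) \<le> K * (t - s)" if st: "0 \<le> s" "s \<le> t" "t \<le> T" for s t
  proof -
    have "integral {0..s} (\<lambda>s. - adj s (\<psi> s)) + integral {s..t} (\<lambda>s. - adj s (\<psi> s)) = integral {0..t} (\<lambda>s. - adj s (\<psi> s))"
      using st by (intro Henstock_Kurzweil_Integration.integral_combine integrable_on_subinterval[OF ai]) auto
    then have "\<psi> t - \<psi> s = integral {s..t} (\<lambda>s. - adj s (\<psi> s))"
    proof (rule diff_eq)
      show "\<psi> t = \<psi> 0 + integral {0..t} (\<lambda>s. - adj s (\<psi> s))" "\<psi> s = \<psi> 0 + integral {0..s} (\<lambda>s. - adj s (\<psi> s))"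
        by (rule \<psi>(2); use st in simp)+
    qed
    also have "norm \<dots> \<le> integral {s..t} (\<lambda>s. K)"
    proof (rule Henstock_Kurzweil_Integration.integral_norm_bound_integral)
      show "(\<lambda>s. - adj s (\<psi> s)) integrable_on {s..t}" by (rule integrable_on_subinterval[OF ai]) (use st in auto)
      fix r assume r: "r \<in> {s..t}"
      have "norm (adj r (\<psi> r)) \<le> (DIM('a) * L) * norm (\<psi> r)" by (rule adj_bound) (use r st in auto)
      also have "\<dots> \<le> (DIM('a) * L) * M" by (rule mult_left_mono[OF M(2)]) (use r st L in auto)
      finally show "norm (- adj r (\<psi> r)) \<le> K" by (simp add: K_def)
    qed auto
    also have "\<dots> = K * (t - s)" using st by simp
    finally show ?thesis .
  qed
  have "K-lipschitz_on {0..T} \<psi>"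
  proof (rule lipschitz_onI[OF _ K])
    fix s t assume st: "s \<in> {0..T}" "t \<in> {0..T}"
    show "dist (\<psi> s) (\<psi> t) \<le> K * dist s t"
      using le[of s t] le[of t s] st by (cases "s \<le> t") (auto simp: dist_norm norm_minus_commute abs_if)
  qed
  then show ?thesis by blast
qed

text \<open>Exactness at the endpoint and closeness in L1 have to hold together. A control of V
  close to v0 has a small endpoint error, which is cancelled by finitely many fixed controls whose
  endpoints form an orthonormal basis of all attainable ones; the coefficients are as small as the
  error.\<close>

lemma dense_controls_attain_endpoint:
  fixes V :: "(real \<Rightarrow> 'u::euclidean_space) set" and B :: "real \<Rightarrow> 'u \<Rightarrow> 'a"
  assumes B: "\<And>t. t \<in> {0..T} \<Longrightarrow> linear (B t)" "\<And>t u. t \<in> {0..T} \<Longrightarrow> norm (B t u) \<le> K * norm u"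
    and Bi: "\<And>v. v absolutely_integrable_on {0..T} \<Longrightarrow> (\<lambda>t. B t (v t)) absolutely_integrable_on {0..T}"
    and V: "(\<lambda>_. 0) \<in> V" "\<And>v w. v \<in> V \<Longrightarrow> w \<in> V \<Longrightarrow> (\<lambda>t. v t + w t) \<in> V" "\<And>v c. v \<in> V \<Longrightarrow> (\<lambda>t. c *\<^sub>R v t) \<in> V"
    and Vi: "\<And>v. v \<in> V \<Longrightarrow> v absolutely_integrable_on {0..T}"
    and v0: "v0 absolutely_integrable_on {0..T}"
    and dense: "\<And>e. e > 0 \<Longrightarrow> \<exists>v\<in>V. integral {0..T} (\<lambda>t. norm (v t - v0 t)) \<le> e"
    and z: "sol (\<lambda>t. B t (v0 t)) z" and e: "0 < e" and K: "0 \<le> K"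
  obtains v y where "v \<in> V" "sol (\<lambda>t. B t (v t)) y" "y T = z T" "integral {0..T} (\<lambda>t. norm (v t - v0 t)) \<le> e"
proof -
  have BL: "sol (\<lambda>t. B t (v t + c *\<^sub>R w t)) (\<lambda>t. y t + c *\<^sub>R x t)"
    if "sol (\<lambda>t. B t (v t)) y" "sol (\<lambda>t. B t (w t)) x" for v w y x c
  proof -
    have s: "sol (\<lambda>t. B t (v t) + c *\<^sub>R B t (w t)) (\<lambda>t. y t + c *\<^sub>R x t)" by (intro sol_add sol_scaleR that)
    have eq: "B t (v t + c *\<^sub>R w t) = B t (v t) + c *\<^sub>R B t (w t)" if "t \<in> {0..T}" for t
      using B(1)[OF that] by (simp add: linear_add linear_cmul)
    show ?thesis unfolding sol_def
    proof (intro conjI ballI)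
      show "(\<lambda>t. B t (v t + c *\<^sub>R w t)) absolutely_integrable_on {0..T}"
        by (rule absolutely_integrable_spike[OF solD(1)[OF s] negligible_empty]) (use eq in auto)
      show "continuous_on {0..T} (\<lambda>t. y t + c *\<^sub>R x t)" by (rule solD(2)[OF s])
      fix t assume t: "t \<in> {0..T}"
      have "integral {0..t} (\<lambda>s. A s (y s + c *\<^sub>R x s) + (B s (v s) + c *\<^sub>R B s (w s))) = integral {0..t} (\<lambda>s. A s (y s + c *\<^sub>R x s) + B s (v s + c *\<^sub>R w s))"
        by (rule integral_cong) (use eq t in auto)
      then show "y t + c *\<^sub>R x t = integral {0..t} (\<lambda>s. A s (y s + c *\<^sub>R x s) + B s (v s + c *\<^sub>R w s))"
        using solD(3)[OF s t] by (rule trans[rotated])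
    qed
  qed
  define D where "D = {y T |v y. v \<in> V \<and> sol (\<lambda>t. B t (v t)) y}"
  have Dlin: "p + c *\<^sub>R q \<in> D" if pq: "p \<in> D" "q \<in> D" for p q c
  proof -
    obtain v y where vy: "v \<in> V" "sol (\<lambda>t. B t (v t)) y" "p = y T" using pq(1) unfolding D_def by blast
    obtain w x where wx: "w \<in> V" "sol (\<lambda>t. B t (w t)) x" "q = x T" using pq(2) unfolding D_def by blast
    have "(\<lambda>t. v t + c *\<^sub>R w t) \<in> V" by (intro V(2) V(3) vy wx)
    with BL[OF vy(2) wx(2), of c] show ?thesis unfolding D_def vy wx
      by (intro CollectI exI[of _ "\<lambda>t. v t + c *\<^sub>R w t"] exI[of _ "\<lambda>t. y t + c *\<^sub>R x t"]) auto
  qed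
  have "0 \<in> D"
  proof -
    obtain y where y: "sol (\<lambda>t. B t 0) y" using sol_exists Bi[OF Vi[OF V(1)]] by blast
    have "norm (y T) \<le> 2 * integral {0..T} (\<lambda>s. norm (B s 0)) * exp (2 * L * T)" by (rule sol_bound[OF y]) (use T in auto)
    also have "integral {0..T} (\<lambda>s. norm (B s 0)) = integral {0..T} (\<lambda>s. 0)" by (rule integral_cong) (use B(1) linear_0 in auto)
    finally have "y T = 0" by simp
    then show ?thesis using y V(1) unfolding D_def by force
  qed
  (* D is a subspace of a finite-dimensional space, hence closed: it contains z T itself, not only
     approximations of it. *)
  then have "subspace D" unfolding subspace_def
    using Dlin[of _ _ 1] Dlin[of 0] by auto
  \<comment> \<open>The factor by which the L1 distance of two controls bounds the distance of their
    endpoints, K from the bound on B and the rest from Gronwall.\<close>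
  define C where "C = 2 * K * exp (2 * L * T)"
  have C: "0 \<le> C" using K by (simp add: C_def)
  have close: "norm (z T - y T) \<le> C * integral {0..T} (\<lambda>t. norm (v t - v0 t))"
    if v: "v \<in> V" "sol (\<lambda>t. B t (v t)) y" for v y
  proof -
    have i: "(\<lambda>t. v t - v0 t) absolutely_integrable_on {0..T}" by (intro set_integral_diff(1) Vi v v0)
    have s: "sol (\<lambda>t. B t (v t + (-1) *\<^sub>R v0 t)) (\<lambda>t. y t + (-1) *\<^sub>R z t)" by (rule BL[OF v(2) z])
    have "norm (y T + (-1) *\<^sub>R z T) \<le> 2 * integral {0..T} (\<lambda>t. norm (B t (v t + (-1) *\<^sub>R v0 t))) * exp (2 * L * T)"
      by (rule sol_bound[OF s]) (use T in auto)
    also have "integral {0..T} (\<lambda>t. norm (B t (v t + (-1) *\<^sub>R v0 t))) \<le> integral {0..T} (\<lambda>t. K * norm (v t - v0 t))"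
    proof (rule integral_le)
      show "(\<lambda>t. norm (B t (v t + - 1 *\<^sub>R v0 t))) integrable_on {0..T}" using solD(1)[OF s] by (auto simp: absolutely_integrable_on_def)
      show "(\<lambda>t. K * norm (v t - v0 t)) integrable_on {0..T}" using i by (intro integrable_on_mult_right) (auto simp: absolutely_integrable_on_def)
    qed (use B(2) in auto)
    also have "\<dots> = K * integral {0..T} (\<lambda>t. norm (v t - v0 t))" by simp
    finally show ?thesis by (simp add: C_def norm_minus_commute mult_ac)
  qed
  have approx: "\<exists>v y. v \<in> V \<and> sol (\<lambda>t. B t (v t)) y \<and> integral {0..T} (\<lambda>t. norm (v t - v0 t)) \<le> e \<and> norm (z T - y T) \<le> C * e" if epos: "e > 0" for e
  proof -
    obtain v where v: "v \<in> V" "integral {0..T} (\<lambda>t. norm (v t - v0 t)) \<le> e" using dense[OF epos] by blast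
    obtain y where y: "sol (\<lambda>t. B t (v t)) y" using sol_exists Bi[OF Vi[OF v(1)]] by blast
    show ?thesis using close[OF v(1) y] v y mult_left_mono[OF v(2) C] by (intro exI[of _ v] exI[of _ y]) auto
  qed
  have "z T \<in> closure D"
    unfolding closure_approachable
  proof (intro allI impI)
    fix e :: real assume e: "e > 0"
    define e' where "e' = e / (C + 1)"
    have e': "e' > 0" using e C by (simp add: e'_def)
    obtain v y where v: "v \<in> V" "sol (\<lambda>t. B t (v t)) y" "norm (z T - y T) \<le> C * e'" using approx[OF e'] by blast
    have "C * e' < e" using e C by (simp add: e'_def field_simps)
    then show "\<exists>x\<in>D. dist x (z T) < e" using v by (intro bexI[of _ "y T"]) (auto simp: D_def dist_norm norm_minus_commute)
  qed
  then have zD: "z T \<in> D" using closed_subspace[OF \<open>subspace D\<close>] by simp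
  obtain Bs where Bs: "Bs \<subseteq> D" "pairwise orthogonal Bs" "\<And>x. x \<in> Bs \<Longrightarrow> norm x = 1" "independent Bs" "span Bs = D"
    using orthonormal_basis_subspace[OF \<open>subspace D\<close>] by metis
  have fin: "finite Bs" using Bs(4) by (rule independent_imp_finite)
  have "\<forall>b\<in>Bs. \<exists>v y. v \<in> V \<and> sol (\<lambda>t. B t (v t)) y \<and> y T = b" using Bs(1) unfolding D_def by blast
  then obtain vb yb where b: "\<And>b. b \<in> Bs \<Longrightarrow> vb b \<in> V \<and> sol (\<lambda>t. B t (vb b t)) (yb b) \<and> yb b T = b" by metis
  define N where "N = (\<Sum>b\<in>Bs. integral {0..T} (\<lambda>t. norm (vb b t)))"
  have N: "0 \<le> N" unfolding N_def
    by (intro sum_nonneg Henstock_Kurzweil_Integration.integral_nonneg) (use b Vi in \<open>auto simp: absolutely_integrable_on_def\<close>)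
  \<comment> \<open>The approximation costs e' and the correction at most C e' N, so that the total
    e' (1 + C N) is e.\<close>
  define e' where "e' = e / (1 + C * N)"
  have p: "0 < 1 + C * N" using C N by (simp add: add_pos_nonneg)
  have e': "e' > 0" using e p by (simp add: e'_def)
  obtain v y where v: "v \<in> V" "sol (\<lambda>t. B t (v t)) y" "integral {0..T} (\<lambda>t. norm (v t - v0 t)) \<le> e'" "norm (z T - y T) \<le> C * e'"
    using approx[OF e'] by blast
  define \<delta> where "\<delta> = z T - y T"
  have \<delta>D: "\<delta> \<in> span Bs" unfolding \<delta>_def Bs(5)
    by (rule subspace_diff[OF \<open>subspace D\<close> zD]) (use v in \<open>auto simp: D_def\<close>)
  define w where "w S t = (\<Sum>b\<in>S. (\<delta> \<bullet> b) *\<^sub>R vb b t)" for S t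
  \<comment> \<open>Induction over subsets of the basis adds one correcting control at a time, so
    that closure of V under sums and multiples is enough.\<close>
  have main: "(\<lambda>t. v t + w S t) \<in> V \<and> sol (\<lambda>t. B t (v t + w S t)) (\<lambda>t. y t + (\<Sum>b\<in>S. (\<delta> \<bullet> b) *\<^sub>R yb b t))
     \<and> integral {0..T} (\<lambda>t. norm (v t + w S t - v0 t)) \<le> e' + (\<Sum>b\<in>S. \<bar>\<delta> \<bullet> b\<bar> * integral {0..T} (\<lambda>t. norm (vb b t)))"
    if "S \<subseteq> Bs" for S
    using finite_subset[OF that fin] that
  proof (induction S rule: finite_induct)
    case empty
    then show ?case using v by (simp add: w_def)
  next
    case (insert b S)
    then have bB: "b \<in> Bs" and IH: "(\<lambda>t. v t + w S t) \<in> V" "sol (\<lambda>t. B t (v t + w S t)) (\<lambda>t. y t + (\<Sum>b\<in>S. (\<delta> \<bullet> b) *\<^sub>R yb b t))"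
      "integral {0..T} (\<lambda>t. norm (v t + w S t - v0 t)) \<le> e' + (\<Sum>b\<in>S. \<bar>\<delta> \<bullet> b\<bar> * integral {0..T} (\<lambda>t. norm (vb b t)))" by auto
    note bb = b[OF bB]
    have w: "v t + w (insert b S) t = (v t + w S t) + (\<delta> \<bullet> b) *\<^sub>R vb b t" for t using insert by (simp add: w_def add_ac)
    have y: "y t + (\<Sum>b\<in>insert b S. (\<delta> \<bullet> b) *\<^sub>R yb b t) = (y t + (\<Sum>b\<in>S. (\<delta> \<bullet> b) *\<^sub>R yb b t)) + (\<delta> \<bullet> b) *\<^sub>R yb b t" for t
      using insert by (simp add: add_ac)
    have i1: "(\<lambda>t. norm (v t + w S t - v0 t)) integrable_on {0..T}" "(\<lambda>t. norm (vb b t)) integrable_on {0..T}"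
      using set_integral_diff(1)[OF Vi[OF IH(1)] v0] Vi bb by (auto simp: absolutely_integrable_on_def)
    have wV: "(\<lambda>t. v t + w (insert b S) t) \<in> V" unfolding w by (intro V(2) V(3) IH) (use bb in auto)
    have "integral {0..T} (\<lambda>t. norm (v t + w (insert b S) t - v0 t)) \<le> integral {0..T} (\<lambda>t. norm (v t + w S t - v0 t) + \<bar>\<delta> \<bullet> b\<bar> * norm (vb b t))"
    proof (rule integral_le)
      show "(\<lambda>t. norm (v t + w (insert b S) t - v0 t)) integrable_on {0..T}"
        using set_integral_diff(1)[OF Vi[OF wV] v0] by (auto simp: absolutely_integrable_on_def)
      show "(\<lambda>t. norm (v t + w S t - v0 t) + \<bar>\<delta> \<bullet> b\<bar> * norm (vb b t)) integrable_on {0..T}"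
        by (intro Henstock_Kurzweil_Integration.integrable_add integrable_on_mult_right i1)
      fix t
      have "v t + w (insert b S) t - v0 t = (v t + w S t - v0 t) + (\<delta> \<bullet> b) *\<^sub>R vb b t" by (simp add: w)
      also have "norm \<dots> \<le> norm (v t + w S t - v0 t) + \<bar>\<delta> \<bullet> b\<bar> * norm (vb b t)" by (metis norm_scaleR norm_triangle_ineq)
      finally show "norm (v t + w (insert b S) t - v0 t) \<le> norm (v t + w S t - v0 t) + \<bar>\<delta> \<bullet> b\<bar> * norm (vb b t)" .
    qed
    also have "\<dots> = integral {0..T} (\<lambda>t. norm (v t + w S t - v0 t)) + \<bar>\<delta> \<bullet> b\<bar> * integral {0..T} (\<lambda>t. norm (vb b t))"
      by (subst Henstock_Kurzweil_Integration.integral_add) (auto intro!: integrable_on_mult_right i1)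
    finally have i: "integral {0..T} (\<lambda>t. norm (v t + w (insert b S) t - v0 t)) \<le> e' + (\<Sum>b\<in>insert b S. \<bar>\<delta> \<bullet> b\<bar> * integral {0..T} (\<lambda>t. norm (vb b t)))"
      using IH(3) insert by simp
    show ?case using wV i BL[OF IH(2), of "vb b" "yb b" "\<delta> \<bullet> b"] bb unfolding w y by auto
  qed
  note m = main[OF order_refl]
  show thesis
  proof (rule that)
    show "(\<lambda>t. v t + w Bs t) \<in> V" "sol (\<lambda>t. B t (v t + w Bs t)) (\<lambda>t. y t + (\<Sum>b\<in>Bs. (\<delta> \<bullet> b) *\<^sub>R yb b t))" using m by auto
    have "(\<Sum>b\<in>Bs. (\<delta> \<bullet> b) *\<^sub>R yb b T) = (\<Sum>b\<in>Bs. (\<delta> \<bullet> b) *\<^sub>R b)" by (rule sum.cong) (use b in auto)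
    also have "\<dots> = \<delta>" by (rule orthonormal_basis_expand) (use Bs fin \<delta>D in auto)
    finally show "y T + (\<Sum>b\<in>Bs. (\<delta> \<bullet> b) *\<^sub>R yb b T) = z T" by (simp add: \<delta>_def)
    have "(\<Sum>b\<in>Bs. \<bar>\<delta> \<bullet> b\<bar> * integral {0..T} (\<lambda>t. norm (vb b t))) \<le> (\<Sum>b\<in>Bs. (C * e') * integral {0..T} (\<lambda>t. norm (vb b t)))"
    proof (intro sum_mono mult_right_mono)
      fix b assume bB: "b \<in> Bs"
      have "\<bar>\<delta> \<bullet> b\<bar> \<le> norm \<delta> * norm b" by (rule Cauchy_Schwarz_ineq2)
      then show "\<bar>\<delta> \<bullet> b\<bar> \<le> C * e'" using Bs(3)[OF bB] v(4) by (simp add: \<delta>_def)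
      show "0 \<le> integral {0..T} (\<lambda>t. norm (vb b t))"
        by (intro Henstock_Kurzweil_Integration.integral_nonneg) (use b[OF bB] Vi in \<open>auto simp: absolutely_integrable_on_def\<close>)
    qed
    also have "\<dots> = C * e' * N" by (simp add: N_def sum_distrib_left)
    finally have "integral {0..T} (\<lambda>t. norm (v t + w Bs t - v0 t)) \<le> e' + C * e' * N" using m by simp
    also have "\<dots> = e' * (1 + C * N)" by (simp add: algebra_simps)
    also have "\<dots> = e" using p by (simp add: e'_def)
    finally show "integral {0..T} (\<lambda>t. norm (v t + w Bs t - v0 t)) \<le> e" .
  qed
qed

end

section \<open>Second-order expansion of the control-affine field and of its trajectories\<close>

section \<open>Control-affine dynamics\<close>

text \<open>One summand of the field: F is a vector field at the perturbed state, a + \<epsilon> b +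
  \<epsilon>^2 c its perturbed coefficient. After multiplying out, what remains is either the error
  of F times a coefficient bounded by 3 M, or carries a factor \<epsilon>^3.\<close>

lemma product_expansion:
  fixes f f1 f2 F :: "'a::real_normed_vector"
  assumes \<epsilon>: "0 < \<epsilon>" "\<epsilon> \<le> 1" and abc: "\<bar>a\<bar> \<le> M" "\<bar>b\<bar> \<le> M" "\<bar>c\<bar> \<le> M"
    and F: "norm (F - f - \<epsilon> *\<^sub>R f1 - \<epsilon>\<^sup>2 *\<^sub>R f2) \<le> \<delta> * \<epsilon>\<^sup>2" and f12: "norm f1 \<le> C" "norm f2 \<le> C" and "0 \<le> \<delta>"
  shows "norm ((a + \<epsilon> * b + \<epsilon>\<^sup>2 * c) *\<^sub>R F - a *\<^sub>R f - \<epsilon> *\<^sub>R (a *\<^sub>R f1 + b *\<^sub>R f)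
     - \<epsilon>\<^sup>2 *\<^sub>R (a *\<^sub>R f2 + b *\<^sub>R f1 + c *\<^sub>R f)) \<le> 3 * M * (\<delta> + \<epsilon> * C) * \<epsilon>\<^sup>2"
proof -
  have M: "0 \<le> M" using abc by linarith
  have C: "0 \<le> C" using f12 norm_ge_zero order_trans by blast
  have \<epsilon>2: "\<epsilon>\<^sup>2 \<le> 1" "0 \<le> \<epsilon>\<^sup>2" using \<epsilon> by (auto simp: power_le_one)
  have eq: "(a + \<epsilon> * b + \<epsilon>\<^sup>2 * c) *\<^sub>R F - a *\<^sub>R f - \<epsilon> *\<^sub>R (a *\<^sub>R f1 + b *\<^sub>R f) - \<epsilon>\<^sup>2 *\<^sub>R (a *\<^sub>R f2 + b *\<^sub>R f1 + c *\<^sub>R f)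
    = (a + \<epsilon> * b + \<epsilon>\<^sup>2 * c) *\<^sub>R (F - f - \<epsilon> *\<^sub>R f1 - \<epsilon>\<^sup>2 *\<^sub>R f2) + (\<epsilon> * \<epsilon>\<^sup>2) *\<^sub>R (b *\<^sub>R f2 + c *\<^sub>R f1 + \<epsilon> *\<^sub>R c *\<^sub>R f2)"
    by (simp add: algebra_simps power2_eq_square)
  have "\<bar>\<epsilon> * b\<bar> \<le> 1 * M" unfolding abs_mult using \<epsilon> abc by (intro mult_mono) auto
  moreover have "\<bar>\<epsilon>\<^sup>2 * c\<bar> \<le> 1 * M" unfolding abs_mult using \<epsilon>2 abc by (intro mult_mono) auto
  ultimately have "\<bar>a + \<epsilon> * b + \<epsilon>\<^sup>2 * c\<bar> \<le> 3 * M" using abc by linarith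
  then have A: "norm ((a + \<epsilon> * b + \<epsilon>\<^sup>2 * c) *\<^sub>R (F - f - \<epsilon> *\<^sub>R f1 - \<epsilon>\<^sup>2 *\<^sub>R f2)) \<le> (3 * M) * (\<delta> * \<epsilon>\<^sup>2)"
    unfolding norm_scaleR using F M by (intro mult_mono) auto
  have "norm (b *\<^sub>R f2) \<le> M * C" "norm (c *\<^sub>R f1) \<le> M * C" "norm (c *\<^sub>R f2) \<le> M * C"
    unfolding norm_scaleR using abc f12 M by (auto intro!: mult_mono)
  moreover from this have "norm (\<epsilon> *\<^sub>R c *\<^sub>R f2) \<le> 1 * (M * C)"
    unfolding norm_scaleR[of \<epsilon>] using \<epsilon> M C by (intro mult_mono) auto
  ultimately have "norm (b *\<^sub>R f2 + c *\<^sub>R f1 + \<epsilon> *\<^sub>R c *\<^sub>R f2) \<le> M * C + M * C + 1 * (M * C)"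
    by (intro norm_triangle_mono)
  then have "norm ((\<epsilon> * \<epsilon>\<^sup>2) *\<^sub>R (b *\<^sub>R f2 + c *\<^sub>R f1 + \<epsilon> *\<^sub>R c *\<^sub>R f2)) \<le> (\<epsilon> * \<epsilon>\<^sup>2) * (3 * (M * C))"
    unfolding norm_scaleR using \<epsilon> by (intro mult_mono) (auto simp: mult_ac)
  from norm_triangle_mono[OF A this] show ?thesis unfolding eq by (simp add: algebra_simps)
qed

lemma bounded_on_cball:
  fixes g :: "'a::euclidean_space \<Rightarrow> 'b::real_normed_vector"
  assumes "continuous_on UNIV g"
  obtains K where "0 \<le> K" "\<And>x. x \<in> cball 0 R \<Longrightarrow> norm (g x) \<le> K"
proof -
  have "bounded (g ` cball 0 R)"
    by (intro compact_imp_bounded compact_continuous_image continuous_on_subset[OF assms]) auto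
  then show thesis using that unfolding bounded_pos by (metis image_eqI less_imp_le)
qed

lemma lipschitz_on_cball:
  fixes g :: "'a::euclidean_space \<Rightarrow> 'b::real_normed_vector"
  assumes g: "\<And>x. (g has_derivative blinfun_apply (g' x)) (at x)" and "continuous_on UNIV g'"
  obtains K where "0 \<le> K" "\<And>x y. x \<in> cball 0 R \<Longrightarrow> y \<in> cball 0 R \<Longrightarrow> norm (g x - g y) \<le> K * norm (x - y)"
proof -
  obtain K where K: "0 \<le> K" "\<And>x. x \<in> cball 0 R \<Longrightarrow> norm (g' x) \<le> K" using bounded_on_cball[OF assms(2)] by blast
  show thesis
  proof (rule that[OF K(1)])
    fix x y :: 'a assume xy: "x \<in> cball 0 R" "y \<in> cball 0 R"
    show "norm (g x - g y) \<le> K * norm (x - y)"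
      by (rule differentiable_bound[of "cball 0 R" g "\<lambda>x. blinfun_apply (g' x)"])
        (use xy K g in \<open>auto intro: has_derivative_at_withinI simp: norm_blinfun.rep_eq[symmetric]\<close>)
  qed
qed

lemma absolutely_integrable_scaleR_continuous:
  fixes a :: "real \<Rightarrow> real" and c :: "real \<Rightarrow> 'a::euclidean_space"
  assumes "a absolutely_integrable_on {0..T}" "continuous_on {0..T} c"
  shows "(\<lambda>t. a t *\<^sub>R c t) absolutely_integrable_on {0..T}"
  using assms
  by (intro absolutely_integrable_bounded_measurable_product[of "\<lambda>x y. y *\<^sub>R x"])
    (auto simp: bilinear_conv_bounded_bilinear bounded_bilinear.flip bounded_bilinear_scaleR
       intro!: continuous_imp_measurable_on_sets_lebesgue compact_imp_bounded compact_continuous_image)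

lemma absolutely_integrable_vec_nth:
  fixes v :: "real \<Rightarrow> real^'m"
  assumes "v absolutely_integrable_on S"
  shows "(\<lambda>t. v t $ i) absolutely_integrable_on S"
  using absolutely_integrable_linear[OF assms bounded_linear_vec_nth] by (simp add: o_def)

lemma absolutely_integrable_bounded_measurable:
  fixes v :: "real \<Rightarrow> 'a::euclidean_space"
  assumes "v \<in> borel_measurable (lebesgue_on {0..T})" "\<And>t. t \<in> {0..T} \<Longrightarrow> norm (v t) \<le> M"
  shows "v absolutely_integrable_on {0..T}"
  by (rule measurable_bounded_by_integrable_imp_absolutely_integrable[of _ _ "\<lambda>_. M"]) (use assms in auto)

locale c2_dynamics =
  fixes f0 :: "(real^'n) \<Rightarrow> (real^'n)" and f :: "'m::finite \<Rightarrow> (real^'n) \<Rightarrow> (real^'n)"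
    and f0' :: "(real^'n) \<Rightarrow> (real^'n) \<Rightarrow>\<^sub>L (real^'n)" and f' :: "'m \<Rightarrow> (real^'n) \<Rightarrow> (real^'n) \<Rightarrow>\<^sub>L (real^'n)"
    and f0'' :: "(real^'n) \<Rightarrow> (real^'n) \<Rightarrow>\<^sub>L (real^'n) \<Rightarrow>\<^sub>L (real^'n)"
    and f'' :: "'m \<Rightarrow> (real^'n) \<Rightarrow> (real^'n) \<Rightarrow>\<^sub>L (real^'n) \<Rightarrow>\<^sub>L (real^'n)"
  assumes f0: "\<And>x. (f0 has_derivative blinfun_apply (f0' x)) (at x)"
               "\<And>x. (f0' has_derivative blinfun_apply (f0'' x)) (at x)"
               "continuous_on UNIV f0''"
    and f: "\<And>i x. (f i has_derivative blinfun_apply (f' i x)) (at x)"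
              "\<And>i x. (f' i has_derivative blinfun_apply (f'' i x)) (at x)"
              "\<And>i. continuous_on UNIV (f'' i)"
begin

lemma cont: "continuous_on UNIV f0" "continuous_on UNIV f0'" "continuous_on UNIV (f i)" "continuous_on UNIV (f' i)"
  using f0(1,2) f(1,2) has_derivative_continuous by (blast intro: continuous_at_imp_continuous_on)+

(* With dyn(x, a) = f0 x + sum_i a_i f_i x, the perturbation (x + eps*z, a + eps*b) changes dyn by
   eps * (DA x a z + Bm x b) + eps^2 * Qm x a z b + o(eps^2); compare A(t), B(t) and Omega. *)
definition DA :: "real^'n \<Rightarrow> real^'m \<Rightarrow> real^'n \<Rightarrow> real^'n" where
  "DA x a z = blinfun_apply (f0' x) z + (\<Sum>i\<in>UNIV. a $ i *\<^sub>R blinfun_apply (f' i x) z)"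

definition Bm :: "real^'n \<Rightarrow> real^'m \<Rightarrow> real^'n" where
  "Bm x b = (\<Sum>i\<in>UNIV. b $ i *\<^sub>R f i x)"

definition Qm :: "real^'n \<Rightarrow> real^'m \<Rightarrow> real^'n \<Rightarrow> real^'m \<Rightarrow> real^'n" where
  "Qm x a z b = (1/2) *\<^sub>R (blinfun_apply (blinfun_apply (f0'' x) z) z + (\<Sum>i\<in>UNIV. a $ i *\<^sub>R blinfun_apply (blinfun_apply (f'' i x) z) z))
     + (\<Sum>i\<in>UNIV. b $ i *\<^sub>R blinfun_apply (f' i x) z)"

text \<open>The estimate will be used at every time and for a whole family of controls, hence one
  \<epsilon>0 for all arguments in a bounded set. Each f i contributes a product expansion, f0 a
  plain Taylor expansion.\<close>

lemma dyn_expansion: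
  assumes \<delta>: "0 < \<delta>" and M: "0 \<le> M"
  obtains \<epsilon>0 where "0 < \<epsilon>0"
    "\<And>\<epsilon> x z \<zeta> a b c. 0 < \<epsilon> \<Longrightarrow> \<epsilon> \<le> \<epsilon>0 \<Longrightarrow> norm x \<le> R \<Longrightarrow> norm z \<le> M \<Longrightarrow> norm \<zeta> \<le> M \<Longrightarrow>
       norm a \<le> M \<Longrightarrow> norm b \<le> M \<Longrightarrow> norm c \<le> M \<Longrightarrow>
       norm (dyn f0 f (x + \<epsilon> *\<^sub>R z + \<epsilon>\<^sup>2 *\<^sub>R \<zeta>) (a + \<epsilon> *\<^sub>R b + \<epsilon>\<^sup>2 *\<^sub>R c) - dyn f0 f x a - \<epsilon> *\<^sub>R (DA x a z + Bm x b)
         - \<epsilon>\<^sup>2 *\<^sub>R (DA x a \<zeta> + Qm x a z b + Bm x c)) \<le> \<delta> * \<epsilon>\<^sup>2"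
proof -
  define N where "N = real CARD('m)"
  \<comment> \<open>The error of f0 counts once, that of each of the N fields f i counts 3 M times;
    the factor 2 leaves half of \<delta> for the terms of order \<epsilon>^3, which are controlled
    through \<open>p\<close>.\<close>
  define \<delta>' where "\<delta>' = \<delta> / (2 * (1 + 3 * N * M))"
  have p1: "0 < 1 + 3 * N * M" using M by (simp add: N_def add_pos_nonneg)
  have \<delta>': "0 < \<delta>'" using \<delta> p1 by (simp add: \<delta>'_def)
  have exp: "\<exists>e>0. \<forall>\<epsilon> x z \<zeta>. 0 < \<epsilon> \<longrightarrow> \<epsilon> \<le> e \<longrightarrow> x \<in> cball 0 R \<longrightarrow> norm z \<le> M \<longrightarrow> norm \<zeta> \<le> M \<longrightarrow>
     norm (g (x + \<epsilon> *\<^sub>R z + \<epsilon>\<^sup>2 *\<^sub>R \<zeta>) - g x - \<epsilon> *\<^sub>R g' x z - \<epsilon>\<^sup>2 *\<^sub>R (g' x \<zeta> + (1/2) *\<^sub>R g'' x z z)) \<le> \<delta>' * \<epsilon>\<^sup>2"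
    if g: "\<And>x. (g has_derivative blinfun_apply (g' x)) (at x)"
              "\<And>x. (g' has_derivative blinfun_apply (g'' x)) (at x)"
              "continuous_on UNIV g''" for g :: "real^'n \<Rightarrow> real^'n" and g' :: "(real^'n) \<Rightarrow> (real^'n) \<Rightarrow>\<^sub>L (real^'n)" and g''
  proof -
    obtain K where K: "0 \<le> K" "\<And>x. x \<in> cball 0 R \<Longrightarrow> norm (g'' x) \<le> K" using bounded_on_cball[OF g(3)] by blast
    have unif: "\<exists>r>0. \<forall>x\<in>cball 0 R. \<forall>y. norm y \<le> r \<longrightarrow> norm (g' (x + y) - g' x - blinfun_apply (g'' x) y) \<le> d * norm y" if "0 < d" for d
      using uniform_derivative_approx_on_compact[OF g(2,3) compact_cball that] by metis
    show ?thesis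
      using second_order_expansion[where X="cball 0 R" and f=g and f'=g' and f''=g'', OF g(1) unif K(2) \<delta>' M] by metis
  qed
  have "\<exists>C\<ge>0. \<forall>x\<in>cball 0 R. \<forall>z \<zeta>. norm z \<le> M \<longrightarrow> norm \<zeta> \<le> M \<longrightarrow> norm (blinfun_apply (f' i x) z) \<le> C \<and>
      norm (blinfun_apply (f' i x) \<zeta> + (1/2) *\<^sub>R blinfun_apply (blinfun_apply (f'' i x) z) z) \<le> C" for i
  proof -
    obtain K where K: "0 \<le> K" "\<And>x. x \<in> cball 0 R \<Longrightarrow> norm (f' i x) \<le> K" using bounded_on_cball[OF cont(4)] by blast
    obtain K2 where K2: "0 \<le> K2" "\<And>x. x \<in> cball 0 R \<Longrightarrow> norm (f'' i x) \<le> K2" using bounded_on_cball[OF f(3)] by blast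
    show ?thesis
    proof (intro exI[of _ "K * M + (K2 * M) * M"] conjI ballI allI impI)
      show "0 \<le> K * M + (K2 * M) * M" using K K2 M by simp
      fix x z \<zeta> :: "real^'n" assume x: "x \<in> cball 0 R" and z: "norm z \<le> M" "norm \<zeta> \<le> M"
      have l: "norm (f' i x y) \<le> K * M" if "norm y \<le> M" for y
        using norm_blinfun[of "f' i x" y] K(2)[OF x] K(1) that by (meson mult_mono norm_ge_zero order_trans)
      have "norm (f'' i x z) \<le> K2 * M"
        using norm_blinfun[of "f'' i x" z] K2(2)[OF x] K2(1) z(1) by (meson mult_mono norm_ge_zero order_trans)
      then have q: "norm (f'' i x z z) \<le> (K2 * M) * M"
        using norm_blinfun[of "f'' i x z" z] z(1) K2(1) M by (meson mult_mono mult_nonneg_nonneg norm_ge_zero order_trans)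
      have nn: "0 \<le> K2 * M * M" using K2(1) M by simp
      show "norm (blinfun_apply (f' i x) z) \<le> K * M + K2 * M * M" using l[OF z(1)] nn by linarith
      have "norm ((1/2) *\<^sub>R f'' i x z z) \<le> (K2 * M) * M" using q nn by simp
      then show "norm (blinfun_apply (f' i x) \<zeta> + (1/2) *\<^sub>R blinfun_apply (blinfun_apply (f'' i x) z) z) \<le> K * M + K2 * M * M"
        using l[OF z(2)] by (intro norm_triangle_mono) auto
    qed
  qed
  then obtain Ci where Ci: "\<And>i. 0 \<le> Ci i" "\<And>i x z \<zeta>. x\<in>cball 0 R \<Longrightarrow> norm z \<le> M \<Longrightarrow> norm \<zeta> \<le> M \<Longrightarrow> norm (blinfun_apply (f' i x) z) \<le> Ci i \<and>
      norm (blinfun_apply (f' i x) \<zeta> + (1/2) *\<^sub>R blinfun_apply (blinfun_apply (f'' i x) z) z) \<le> Ci i" by metis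
  define C where "C = (\<Sum>i\<in>UNIV. Ci i)"
  have CiC: "Ci i \<le> C" for i unfolding C_def by (rule member_le_sum) (use Ci in auto)
  have C0: "0 \<le> C" unfolding C_def by (intro sum_nonneg) (use Ci in auto)
  obtain e0 where e0: "e0 > 0" "\<And>\<epsilon> x z \<zeta>. 0 < \<epsilon> \<Longrightarrow> \<epsilon> \<le> e0 \<Longrightarrow> x \<in> cball 0 R \<Longrightarrow> norm z \<le> M \<Longrightarrow> norm \<zeta> \<le> M \<Longrightarrow>
     norm (f0 (x + \<epsilon> *\<^sub>R z + \<epsilon>\<^sup>2 *\<^sub>R \<zeta>) - f0 x - \<epsilon> *\<^sub>R f0' x z - \<epsilon>\<^sup>2 *\<^sub>R (f0' x \<zeta> + (1/2) *\<^sub>R f0'' x z z)) \<le> \<delta>' * \<epsilon>\<^sup>2"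
    using exp[OF f0] by metis
  have "\<forall>i. \<exists>e>0. \<forall>\<epsilon> x z \<zeta>. 0 < \<epsilon> \<longrightarrow> \<epsilon> \<le> e \<longrightarrow> x \<in> cball 0 R \<longrightarrow> norm z \<le> M \<longrightarrow> norm \<zeta> \<le> M \<longrightarrow>
     norm (f i (x + \<epsilon> *\<^sub>R z + \<epsilon>\<^sup>2 *\<^sub>R \<zeta>) - f i x - \<epsilon> *\<^sub>R f' i x z - \<epsilon>\<^sup>2 *\<^sub>R (f' i x \<zeta> + (1/2) *\<^sub>R f'' i x z z)) \<le> \<delta>' * \<epsilon>\<^sup>2"
    using exp[OF f] by blast
  then obtain ei where ei: "\<And>i. ei i > 0" "\<And>i \<epsilon> x z \<zeta>. 0 < \<epsilon> \<Longrightarrow> \<epsilon> \<le> ei i \<Longrightarrow> x \<in> cball 0 R \<Longrightarrow> norm z \<le> M \<Longrightarrow> norm \<zeta> \<le> M \<Longrightarrow>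
     norm (f i (x + \<epsilon> *\<^sub>R z + \<epsilon>\<^sup>2 *\<^sub>R \<zeta>) - f i x - \<epsilon> *\<^sub>R f' i x z - \<epsilon>\<^sup>2 *\<^sub>R (f' i x \<zeta> + (1/2) *\<^sub>R f'' i x z z)) \<le> \<delta>' * \<epsilon>\<^sup>2"
    by metis
  define p where "p = 3 * N * M * C + 1"
  have p: "0 < p" using M C0 by (simp add: p_def N_def add_nonneg_pos)
  define em where "em = Min (range ei)"
  have em: "0 < em" "\<And>i. em \<le> ei i" using ei(1) by (auto simp: em_def)
  show thesis
  proof (rule that[of "min (min 1 e0) (min em (\<delta> / (2 * p)))"])
    show "0 < min (min 1 e0) (min em (\<delta> / (2 * p)))" using e0 em \<delta> p by simp
    fix \<epsilon> :: real and x z \<zeta> :: "real^'n" and a b c :: "real^'m"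
    assume \<epsilon>: "0 < \<epsilon>" "\<epsilon> \<le> min (min 1 e0) (min em (\<delta> / (2 * p)))" and x: "norm x \<le> R" and z: "norm z \<le> M" "norm \<zeta> \<le> M"
      and abc: "norm a \<le> M" "norm b \<le> M" "norm c \<le> M"
    have xR: "x \<in> cball 0 R" using x by simp
    define y where "y = x + \<epsilon> *\<^sub>R z + \<epsilon>\<^sup>2 *\<^sub>R \<zeta>"
    define G0 where "G0 = f0 y - f0 x - \<epsilon> *\<^sub>R f0' x z - \<epsilon>\<^sup>2 *\<^sub>R (f0' x \<zeta> + (1/2) *\<^sub>R f0'' x z z)"
    define G where "G i = (a $ i + \<epsilon> * b $ i + \<epsilon>\<^sup>2 * c $ i) *\<^sub>R f i y - a $ i *\<^sub>R f i x - \<epsilon> *\<^sub>R (a $ i *\<^sub>R f' i x z + b $ i *\<^sub>R f i x)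
     - \<epsilon>\<^sup>2 *\<^sub>R (a $ i *\<^sub>R (f' i x \<zeta> + (1/2) *\<^sub>R f'' i x z z) + b $ i *\<^sub>R f' i x z + c $ i *\<^sub>R f i x)" for i
    have G0: "norm G0 \<le> \<delta>' * \<epsilon>\<^sup>2" unfolding G0_def y_def using \<epsilon> by (intro e0(2) xR z) auto
    have G: "norm (G i) \<le> 3 * M * (\<delta>' + \<epsilon> * C) * \<epsilon>\<^sup>2" for i
      unfolding G_def
    proof (rule product_expansion)
      show "norm (f i y - f i x - \<epsilon> *\<^sub>R f' i x z - \<epsilon>\<^sup>2 *\<^sub>R (f' i x \<zeta> + (1/2) *\<^sub>R f'' i x z z)) \<le> \<delta>' * \<epsilon>\<^sup>2"
        unfolding y_def using \<epsilon> em(2)[of i] by (intro ei(2) xR z) auto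
      show "\<bar>a $ i\<bar> \<le> M" "\<bar>b $ i\<bar> \<le> M" "\<bar>c $ i\<bar> \<le> M"
        using abc component_le_norm_cart order_trans by blast+
      show "norm (f' i x z) \<le> C" "norm (f' i x \<zeta> + (1/2) *\<^sub>R f'' i x z z) \<le> C"
        using Ci(2)[OF xR z, of i] CiC[of i] by auto
    qed (use \<epsilon> \<delta>' in auto)
    have "dyn f0 f y (a + \<epsilon> *\<^sub>R b + \<epsilon>\<^sup>2 *\<^sub>R c) - dyn f0 f x a - \<epsilon> *\<^sub>R (DA x a z + Bm x b)
         - \<epsilon>\<^sup>2 *\<^sub>R (DA x a \<zeta> + Qm x a z b + Bm x c) = G0 + (\<Sum>i\<in>UNIV. G i)"
      unfolding dyn_def DA_def Bm_def Qm_def G0_def G_def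
      by (simp add: scaleR_add_right sum.distrib sum_subtractf scaleR_sum_right scaleR_add_left algebra_simps)
    also have "norm \<dots> \<le> \<delta>' * \<epsilon>\<^sup>2 + (\<Sum>i\<in>(UNIV::'m set). 3 * M * (\<delta>' + \<epsilon> * C) * \<epsilon>\<^sup>2)"
      by (intro norm_triangle_mono G0 sum_norm_le G)
    also have "\<dots> = ((1 + 3 * N * M) * \<delta>' + \<epsilon> * (3 * N * M * C)) * \<epsilon>\<^sup>2"
      by (simp add: N_def algebra_simps)
    also have "\<dots> \<le> \<delta> * \<epsilon>\<^sup>2"
    proof (rule mult_right_mono)
      have "P * (\<delta> / (2 * P)) = \<delta> / 2" if "P > 0" for P using that by simp
      from this[OF p1] have "(1 + 3 * N * M) * \<delta>' = \<delta> / 2" unfolding \<delta>'_def .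
      moreover have "\<epsilon> * (2 * p) \<le> \<delta>" using \<epsilon> p by (simp add: pos_le_divide_eq)
      then have "\<epsilon> * (3 * N * M * C) \<le> \<delta> / 2" using \<epsilon> by (simp add: p_def algebra_simps)
      ultimately show "(1 + 3 * N * M) * \<delta>' + \<epsilon> * (3 * N * M * C) \<le> \<delta>" by simp
    qed simp
    finally show "norm (dyn f0 f (x + \<epsilon> *\<^sub>R z + \<epsilon>\<^sup>2 *\<^sub>R \<zeta>) (a + \<epsilon> *\<^sub>R b + \<epsilon>\<^sup>2 *\<^sub>R c) - dyn f0 f x a - \<epsilon> *\<^sub>R (DA x a z + Bm x b)
         - \<epsilon>\<^sup>2 *\<^sub>R (DA x a \<zeta> + Qm x a z b + Bm x c)) \<le> \<delta> * \<epsilon>\<^sup>2" unfolding y_def .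
  qed
qed

text \<open>The constant for the state grows with the size of the control, because the f i enter
  multiplied by it; splitting off the factor 1 + C lets one K serve both estimates.\<close>

lemma dyn_lipschitz:
  obtains K where "0 \<le> K"
    "\<And>x y a C. norm x \<le> R \<Longrightarrow> norm y \<le> R \<Longrightarrow> norm a \<le> C \<Longrightarrow> norm (dyn f0 f x a - dyn f0 f y a) \<le> (K * (1 + C)) * norm (x - y)"
    "\<And>x a b. norm x \<le> R \<Longrightarrow> norm (dyn f0 f x a - dyn f0 f x b) \<le> K * norm (a - b)"
proof -
  obtain K0 where K0: "0 \<le> K0" "\<And>x y. x \<in> cball 0 R \<Longrightarrow> y \<in> cball 0 R \<Longrightarrow> norm (f0 x - f0 y) \<le> K0 * norm (x - y)"
    using lipschitz_on_cball[OF f0(1) cont(2)] by blast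
  have "\<exists>K\<ge>0. \<forall>x y. x \<in> cball 0 R \<longrightarrow> y \<in> cball 0 R \<longrightarrow> norm (f i x - f i y) \<le> K * norm (x - y)" for i
    using lipschitz_on_cball[OF f(1) cont(4)] by metis
  then obtain Ki where Ki: "\<And>i. 0 \<le> Ki i" "\<And>i x y. x \<in> cball 0 R \<Longrightarrow> y \<in> cball 0 R \<Longrightarrow> norm (f i x - f i y) \<le> Ki i * norm (x - y)"
    by metis
  have "\<exists>K\<ge>0. \<forall>x. x \<in> cball 0 R \<longrightarrow> norm (f i x) \<le> K" for i
    using bounded_on_cball[OF cont(3)] by metis
  then obtain Bi where Bi: "\<And>i. 0 \<le> Bi i" "\<And>i x. x \<in> cball 0 R \<Longrightarrow> norm (f i x) \<le> Bi i" by metis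
  define K where "K = K0 + (\<Sum>i\<in>UNIV. Ki i) + (\<Sum>i\<in>UNIV. Bi i)"
  have s: "0 \<le> (\<Sum>i\<in>UNIV. Ki i)" "0 \<le> (\<Sum>i\<in>UNIV. Bi i)" by (intro sum_nonneg Ki Bi)+
  show thesis
  proof (rule that[of K])
    show "0 \<le> K" using K0 s by (simp add: K_def)
    fix x :: "real^'n" assume x: "norm x \<le> R"
    {
      fix y :: "real^'n" and a :: "real^'m" and C assume y: "norm y \<le> R" and a: "norm a \<le> C"
      have C: "0 \<le> C" using a norm_ge_zero order_trans by blast
      have "dyn f0 f x a - dyn f0 f y a = (f0 x - f0 y) + (\<Sum>i\<in>UNIV. a $ i *\<^sub>R (f i x - f i y))"
        by (simp add: dyn_def scaleR_diff_right sum_subtractf)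
      also have "norm \<dots> \<le> K0 * norm (x - y) + (\<Sum>i\<in>UNIV. C * (Ki i * norm (x - y)))"
      proof (intro norm_triangle_mono sum_norm_le)
        show "norm (f0 x - f0 y) \<le> K0 * norm (x - y)" using K0 x y by auto
        show "norm (a $ i *\<^sub>R (f i x - f i y)) \<le> C * (Ki i * norm (x - y))" for i
          unfolding norm_scaleR using Ki(2)[of x y i] x y C a component_le_norm_cart[of a i] by (intro mult_mono) auto
      qed
      also have "\<dots> = (K0 + C * (\<Sum>i\<in>UNIV. Ki i)) * norm (x - y)"
        by (simp add: sum_distrib_left[symmetric] sum_distrib_right[symmetric] algebra_simps)
      also have "\<dots> \<le> (K * (1 + C)) * norm (x - y)"
      proof (rule mult_right_mono)
        have "K0 * 1 + (\<Sum>i\<in>UNIV. Ki i) * C \<le> K * 1 + K * C"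
          using K0 s C by (intro add_mono mult_right_mono) (auto simp: K_def)
        then show "K0 + C * (\<Sum>i\<in>UNIV. Ki i) \<le> K * (1 + C)" by (simp add: algebra_simps)
      qed simp
      finally show "norm (dyn f0 f x a - dyn f0 f y a) \<le> (K * (1 + C)) * norm (x - y)" .
    }
    fix a b :: "real^'m"
    have "dyn f0 f x a - dyn f0 f x b = (\<Sum>i\<in>UNIV. (a - b) $ i *\<^sub>R f i x)"
      by (simp add: dyn_def scaleR_diff_left sum_subtractf)
    also have "norm \<dots> \<le> (\<Sum>i\<in>UNIV. norm (a - b) * Bi i)"
    proof (rule sum_norm_le)
      show "norm ((a - b) $ i *\<^sub>R f i x) \<le> norm (a - b) * Bi i" for i
        unfolding norm_scaleR using Bi(2)[of x i] x component_le_norm_cart[of "a - b" i] by (intro mult_mono) auto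
    qed
    also have "\<dots> = (\<Sum>i\<in>UNIV. Bi i) * norm (a - b)" by (simp add: sum_distrib_left[symmetric])
    also have "\<dots> \<le> K * norm (a - b)" using K0 s by (intro mult_right_mono) (auto simp: K_def)
    finally show "norm (dyn f0 f x a - dyn f0 f x b) \<le> K * norm (a - b)" .
  qed
qed

text \<open>A finite sum of continuous factors times coordinates of a control: affine dependence on
  the control keeps the integrand integrable when the control is merely integrable. The three
  integrands that follow have the same structure.\<close>

lemma dyn_abs_int:
  fixes T :: real
  assumes x: "continuous_on {0..T} x" and a: "a absolutely_integrable_on {0..T}"
  shows "(\<lambda>t. dyn f0 f (x t) (a t)) absolutely_integrable_on {0..T}"
  unfolding dyn_def
  by (intro set_integral_add(1) absolutely_integrable_sum absolutely_integrable_scaleR_continuous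
      absolutely_integrable_vec_nth[OF a] absolutely_integrable_continuous_real
      continuous_on_compose2[OF cont(1) x] continuous_on_compose2[OF cont(3) x]) auto

lemma DA_abs_int:
  fixes T :: real
  assumes x: "continuous_on {0..T} x" and z: "continuous_on {0..T} z" and a: "a absolutely_integrable_on {0..T}"
  shows "(\<lambda>t. DA (x t) (a t) (z t)) absolutely_integrable_on {0..T}"
  unfolding DA_def
  by (intro set_integral_add(1) absolutely_integrable_sum absolutely_integrable_scaleR_continuous
      absolutely_integrable_vec_nth[OF a] absolutely_integrable_continuous_real blinfun.continuous_on z
      continuous_on_compose2[OF cont(2) x] continuous_on_compose2[OF cont(4) x]) auto

lemma Bm_abs_int:
  fixes T :: real
  assumes x: "continuous_on {0..T} x" and a: "a absolutely_integrable_on {0..T}"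
  shows "(\<lambda>t. Bm (x t) (a t)) absolutely_integrable_on {0..T}"
  unfolding Bm_def
  by (intro absolutely_integrable_sum absolutely_integrable_scaleR_continuous
      absolutely_integrable_vec_nth[OF a] continuous_on_compose2[OF cont(3) x]) auto

lemma Qm_abs_int:
  fixes T :: real
  assumes x: "continuous_on {0..T} x" and z: "continuous_on {0..T} z" and a: "a absolutely_integrable_on {0..T}"
    and b: "b absolutely_integrable_on {0..T}"
  shows "(\<lambda>t. Qm (x t) (a t) (z t) (b t)) absolutely_integrable_on {0..T}"
  unfolding Qm_def
  by (intro set_integral_add(1) absolutely_integrable_cmul absolutely_integrable_sum absolutely_integrable_scaleR_continuous
      absolutely_integrable_vec_nth[OF a] absolutely_integrable_vec_nth[OF b] absolutely_integrable_continuous_real blinfun.continuous_on z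
      continuous_on_compose2[OF f0(3) x] continuous_on_compose2[OF f(3) x] continuous_on_compose2[OF cont(4) x]) auto

end

text \<open>The reference pair. u is a representative bounded at every time and the state equation
  is in integral form, so that pointwise estimates carry no exceptional sets.\<close>

locale control_system = c2_dynamics f0 f f0' f' f0'' f''
  for f0 :: "(real^'n) \<Rightarrow> (real^'n)" and f :: "'m::finite \<Rightarrow> (real^'n) \<Rightarrow> (real^'n)"
    and f0' f' f0'' f'' +
  fixes T Mu :: real and x0 :: "real^'n" and xh :: "real \<Rightarrow> real^'n" and u :: "real \<Rightarrow> real^'m"
  assumes T: "0 < T" and u_meas: "u \<in> borel_measurable (lebesgue_on {0..T})"
    and u_bound: "\<And>t. t \<in> {0..T} \<Longrightarrow> norm (u t) \<le> Mu"
    and xh_cont: "continuous_on {0..T} xh"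
    and xh_eq: "\<And>t. t \<in> {0..T} \<Longrightarrow> xh t = x0 + integral {0..t} (\<lambda>s. dyn f0 f (xh s) (u s))"
begin

lemma u_int: "u absolutely_integrable_on {0..T}"
  by (rule absolutely_integrable_bounded_measurable[OF u_meas u_bound])

lemma Mu: "0 \<le> Mu" using order_trans[OF norm_ge_zero u_bound[of 0]] T by simp

lemma xh_bounded: obtains R where "\<And>t. t \<in> {0..T} \<Longrightarrow> norm (xh t) \<le> R"
proof -
  have "bounded (xh ` {0..T})" by (intro compact_imp_bounded compact_continuous_image xh_cont) auto
  then show thesis using that by (meson bounded_iff image_eqI)
qed

lemma linear_bound: "\<exists>L\<ge>0. \<forall>t\<in>{0..T}. (\<forall>z. norm (DA (xh t) (u t) z) \<le> L * norm z) \<and> (\<forall>v. norm (Bm (xh t) v) \<le> L * norm v)"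
proof -
  obtain R where R: "\<And>t. t \<in> {0..T} \<Longrightarrow> norm (xh t) \<le> R" using xh_bounded by blast
  obtain K0 where K0: "0 \<le> K0" "\<And>x. x \<in> cball 0 R \<Longrightarrow> norm (f0' x) \<le> K0" using bounded_on_cball[OF cont(2)] by blast
  have "\<exists>K\<ge>0. \<forall>x. x \<in> cball 0 R \<longrightarrow> norm (f' i x) \<le> K" for i using bounded_on_cball[OF cont(4)] by metis
  then obtain Ki where Ki: "\<And>i. 0 \<le> Ki i" "\<And>i x. x \<in> cball 0 R \<Longrightarrow> norm (f' i x) \<le> Ki i" by metis
  have "\<exists>K\<ge>0. \<forall>x. x \<in> cball 0 R \<longrightarrow> norm (f i x) \<le> K" for i using bounded_on_cball[OF cont(3)] by metis
  then obtain Bi where Bi: "\<And>i. 0 \<le> Bi i" "\<And>i x. x \<in> cball 0 R \<Longrightarrow> norm (f i x) \<le> Bi i" by metis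
  define L where "L = K0 + (\<Sum>i\<in>UNIV. Mu * Ki i) + (\<Sum>i\<in>UNIV. Bi i)"
  have s: "0 \<le> (\<Sum>i\<in>UNIV. Mu * Ki i)" "0 \<le> (\<Sum>i\<in>UNIV. Bi i)" by (intro sum_nonneg mult_nonneg_nonneg Mu Ki Bi)+
  show ?thesis
  proof (intro exI[of _ L] conjI ballI allI)
    show "0 \<le> L" using K0 s by (simp add: L_def)
    fix t assume t: "t \<in> {0..T}"
    then have x: "xh t \<in> cball 0 R" using R by simp
    show "norm (DA (xh t) (u t) z) \<le> L * norm z" for z
    proof -
      have "norm (DA (xh t) (u t) z) \<le> K0 * norm z + (\<Sum>i\<in>UNIV. Mu * Ki i * norm z)"
        unfolding DA_def
      proof (intro norm_triangle_mono sum_norm_le)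
        show "norm (f0' (xh t) z) \<le> K0 * norm z"
          using norm_blinfun[of "f0' (xh t)" z] K0(2)[OF x] by (meson mult_right_mono norm_ge_zero order_trans)
        fix i
        have "norm (f' i (xh t) z) \<le> Ki i * norm z"
          using norm_blinfun[of "f' i (xh t)" z] Ki(2)[OF x] by (meson mult_right_mono norm_ge_zero order_trans)
        then have "\<bar>u t $ i\<bar> * norm (f' i (xh t) z) \<le> Mu * (Ki i * norm z)"
          using u_bound[OF t] component_le_norm_cart[of "u t" i] Mu by (intro mult_mono) auto
        then show "norm (u t $ i *\<^sub>R f' i (xh t) z) \<le> Mu * Ki i * norm z" by (simp add: mult.assoc)
      qed
      also have "\<dots> = (K0 + (\<Sum>i\<in>UNIV. Mu * Ki i)) * norm z" by (simp add: sum_distrib_right distrib_right)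
      also have "\<dots> \<le> L * norm z" using s by (intro mult_right_mono) (auto simp: L_def)
      finally show ?thesis .
    qed
    show "norm (Bm (xh t) v) \<le> L * norm v" for v
    proof -
      have "norm (Bm (xh t) v) \<le> (\<Sum>i\<in>UNIV. norm v * Bi i)"
        unfolding Bm_def
      proof (rule sum_norm_le)
        show "norm (v $ i *\<^sub>R f i (xh t)) \<le> norm v * Bi i" for i
          unfolding norm_scaleR using Bi(2)[OF x, of i] component_le_norm_cart[of v i] by (intro mult_mono) auto
      qed
      also have "\<dots> = (\<Sum>i\<in>UNIV. Bi i) * norm v" by (simp add: sum_distrib_left[symmetric])
      also have "\<dots> \<le> L * norm v" using K0 s by (intro mult_right_mono) (auto simp: L_def)
      finally show ?thesis .
    qed
  qed
qed

text \<open>Fixed by choice because the sublocale below takes it as a parameter; any common bound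
  for the two linearised operators serves.\<close>

definition L where "L = (SOME L. 0 \<le> L \<and> (\<forall>t\<in>{0..T}. (\<forall>z. norm (DA (xh t) (u t) z) \<le> L * norm z) \<and> (\<forall>v. norm (Bm (xh t) v) \<le> L * norm v)))"

lemma L: "0 \<le> L" "\<And>t z. t \<in> {0..T} \<Longrightarrow> norm (DA (xh t) (u t) z) \<le> L * norm z" "\<And>t v. t \<in> {0..T} \<Longrightarrow> norm (Bm (xh t) v) \<le> L * norm v"
proof -
  have *: "0 \<le> L \<and> (\<forall>t\<in>{0..T}. (\<forall>z. norm (DA (xh t) (u t) z) \<le> L * norm z) \<and> (\<forall>v. norm (Bm (xh t) v) \<le> L * norm v))"
    unfolding L_def by (rule someI_ex[OF linear_bound])
  from * show "0 \<le> L" by (rule conjunct1)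
  from * show "norm (DA (xh t) (u t) z) \<le> L * norm z" "norm (Bm (xh t) v) \<le> L * norm v" if "t \<in> {0..T}" for t z v using that by simp_all
qed

lemma linear_DA: "linear (DA x a)"
  by (rule linearI) (simp_all add: DA_def blinfun.add_right blinfun.scaleR_right scaleR_add_right sum.distrib scaleR_sum_right mult.commute)

sublocale lin: linear_system T L "\<lambda>t. DA (xh t) (u t)"
  by unfold_locales (use T L linear_add[OF linear_DA] linear_cmul[OF linear_DA] DA_abs_int[OF xh_cont _ u_int] in auto)

end

text \<open>The form in which Gronwall compares two curves: c is either the Taylor remainder of the
  field or the effect of changing the control.\<close>

lemma gronwall_difference:
  fixes D h :: "real \<Rightarrow> 'a::euclidean_space"
  assumes T: "0 \<le> T" and L: "0 \<le> L" and c: "0 \<le> c" and D: "continuous_on {0..T} D" and h: "h integrable_on {0..T}"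
    and eq: "\<And>t. t \<in> {0..T} \<Longrightarrow> D t = integral {0..t} h"
    and le: "\<And>s. s \<in> {0..T} \<Longrightarrow> norm (h s) \<le> L * norm (D s) + c" and t: "t \<in> {0..T}"
  shows "norm (D t) \<le> 2 * (c * T) * exp (2 * L * T)"
proof (rule gronwall_bound[where e="\<lambda>t. norm (D t)", OF L _ T _ _ t])
  show "0 \<le> c * T" using c T by simp
  show "continuous_on {0..T} (\<lambda>t. norm (D t))" by (intro continuous_intros D)
  fix t assume t: "t \<in> {0..T}"
  have Di: "(\<lambda>s. norm (D s)) integrable_on {0..t}"
    by (intro integrable_continuous_real continuous_intros continuous_on_subset[OF D]) (use t in auto)
  have "norm (D t) = norm (integral {0..t} h)" by (simp only: eq[OF t])
  also have "\<dots> \<le> integral {0..t} (\<lambda>s. L * norm (D s) + c)"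
  proof (rule Henstock_Kurzweil_Integration.integral_norm_bound_integral)
    show "h integrable_on {0..t}" by (rule integrable_on_subinterval[OF h]) (use t in auto)
    show "(\<lambda>s. L * norm (D s) + c) integrable_on {0..t}"
      by (intro Henstock_Kurzweil_Integration.integrable_add integrable_on_mult_right Di) auto
    show "norm (h r) \<le> L * norm (D r) + c" if "r \<in> {0..t}" for r
      by (rule le) (use that t in auto)
  qed
  also have "\<dots> = L * integral {0..t} (\<lambda>s. norm (D s)) + c * t"
    using t by (subst Henstock_Kurzweil_Integration.integral_add) (auto intro!: integrable_on_mult_right Di)
  also have "\<dots> \<le> c * T + L * integral {0..t} (\<lambda>s. norm (D s))"
    using t c by (simp add: mult_left_mono)
  finally show "norm (D t) \<le> c * T + L * integral {0..t} (\<lambda>s. norm (D s))" .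
qed

context control_system
begin

lemma sol_continuous_bounded:
  assumes "lin.sol h y" obtains M where "\<And>t. t \<in> {0..T} \<Longrightarrow> norm (y t) \<le> M"
proof -
  have "bounded (y ` {0..T})" by (intro compact_imp_bounded compact_continuous_image lin.solD(2)[OF assms]) auto
  then show thesis using that by (meson bounded_iff image_eqI)
qed

text \<open>w enters the bound only through its supremum, so the bound is uniform over a family of
  controls.\<close>

lemma sol_Bm_bound:
  assumes y: "lin.sol (\<lambda>t. Bm (xh t) (w t)) y" and w: "\<And>t. t \<in> {0..T} \<Longrightarrow> norm (w t) \<le> M" and t: "t \<in> {0..T}"
  shows "norm (y t) \<le> 2 * (L * M * T) * exp (2 * L * T)"
proof -
  have "integral {0..T} (\<lambda>s. norm (Bm (xh s) (w s))) \<le> integral {0..T} (\<lambda>s. L * M)"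
  proof (rule integral_le)
    show "(\<lambda>s. norm (Bm (xh s) (w s))) integrable_on {0..T}" using lin.solD(1)[OF y] by (simp add: absolutely_integrable_on_def)
    show "norm (Bm (xh s) (w s)) \<le> L * M" if "s \<in> {0..T}" for s
      using L(3)[OF that, of "w s"] mult_left_mono[OF w[OF that] L(1)] by linarith
  qed auto
  also have "\<dots> = L * M * T" using T by simp
  finally have "integral {0..T} (\<lambda>s. norm (Bm (xh s) (w s))) \<le> L * M * T" .
  then have "2 * integral {0..T} (\<lambda>s. norm (Bm (xh s) (w s))) * exp (2 * L * T) \<le> 2 * (L * M * T) * exp (2 * L * T)"
    by (intro mult_right_mono mult_left_mono) auto
  then show ?thesis using lin.sol_bound[OF y t] by linarith
qed

text \<open>The second-order polynomial in \<epsilon> solves exactly the integral equation whose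
  right-hand side is the second-order polynomial of the dynamics. Compared with the true trajectory,
  only the remainder of \<open>dyn_expansion\<close> is left.\<close>

lemma expansion_integral_equation:
  fixes \<epsilon> :: real
  assumes z: "lin.sol (\<lambda>t. Bm (xh t) (v t)) z" and s: "lin.sol (\<lambda>t. Qm (xh t) (u t) (z t) (v t)) s"
    and y: "lin.sol (\<lambda>t. Bm (xh t) (w t)) y"
  defines "\<zeta> \<equiv> \<lambda>t. s t + y t"
  defines "E \<equiv> \<lambda>r. dyn f0 f (xh r) (u r) + \<epsilon> *\<^sub>R (DA (xh r) (u r) (z r) + Bm (xh r) (v r))
      + \<epsilon>\<^sup>2 *\<^sub>R (DA (xh r) (u r) (\<zeta> r) + Qm (xh r) (u r) (z r) (v r) + Bm (xh r) (w r))"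
  shows "E integrable_on {0..T}" "continuous_on {0..T} (\<lambda>t. xh t + \<epsilon> *\<^sub>R z t + \<epsilon>\<^sup>2 *\<^sub>R \<zeta> t)"
    "t \<in> {0..T} \<Longrightarrow> xh t + \<epsilon> *\<^sub>R z t + \<epsilon>\<^sup>2 *\<^sub>R \<zeta> t = x0 + integral {0..t} E"
proof -
  have \<zeta>: "lin.sol (\<lambda>t. Qm (xh t) (u t) (z t) (v t) + Bm (xh t) (w t)) \<zeta>" unfolding \<zeta>_def by (rule lin.sol_add[OF s y])
  have zeq: "z t = integral {0..t} (\<lambda>r. DA (xh r) (u r) (z r) + Bm (xh r) (v r))" if "t \<in> {0..T}" for t
    by (rule lin.solD(3)[OF z that])
  have \<zeta>eq: "\<zeta> t = integral {0..t} (\<lambda>r. DA (xh r) (u r) (\<zeta> r) + Qm (xh r) (u r) (z r) (v r) + Bm (xh r) (w r))" if "t \<in> {0..T}" for t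
    using lin.solD(3)[OF \<zeta> that] by (simp only: add.assoc)
  have i1: "(\<lambda>r. dyn f0 f (xh r) (u r)) integrable_on {0..T}"
    using dyn_abs_int[OF xh_cont u_int] by (simp add: absolutely_integrable_on_def)
  have i2: "(\<lambda>r. DA (xh r) (u r) (z r) + Bm (xh r) (v r)) integrable_on {0..T}"
    using lin.sol_abs_int[OF z] by (simp add: absolutely_integrable_on_def)
  have i3: "(\<lambda>r. DA (xh r) (u r) (\<zeta> r) + Qm (xh r) (u r) (z r) (v r) + Bm (xh r) (w r)) integrable_on {0..T}"
    using lin.sol_abs_int[OF \<zeta>] by (simp add: absolutely_integrable_on_def add.assoc)
  show "E integrable_on {0..T}" unfolding E_def
    by (intro Henstock_Kurzweil_Integration.integrable_add integrable_cmul i1 i2 i3)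
  show "continuous_on {0..T} (\<lambda>t. xh t + \<epsilon> *\<^sub>R z t + \<epsilon>\<^sup>2 *\<^sub>R \<zeta> t)"
    by (intro continuous_intros xh_cont lin.solD(2)[OF z] lin.solD(2)[OF \<zeta>])
  assume t: "t \<in> {0..T}"
  have sub: "g integrable_on {0..t}" if "g integrable_on {0..T}" for g :: "real \<Rightarrow> real^'n"
    by (rule integrable_on_subinterval[OF that]) (use t in auto)
  have "integral {0..t} E = integral {0..t} (\<lambda>r. dyn f0 f (xh r) (u r) + \<epsilon> *\<^sub>R (DA (xh r) (u r) (z r) + Bm (xh r) (v r)))
      + integral {0..t} (\<lambda>r. \<epsilon>\<^sup>2 *\<^sub>R (DA (xh r) (u r) (\<zeta> r) + Qm (xh r) (u r) (z r) (v r) + Bm (xh r) (w r)))"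
    unfolding E_def by (intro Henstock_Kurzweil_Integration.integral_add Henstock_Kurzweil_Integration.integrable_add integrable_cmul sub i1 i2 i3)
  also have "integral {0..t} (\<lambda>r. dyn f0 f (xh r) (u r) + \<epsilon> *\<^sub>R (DA (xh r) (u r) (z r) + Bm (xh r) (v r)))
    = integral {0..t} (\<lambda>r. dyn f0 f (xh r) (u r)) + integral {0..t} (\<lambda>r. \<epsilon> *\<^sub>R (DA (xh r) (u r) (z r) + Bm (xh r) (v r)))"
    by (intro Henstock_Kurzweil_Integration.integral_add Henstock_Kurzweil_Integration.integrable_add integrable_cmul sub i1 i2)
  finally have "integral {0..t} E = integral {0..t} (\<lambda>r. dyn f0 f (xh r) (u r)) + \<epsilon> *\<^sub>R z t + \<epsilon>\<^sup>2 *\<^sub>R \<zeta> t"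
    unfolding integral_cmul zeq[OF t, symmetric] \<zeta>eq[OF t, symmetric] .
  then show "xh t + \<epsilon> *\<^sub>R z t + \<epsilon>\<^sup>2 *\<^sub>R \<zeta> t = x0 + integral {0..t} E"
    unfolding xh_eq[OF t] by (simp only: add.assoc)
qed

text \<open>Brouwer's theorem will be applied to the endpoint map, so the family needs a common
  \<epsilon>0 and endpoints continuous in p. The field is only locally Lipschitz; it is first
  composed with the projection onto a ball, and the estimate then shows that the trajectories never
  leave that ball.\<close>

lemma perturbed_trajectories:
  fixes K :: "'p::metric_space set" and w :: "'p \<Rightarrow> real \<Rightarrow> real^'m" and y :: "'p \<Rightarrow> real \<Rightarrow> real^'n"
  assumes \<delta>: "0 < \<delta>"
    and v: "v \<in> borel_measurable (lebesgue_on {0..T})" "\<And>t. t \<in> {0..T} \<Longrightarrow> norm (v t) \<le> M"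
    and z: "lin.sol (\<lambda>t. Bm (xh t) (v t)) z" and s: "lin.sol (\<lambda>t. Qm (xh t) (u t) (z t) (v t)) s"
    and w: "\<And>p. p \<in> K \<Longrightarrow> w p \<in> borel_measurable (lebesgue_on {0..T})" "\<And>p t. p \<in> K \<Longrightarrow> t \<in> {0..T} \<Longrightarrow> norm (w p t) \<le> M"
    and y: "\<And>p. p \<in> K \<Longrightarrow> lin.sol (\<lambda>t. Bm (xh t) (w p t)) (y p)"
    and wcont: "\<And>p e. p \<in> K \<Longrightarrow> 0 < e \<Longrightarrow> \<exists>d>0. \<forall>p'\<in>K. dist p' p < d \<longrightarrow> (\<forall>t\<in>{0..T}. norm (w p' t - w p t) \<le> e)"
  obtains \<epsilon>0 where "0 < \<epsilon>0" "\<And>\<epsilon>. 0 < \<epsilon> \<Longrightarrow> \<epsilon> \<le> \<epsilon>0 \<Longrightarrow> \<exists>X. continuous_on K (\<lambda>p. X p T) \<and>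
     (\<forall>p\<in>K. continuous_on {0..T} (X p) \<and> (\<forall>t\<in>{0..T}.
        X p t = x0 + integral {0..t} (\<lambda>r. dyn f0 f (X p r) (u r + \<epsilon> *\<^sub>R v r + \<epsilon>\<^sup>2 *\<^sub>R w p r)) \<and>
        norm (X p t - (xh t + \<epsilon> *\<^sub>R z t + \<epsilon>\<^sup>2 *\<^sub>R (s t + y p t))) \<le> \<delta> * \<epsilon>\<^sup>2))"
proof -
  have M: "0 \<le> M" using order_trans[OF norm_ge_zero v(2)[of 0]] T by simp
  obtain R0 where R0: "\<And>t. t \<in> {0..T} \<Longrightarrow> norm (xh t) \<le> R0" using xh_bounded by blast
  obtain Mz where Mz: "\<And>t. t \<in> {0..T} \<Longrightarrow> norm (z t) \<le> Mz" using sol_continuous_bounded[OF z] by blast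
  obtain Ms where Ms: "\<And>t. t \<in> {0..T} \<Longrightarrow> norm (s t) \<le> Ms" using sol_continuous_bounded[OF s] by blast
  define My where "My = 2 * (L * M * T) * exp (2 * L * T)"
  have My: "norm (y p t) \<le> My" if "p \<in> K" "t \<in> {0..T}" for p t
    unfolding My_def by (rule sol_Bm_bound[OF y w(2)]) (use that in auto)
  define M' where "M' = max (max M Mu) (max Mz (Ms + My))"
  have M': "0 \<le> M'" "M \<le> M'" "Mu \<le> M'" "Mz \<le> M'" "Ms + My \<le> M'" using M by (auto simp: M'_def)
  \<comment> \<open>The polynomial stays within R0 + 1/2, and the trajectory within another 1/2 of
    it.\<close>
  define R where "R = R0 + 1"
  define Cu where "Cu = Mu + M + M"
  obtain Kd where Kd: "0 \<le> Kd"
    "\<And>x y a C. norm x \<le> R \<Longrightarrow> norm y \<le> R \<Longrightarrow> norm a \<le> C \<Longrightarrow> norm (dyn f0 f x a - dyn f0 f y a) \<le> (Kd * (1 + C)) * norm (x - y)"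
    "\<And>x a b. norm x \<le> R \<Longrightarrow> norm (dyn f0 f x a - dyn f0 f x b) \<le> Kd * norm (a - b)"
    using dyn_lipschitz[of R] by blast
  define L1 where "L1 = Kd * (1 + Cu)"
  have L1: "0 \<le> L1" using Kd(1) M Mu by (simp add: L1_def Cu_def)
  \<comment> \<open>Gronwall's amplification factor for an error in the right-hand side.\<close>
  define q where "q = 2 * T * exp (2 * L1 * T)"
  have q: "0 < q" using T by (simp add: q_def)
  \<comment> \<open>The minimum with 1/2 keeps the trajectories in the ball even when \<delta> is
    large.\<close>
  define \<delta>' where "\<delta>' = min \<delta> (1/2) / q"
  have \<delta>': "0 < \<delta>'" using \<delta> q by (simp add: \<delta>'_def)
  obtain e1 where e1: "0 < e1"
    "\<And>\<epsilon> x z \<zeta> a b c. 0 < \<epsilon> \<Longrightarrow> \<epsilon> \<le> e1 \<Longrightarrow> norm x \<le> R0 \<Longrightarrow> norm z \<le> M' \<Longrightarrow> norm \<zeta> \<le> M' \<Longrightarrow>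
       norm a \<le> M' \<Longrightarrow> norm b \<le> M' \<Longrightarrow> norm c \<le> M' \<Longrightarrow>
       norm (dyn f0 f (x + \<epsilon> *\<^sub>R z + \<epsilon>\<^sup>2 *\<^sub>R \<zeta>) (a + \<epsilon> *\<^sub>R b + \<epsilon>\<^sup>2 *\<^sub>R c) - dyn f0 f x a - \<epsilon> *\<^sub>R (DA x a z + Bm x b)
         - \<epsilon>\<^sup>2 *\<^sub>R (DA x a \<zeta> + Qm x a z b + Bm x c)) \<le> \<delta>' * \<epsilon>\<^sup>2"
    using dyn_expansion[OF \<delta>' M'(1), of R0] by blast
  \<comment> \<open>The last bound makes 2 M' \<epsilon> at most 1/2, the distance allowed between
    the polynomial and xh.\<close>
  define \<epsilon>0 where "\<epsilon>0 = min (min 1 e1) (1 / (4 * M' + 1))"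
  show thesis
  proof (rule that[of \<epsilon>0])
    show "0 < \<epsilon>0" using e1 M' by (simp add: \<epsilon>0_def)
    fix \<epsilon> :: real assume \<epsilon>: "0 < \<epsilon>" "\<epsilon> \<le> \<epsilon>0"
    have \<epsilon>1: "\<epsilon> \<le> 1" "\<epsilon> \<le> e1" "\<epsilon> \<le> 1 / (4 * M' + 1)" using \<epsilon> by (auto simp: \<epsilon>0_def)
    have \<epsilon>2: "\<epsilon>\<^sup>2 \<le> \<epsilon>" "\<epsilon>\<^sup>2 \<le> 1" "0 \<le> \<epsilon>\<^sup>2" using \<epsilon> \<epsilon>1 by (auto simp: power2_eq_square mult_le_one)
    have "\<epsilon> * (4 * M' + 1) \<le> 1" using \<epsilon>1(3) M'(1) by (simp add: pos_le_divide_eq)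
    then have \<epsilon>M: "2 * M' * \<epsilon> \<le> 1/2" using \<epsilon> by (simp add: algebra_simps)
    define U where "U p r = u r + \<epsilon> *\<^sub>R v r + \<epsilon>\<^sup>2 *\<^sub>R w p r" for p r
    have Ub: "norm (U p t) \<le> Cu" if "p \<in> K" "t \<in> {0..T}" for p t
    proof -
      have "norm (\<epsilon> *\<^sub>R v t) \<le> 1 * M" unfolding norm_scaleR using \<epsilon> \<epsilon>1 v(2)[OF that(2)] by (intro mult_mono) auto
      moreover have "norm (\<epsilon>\<^sup>2 *\<^sub>R w p t) \<le> 1 * M" unfolding norm_scaleR using \<epsilon>2 w(2)[OF that] by (intro mult_mono) auto
      ultimately have "norm (U p t) \<le> Mu + 1 * M + 1 * M" unfolding U_def using u_bound[OF that(2)] by (intro norm_triangle_mono)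
      then show ?thesis by (simp add: Cu_def)
    qed
    have Ui: "U p absolutely_integrable_on {0..T}" if "p \<in> K" for p
      unfolding U_def[abs_def]
      by (intro set_integral_add(1) absolutely_integrable_cmul u_int absolutely_integrable_bounded_measurable[OF v]
           absolutely_integrable_bounded_measurable[OF w(1) w(2)] that)
    \<comment> \<open>Projection onto the ball: it is 1-Lipschitz, so the composed field is globally
      Lipschitz with constant L1, and it fixes the ball pointwise.\<close>
    define \<pi> where "\<pi> = closest_point (cball (0::real^'n) R)"
    have R: "0 \<le> R" using order_trans[OF norm_ge_zero R0[of 0]] T by (simp add: R_def)
    have \<pi>R: "norm (\<pi> x) \<le> R" for x
      using closest_point_in_set[of "cball (0::real^'n) R" x] R by (auto simp: \<pi>_def)
    have \<pi>id: "\<pi> x = x" if "norm x \<le> R" for x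
      unfolding \<pi>_def by (rule closest_point_self) (use that in auto)
    have \<pi>lip: "norm (\<pi> x - \<pi> y) \<le> norm (x - y)" for x y
      using closest_point_lipschitz[of "cball (0::real^'n) R" x y] R by (auto simp: \<pi>_def dist_norm)
    have \<pi>c: "continuous_on S \<pi>" for S
      unfolding \<pi>_def by (rule continuous_on_closest_point) (use R in auto)
    have "\<exists>X. continuous_on {0..T} X \<and> (\<forall>t\<in>{0..T}. X t = x0 + integral {0..t} (\<lambda>r. dyn f0 f (\<pi> (X r)) (U p r)))"
      if p: "p \<in> K" for p
    proof -
      obtain X where "continuous_on {0..T} X" "\<And>t. t \<in> {0..T} \<Longrightarrow> X t = x0 + integral {0..t} (\<lambda>r. dyn f0 f (\<pi> (X r)) (U p r))"
      proof (rule integral_equation_exists[of T L1 "\<lambda>r x. dyn f0 f (\<pi> x) (U p r)" x0])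
        show "(\<lambda>r. dyn f0 f (\<pi> (x r)) (U p r)) integrable_on {0..T}" if "continuous_on {0..T} x" for x
          using dyn_abs_int[OF continuous_on_compose2[OF \<pi>c that subset_UNIV] Ui[OF p]] by (simp add: absolutely_integrable_on_def)
        fix r x y assume r: "r \<in> {0..T}"
        have "norm (dyn f0 f (\<pi> x) (U p r) - dyn f0 f (\<pi> y) (U p r)) \<le> L1 * norm (\<pi> x - \<pi> y)"
          unfolding L1_def by (rule Kd(2)[OF \<pi>R \<pi>R Ub[OF p r]])
        also have "\<dots> \<le> L1 * norm (x - y)" by (rule mult_left_mono[OF \<pi>lip L1])
        finally show "norm (dyn f0 f (\<pi> x) (U p r) - dyn f0 f (\<pi> y) (U p r)) \<le> L1 * norm (x - y)" .
      qed (use T L1 in auto)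
      then show ?thesis by blast
    qed
    then obtain X where X: "\<And>p. p \<in> K \<Longrightarrow> continuous_on {0..T} (X p)"
      "\<And>p t. p \<in> K \<Longrightarrow> t \<in> {0..T} \<Longrightarrow> X p t = x0 + integral {0..t} (\<lambda>r. dyn f0 f (\<pi> (X p r)) (U p r))" by metis
    have Xi: "(\<lambda>r. dyn f0 f (\<pi> (X p r)) (U p r)) integrable_on {0..T}" if p: "p \<in> K" for p
      using dyn_abs_int[OF continuous_on_compose2[OF \<pi>c X(1)[OF p] subset_UNIV] Ui[OF p]] by (simp add: absolutely_integrable_on_def)
    have est: "norm (X p t - (xh t + \<epsilon> *\<^sub>R z t + \<epsilon>\<^sup>2 *\<^sub>R (s t + y p t))) \<le> min \<delta> (1/2) * \<epsilon>\<^sup>2 \<and> norm (X p t) \<le> R"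
      if p: "p \<in> K" and t: "t \<in> {0..T}" for p t
    proof -
      define Y where "Y t = xh t + \<epsilon> *\<^sub>R z t + \<epsilon>\<^sup>2 *\<^sub>R (s t + y p t)" for t
      define E where "E r = dyn f0 f (xh r) (u r) + \<epsilon> *\<^sub>R (DA (xh r) (u r) (z r) + Bm (xh r) (v r))
        + \<epsilon>\<^sup>2 *\<^sub>R (DA (xh r) (u r) (s r + y p r) + Qm (xh r) (u r) (z r) (v r) + Bm (xh r) (w p r))" for r
      note E = expansion_integral_equation[where \<epsilon>=\<epsilon>, OF z s y[OF p], folded E_def Y_def]
      have sy: "norm (s r + y p r) \<le> M'" if "r \<in> {0..T}" for r
        using norm_triangle_mono[OF Ms[OF that] My[OF p that]] M'(5) by linarith
      have YR: "norm (Y r) \<le> R0 + 1/2" if r: "r \<in> {0..T}" for r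
      proof -
        have "norm (\<epsilon> *\<^sub>R z r) \<le> \<epsilon> * M'" unfolding norm_scaleR using \<epsilon> Mz[OF r] M'(4) by (intro mult_mono) auto
        moreover have "norm (\<epsilon>\<^sup>2 *\<^sub>R (s r + y p r)) \<le> \<epsilon> * M'" unfolding norm_scaleR using \<epsilon> \<epsilon>2 sy[OF r] by (intro mult_mono) auto
        ultimately have "norm (Y r) \<le> R0 + \<epsilon> * M' + \<epsilon> * M'" unfolding Y_def using R0[OF r] by (intro norm_triangle_mono)
        then show ?thesis using \<epsilon>M by (simp add: algebra_simps)
      qed
      have "norm (X p t - Y t) \<le> 2 * ((\<delta>' * \<epsilon>\<^sup>2) * T) * exp (2 * L1 * T)"
      proof (rule gronwall_difference[where D="\<lambda>t. X p t - Y t" and h="\<lambda>r. dyn f0 f (\<pi> (X p r)) (U p r) - E r", OF _ L1 _ _ _ _ _ t])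
        show "continuous_on {0..T} (\<lambda>t. X p t - Y t)" by (intro continuous_intros X(1)[OF p] E(2))
        show "(\<lambda>r. dyn f0 f (\<pi> (X p r)) (U p r) - E r) integrable_on {0..T}"
          by (intro Henstock_Kurzweil_Integration.integrable_diff Xi[OF p] E(1))
        fix r assume r: "r \<in> {0..T}"
        have "integral {0..r} (\<lambda>r. dyn f0 f (\<pi> (X p r)) (U p r) - E r) = integral {0..r} (\<lambda>r. dyn f0 f (\<pi> (X p r)) (U p r)) - integral {0..r} E"
          by (rule Henstock_Kurzweil_Integration.integral_diff; rule integrable_on_subinterval[OF Xi[OF p]] integrable_on_subinterval[OF E(1)]) (use r in auto)
        then show "X p r - Y r = integral {0..r} (\<lambda>r. dyn f0 f (\<pi> (X p r)) (U p r) - E r)"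
          by (simp only: X(2)[OF p r] E(3)[OF r] add_diff_cancel_left)
        have "norm (dyn f0 f (\<pi> (X p r)) (U p r) - dyn f0 f (\<pi> (Y r)) (U p r)) \<le> L1 * norm (\<pi> (X p r) - \<pi> (Y r))"
          unfolding L1_def by (rule Kd(2)[OF \<pi>R \<pi>R Ub[OF p r]])
        also have "\<dots> \<le> L1 * norm (X p r - Y r)" by (rule mult_left_mono[OF \<pi>lip L1])
        finally have 1: "norm (dyn f0 f (\<pi> (X p r)) (U p r) - dyn f0 f (\<pi> (Y r)) (U p r)) \<le> L1 * norm (X p r - Y r)" .
        have "\<pi> (Y r) = Y r" using YR[OF r] by (intro \<pi>id) (simp add: R_def)
        moreover have "norm (dyn f0 f (Y r) (U p r) - dyn f0 f (xh r) (u r) - \<epsilon> *\<^sub>R (DA (xh r) (u r) (z r) + Bm (xh r) (v r))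
            - \<epsilon>\<^sup>2 *\<^sub>R (DA (xh r) (u r) (s r + y p r) + Qm (xh r) (u r) (z r) (v r) + Bm (xh r) (w p r))) \<le> \<delta>' * \<epsilon>\<^sup>2"
          unfolding Y_def U_def using \<epsilon>(1) \<epsilon>1(2) R0[OF r] Mz[OF r] sy[OF r] u_bound[OF r] v(2)[OF r] w(2)[OF p r] M'
          by (intro e1(2)) linarith+
        ultimately have 2: "norm (dyn f0 f (\<pi> (Y r)) (U p r) - E r) \<le> \<delta>' * \<epsilon>\<^sup>2" by (simp add: E_def diff_diff_eq add.assoc)
        show "norm (dyn f0 f (\<pi> (X p r)) (U p r) - E r) \<le> L1 * norm (X p r - Y r) + \<delta>' * \<epsilon>\<^sup>2"
          using norm_triangle_mono[OF 1 2] by simp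
      qed (use T \<delta>' in auto)
      also have "\<dots> = (\<delta>' * q) * \<epsilon>\<^sup>2" by (simp add: q_def)
      also have "\<delta>' * q = min \<delta> (1/2)" using q by (simp add: \<delta>'_def)
      finally have 1: "norm (X p t - Y t) \<le> min \<delta> (1/2) * \<epsilon>\<^sup>2" .
      also have "\<dots> \<le> (1/2) * 1" using \<epsilon>2 \<delta> by (intro mult_mono) auto
      finally have "norm (Y t + (X p t - Y t)) \<le> (R0 + 1/2) + (1/2) * 1" using YR[OF t] by (intro norm_triangle_mono)
      then show ?thesis using 1 by (simp add: R_def Y_def)
    qed
    \<comment> \<open>\<open>est\<close> confines X p to the ball, where the projection is the
      identity, so X p solves the original equation.\<close>
    have Xeq: "X p t = x0 + integral {0..t} (\<lambda>r. dyn f0 f (X p r) (U p r))" if p: "p \<in> K" and t: "t \<in> {0..T}" for p t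
    proof -
      have "integral {0..t} (\<lambda>r. dyn f0 f (\<pi> (X p r)) (U p r)) = integral {0..t} (\<lambda>r. dyn f0 f (X p r) (U p r))"
        by (rule integral_cong) (use est[OF p] t \<pi>id in auto)
      then show ?thesis using X(2)[OF p t] by (rule subst)
    qed
    have Xi': "(\<lambda>r. dyn f0 f (X p r) (U p r)) integrable_on {0..T}" if p: "p \<in> K" for p
      using dyn_abs_int[OF X(1)[OF p] Ui[OF p]] by (simp add: absolutely_integrable_on_def)
    have sub_eq: "P - Q = J" if "J = a - b" "P = x0 + a" "Q = x0 + b" for P Q J a b :: "real^'n"
      using that by simp
    have "continuous_on K (\<lambda>p. X p T)"
      unfolding continuous_on_iff
    proof (intro ballI allI impI)
      fix p and e :: real assume p: "p \<in> K" and e: "0 < e"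
      define e' where "e' = e / (q * Kd + 1)"
      have qK: "0 < q * Kd + 1" using q Kd(1) by (intro add_nonneg_pos) auto
      have e': "0 < e'" using e qK by (simp add: e'_def)
      obtain d where d: "d > 0" "\<And>p'. p' \<in> K \<Longrightarrow> dist p' p < d \<Longrightarrow> (\<forall>t\<in>{0..T}. norm (w p' t - w p t) \<le> e')"
        using wcont[OF p e'] by blast
      show "\<exists>d>0. \<forall>p'\<in>K. dist p' p < d \<longrightarrow> dist (X p' T) (X p T) < e"
      proof (intro exI[of _ d] conjI ballI impI d(1))
        fix p' assume p': "p' \<in> K" "dist p' p < d"
        have "norm (X p' T - X p T) \<le> 2 * ((Kd * e') * T) * exp (2 * L1 * T)"
        proof (rule gronwall_difference[where D="\<lambda>t. X p' t - X p t" and h="\<lambda>r. dyn f0 f (X p' r) (U p' r) - dyn f0 f (X p r) (U p r)", OF _ L1])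
          show "continuous_on {0..T} (\<lambda>t. X p' t - X p t)" by (intro continuous_intros X(1) p p')
          show "(\<lambda>r. dyn f0 f (X p' r) (U p' r) - dyn f0 f (X p r) (U p r)) integrable_on {0..T}"
            by (intro Henstock_Kurzweil_Integration.integrable_diff Xi' p p')
          fix r assume r: "r \<in> {0..T}"
          have "integral {0..r} (\<lambda>r. dyn f0 f (X p' r) (U p' r) - dyn f0 f (X p r) (U p r)) = integral {0..r} (\<lambda>r. dyn f0 f (X p' r) (U p' r)) - integral {0..r} (\<lambda>r. dyn f0 f (X p r) (U p r))"
            by (rule Henstock_Kurzweil_Integration.integral_diff; rule integrable_on_subinterval[OF Xi'[OF p]] integrable_on_subinterval[OF Xi'[OF p'(1)]]) (use r in auto)
          then show "X p' r - X p r = integral {0..r} (\<lambda>r. dyn f0 f (X p' r) (U p' r) - dyn f0 f (X p r) (U p r))"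
            by (rule sub_eq[OF _ Xeq[OF p'(1) r] Xeq[OF p r]])
          \<comment> \<open>The difference of the right-hand sides is split into a change of state
            under the same control and a change of control at the same state.\<close>
          have 1: "norm (dyn f0 f (X p' r) (U p' r) - dyn f0 f (X p r) (U p' r)) \<le> L1 * norm (X p' r - X p r)"
            unfolding L1_def using est[OF p r] est[OF p'(1) r] by (intro Kd(2) Ub p' r) auto
          have "norm (dyn f0 f (X p r) (U p' r) - dyn f0 f (X p r) (U p r)) \<le> Kd * norm (U p' r - U p r)"
            using est[OF p r] by (intro Kd(3)) auto
          also have "U p' r - U p r = \<epsilon>\<^sup>2 *\<^sub>R (w p' r - w p r)" by (simp add: U_def scaleR_diff_right)
          also have "Kd * norm (\<epsilon>\<^sup>2 *\<^sub>R (w p' r - w p r)) \<le> Kd * (1 * e')"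
            unfolding norm_scaleR using \<epsilon>2 d(2)[OF p'] r Kd(1) by (intro mult_left_mono mult_mono) auto
          finally have 2: "norm (dyn f0 f (X p r) (U p' r) - dyn f0 f (X p r) (U p r)) \<le> Kd * e'" by simp
          show "norm (dyn f0 f (X p' r) (U p' r) - dyn f0 f (X p r) (U p r)) \<le> L1 * norm (X p' r - X p r) + Kd * e'"
            using norm_triangle_mono[OF 1 2] by simp
        qed (use T Kd(1) e' in auto)
        also have "\<dots> = (q * Kd) * e'" by (simp add: q_def)
        also have "\<dots> < e" using e qK by (simp add: e'_def field_simps)
        finally show "dist (X p' T) (X p T) < e" by (simp add: dist_norm)
      qed
    qed
    moreover have "norm (X p t - (xh t + \<epsilon> *\<^sub>R z t + \<epsilon>\<^sup>2 *\<^sub>R (s t + y p t))) \<le> \<delta> * \<epsilon>\<^sup>2" if "p \<in> K" "t \<in> {0..T}" for p t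
    proof -
      have "min \<delta> (1/2) * \<epsilon>\<^sup>2 \<le> \<delta> * \<epsilon>\<^sup>2" using \<epsilon>2 by (intro mult_right_mono) auto
      then show ?thesis using est[OF that] by linarith
    qed
    ultimately show "\<exists>X. continuous_on K (\<lambda>p. X p T) \<and>
     (\<forall>p\<in>K. continuous_on {0..T} (X p) \<and> (\<forall>t\<in>{0..T}.
        X p t = x0 + integral {0..t} (\<lambda>r. dyn f0 f (X p r) (u r + \<epsilon> *\<^sub>R v r + \<epsilon>\<^sup>2 *\<^sub>R w p r)) \<and>
        norm (X p t - (xh t + \<epsilon> *\<^sub>R z t + \<epsilon>\<^sup>2 *\<^sub>R (s t + y p t))) \<le> \<delta> * \<epsilon>\<^sup>2))"
      using X(1) Xeq unfolding U_def by (intro exI[of _ X]) blast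
  qed
qed

end

section \<open>L1 stability of the second-order endpoint, admissible perturbations, and the minimum
  condition\<close>

section \<open>Controls and switching functions\<close>

lemma integral_equation_imp_AE_derivative:
  fixes y g :: "real \<Rightarrow> 'a::euclidean_space"
  assumes g: "g integrable_on {0..T}" and y: "\<And>t. t \<in> {0..T} \<Longrightarrow> y t = c + integral {0..t} g"
  shows "AE t in lebesgue_on {0..T}. (y has_vector_derivative g t) (at t within {0..T})"
proof -
  obtain N where N: "negligible N" "\<And>t. t \<in> {0..T} - N \<Longrightarrow> ((\<lambda>t. integral {0..t} g) has_vector_derivative g t) (at t within {0..T})"
    using indefinite_integral_has_vector_derivative_ae[OF g] by blast
  have "(y has_vector_derivative g t) (at t within {0..T})" if t: "t \<in> {0..T} - N" for t
  proof (rule has_vector_derivative_transform)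
    show "((\<lambda>t. c + integral {0..t} g) has_vector_derivative g t) (at t within {0..T})"
      using has_vector_derivative_add[OF has_vector_derivative_const[of c] N(2)[OF t]] by simp
  qed (use t y in auto)
  then show ?thesis using N(1) by (subst AE_lebesgue_on_iff_negligible) auto
qed

text \<open>Membership in a Sobolev space provides only some density w. Both w and g are derivatives
  of y almost everywhere, and 0 < T makes derivatives within the interval unique; replacing w by g
  then gives the integral form of the differential equation.\<close>

lemma AE_derivative_imp_integral_equation:
  fixes y g w :: "real \<Rightarrow> 'a::euclidean_space"
  assumes T: "0 < T" and w: "w integrable_on {0..T}" and y: "\<And>t. t \<in> {0..T} \<Longrightarrow> y t = y 0 + integral {0..t} w"
    and d: "AE t in lebesgue_on {0..T}. (y has_vector_derivative g t) (at t within {0..T})"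
  obtains N where "negligible N" "\<And>t. t \<in> {0..T} - N \<Longrightarrow> w t = g t"
proof -
  have "AE t in lebesgue_on {0..T}. (y has_vector_derivative w t) (at t within {0..T})"
    by (rule integral_equation_imp_AE_derivative[OF w y])
  with d have "AE t in lebesgue_on {0..T}. (y has_vector_derivative w t) (at t within {0..T}) \<and> (y has_vector_derivative g t) (at t within {0..T})"
    by (elim AE_mp) (auto intro!: AE_I2)
  then obtain N where N: "negligible N" "\<forall>t\<in>{0..T} - N. (y has_vector_derivative w t) (at t within {0..T}) \<and> (y has_vector_derivative g t) (at t within {0..T})"
    by (subst (asm) AE_lebesgue_on_iff_negligible) auto
  have "w t = g t" if "t \<in> {0..T} - N" for t
    using N(2) that T vector_derivative_unique_within_closed_interval[of 0 T t y "w t" "g t"] by auto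
  with N(1) that show thesis by blast
qed

lemma integral_nonneg_eq_0_imp_AE:
  fixes h :: "real \<Rightarrow> real"
  assumes h: "h absolutely_integrable_on {0..T}" and nonneg: "\<And>t. t \<in> {0..T} \<Longrightarrow> 0 \<le> h t" and 0: "integral {0..T} h \<le> 0"
  shows "AE t in lebesgue_on {0..T}. h t = 0"
proof -
  have i: "integrable (lebesgue_on {0..T}) h" using h by (simp add: set_integrable_def integrable_restrict_space)
  have "integral {0..T} h \<ge> 0" by (intro Henstock_Kurzweil_Integration.integral_nonneg) (use h nonneg in \<open>auto simp: absolutely_integrable_on_def\<close>)
  with 0 have "integral\<^sup>L (lebesgue_on {0..T}) h = 0" using lebesgue_integral_eq_integral[OF i] by simp
  then show ?thesis using i nonneg by (subst (asm) integral_nonneg_eq_0_iff_AE) (auto intro!: AE_I2)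
qed

lemma borel_measurable_vecI:
  fixes v :: "'a \<Rightarrow> real^'m"
  assumes "\<And>i. (\<lambda>t. v t $ i) \<in> borel_measurable M" shows "v \<in> borel_measurable M"
  unfolding borel_measurable_euclidean_space[of v] using assms by (auto simp: Basis_vec_def inner_axis)

lemma borel_measurable_vec_nth:
  fixes v :: "'a \<Rightarrow> real^'m"
  assumes "v \<in> borel_measurable M" shows "(\<lambda>t. v t $ i) \<in> borel_measurable M"
proof -
  have "(\<lambda>t. v t \<bullet> axis i 1) \<in> borel_measurable M" using assms by measurable
  then show ?thesis by (simp add: inner_axis)
qed

context control_system
begin

text \<open>\<open>Qm\<close> is a quadratic form in z plus a bilinear term in b and z, with no term
  quadratic in b. Hence |b' - b| enters only multiplied by |z'|, which stays bounded.\<close>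

lemma Qm_difference:
  obtains K where "0 \<le> K" "\<And>t z z' b b'. t \<in> {0..T} \<Longrightarrow> norm (Qm (xh t) (u t) z' b' - Qm (xh t) (u t) z b)
     \<le> K * (norm (z' - z) * (norm z' + norm z) + norm (b' - b) * norm z' + norm b * norm (z' - z))"
proof -
  obtain R where R: "\<And>t. t \<in> {0..T} \<Longrightarrow> norm (xh t) \<le> R" using xh_bounded by blast
  obtain K0 where K0: "0 \<le> K0" "\<And>x. x \<in> cball 0 R \<Longrightarrow> norm (f0'' x) \<le> K0" using bounded_on_cball[OF f0(3)] by blast
  have "\<exists>K\<ge>0. \<forall>x. x \<in> cball 0 R \<longrightarrow> norm (f'' i x) \<le> K" for i using bounded_on_cball[OF f(3)] by metis
  then obtain Ki where Ki: "\<And>i. 0 \<le> Ki i" "\<And>i x. x \<in> cball 0 R \<Longrightarrow> norm (f'' i x) \<le> Ki i" by metis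
  have "\<exists>K\<ge>0. \<forall>x. x \<in> cball 0 R \<longrightarrow> norm (f' i x) \<le> K" for i using bounded_on_cball[OF cont(4)] by metis
  then obtain Bi where Bi: "\<And>i. 0 \<le> Bi i" "\<And>i x. x \<in> cball 0 R \<Longrightarrow> norm (f' i x) \<le> Bi i" by metis
  define K where "K = K0 + (\<Sum>i\<in>UNIV. Mu * Ki i) + (\<Sum>i\<in>UNIV. Bi i)"
  have s: "0 \<le> (\<Sum>i\<in>UNIV. Mu * Ki i)" "0 \<le> (\<Sum>i\<in>UNIV. Bi i)" by (intro sum_nonneg mult_nonneg_nonneg Mu Ki Bi)+
  show thesis
  proof (rule that[of K])
    show K: "0 \<le> K" using K0 s by (simp add: K_def)
    fix t and z z' :: "real^'n" and b b' :: "real^'m" assume t: "t \<in> {0..T}"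
    then have x: "xh t \<in> cball 0 R" using R by simp
    define S where "S p q = (1/2) *\<^sub>R (f0'' (xh t) p q + (\<Sum>i\<in>UNIV. u t $ i *\<^sub>R f'' i (xh t) p q))" for p q
    define C where "C b q = (\<Sum>i\<in>UNIV. b $ i *\<^sub>R f' i (xh t) q)" for b :: "real^'m" and q
    have S: "norm (S p q) \<le> K * (norm p * norm q)" for p q
    proof -
      have bil: "norm (blinfun_apply (blinfun_apply G p) q) \<le> k * (norm p * norm q)" if "norm G \<le> k" for G :: "(real^'n) \<Rightarrow>\<^sub>L (real^'n) \<Rightarrow>\<^sub>L (real^'n)" and k
      proof -
        have "norm (blinfun_apply (blinfun_apply G p) q) \<le> norm (blinfun_apply G p) * norm q" by (rule norm_blinfun)
        also have "\<dots> \<le> (norm G * norm p) * norm q" by (intro mult_right_mono norm_blinfun) auto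
        also have "\<dots> \<le> (k * norm p) * norm q" using that by (intro mult_right_mono) auto
        finally show ?thesis by (simp add: mult.assoc)
      qed
      have "norm (f0'' (xh t) p q + (\<Sum>i\<in>UNIV. u t $ i *\<^sub>R f'' i (xh t) p q)) \<le> K0 * (norm p * norm q) + (\<Sum>i\<in>UNIV. Mu * (Ki i * (norm p * norm q)))"
      proof (intro norm_triangle_mono sum_norm_le)
        show "norm (f0'' (xh t) p q) \<le> K0 * (norm p * norm q)" by (rule bil[OF K0(2)[OF x]])
        show "norm (u t $ i *\<^sub>R f'' i (xh t) p q) \<le> Mu * (Ki i * (norm p * norm q))" for i
          unfolding norm_scaleR using u_bound[OF t] component_le_norm_cart[of "u t" i] Mu bil[OF Ki(2)[OF x, of i]]
          by (intro mult_mono) auto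
      qed
      also have "\<dots> = (K0 + (\<Sum>i\<in>UNIV. Mu * Ki i)) * (norm p * norm q)" by (simp add: sum_distrib_right distrib_right mult.assoc)
      also have "\<dots> \<le> K * (norm p * norm q)" using s by (intro mult_right_mono) (auto simp: K_def)
      finally have "norm (S p q) \<le> 1/2 * (K * (norm p * norm q))" by (simp add: S_def)
      also have "\<dots> \<le> 1 * (K * (norm p * norm q))" using K by (intro mult_right_mono) auto
      finally show ?thesis by simp
    qed
    have C: "norm (C b q) \<le> K * (norm b * norm q)" for b q
    proof -
      have "norm (C b q) \<le> (\<Sum>i\<in>UNIV. norm b * (Bi i * norm q))"
        unfolding C_def
      proof (rule sum_norm_le)
        fix i
        have "norm (f' i (xh t) q) \<le> Bi i * norm q"
          using norm_blinfun[of "f' i (xh t)" q] Bi(2)[OF x] by (meson mult_right_mono norm_ge_zero order_trans)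
        then show "norm (b $ i *\<^sub>R f' i (xh t) q) \<le> norm b * (Bi i * norm q)"
          unfolding norm_scaleR using component_le_norm_cart[of b i] by (intro mult_mono) auto
      qed
      also have "\<dots> = (\<Sum>i\<in>UNIV. Bi i) * (norm b * norm q)" unfolding sum_distrib_right by (intro sum.cong) auto
      also have "\<dots> \<le> K * (norm b * norm q)" using K0 s by (intro mult_right_mono) (auto simp: K_def)
      finally show ?thesis .
    qed
    have Sl: "S (p - p') q = S p q - S p' q" "S q (p - p') = S q p - S q p'" for p p' q
      by (simp_all add: S_def blinfun.diff_left blinfun.diff_right scaleR_diff_right sum_subtractf algebra_simps)
    have Cl: "C (b - b') q = C b q - C b' q" "C b (q - q') = C b q - C b q'" for b b' q q'
      by (simp_all add: C_def blinfun.diff_right algebra_simps sum_subtractf)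
    \<comment> \<open>The identity S(z', z') - S(z, z) = S(z' - z, z') + S(z, z' - z), and the
      analogous one for C.\<close>
    have "Qm (xh t) (u t) z' b' - Qm (xh t) (u t) z b = (S (z' - z) z' + S z (z' - z)) + (C (b' - b) z' + C b (z' - z))"
      unfolding Sl Cl by (simp add: Qm_def S_def[symmetric] C_def[symmetric])
    also have "norm \<dots> \<le> (K * (norm (z' - z) * norm z') + K * (norm z * norm (z' - z))) + (K * (norm (b' - b) * norm z') + K * (norm b * norm (z' - z)))"
      by (intro norm_triangle_mono S C)
    also have "\<dots> = K * (norm (z' - z) * (norm z' + norm z) + norm (b' - b) * norm z' + norm b * norm (z' - z))"
      by (simp add: algebra_simps)
    finally show "norm (Qm (xh t) (u t) z' b' - Qm (xh t) (u t) z b) \<le> K * (norm (z' - z) * (norm z' + norm z) + norm (b' - b) * norm z' + norm b * norm (z' - z))" .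
  qed
qed

text \<open>If v' is within \<eta> of v in L1, then z' is uniformly within c \<eta> of z, and
  integrating the bound of \<open>Qm_difference\<close> leaves only the L1 norms of v' - v and v.
  This is what allows v to be replaced by a truncation.\<close>

lemma second_order_endpoint_continuous:
  assumes v: "v absolutely_integrable_on {0..T}" and z: "lin.sol (\<lambda>t. Bm (xh t) (v t)) z"
    and s: "lin.sol (\<lambda>t. Qm (xh t) (u t) (z t) (v t)) s" and \<sigma>: "0 < \<sigma>"
  obtains \<eta> where "0 < \<eta>" "\<And>v' z' s'. v' absolutely_integrable_on {0..T} \<Longrightarrow> lin.sol (\<lambda>t. Bm (xh t) (v' t)) z' \<Longrightarrow>
     lin.sol (\<lambda>t. Qm (xh t) (u t) (z' t) (v' t)) s' \<Longrightarrow> integral {0..T} (\<lambda>t. norm (v' t - v t)) \<le> \<eta> \<Longrightarrow> norm (s' T - s T) \<le> \<sigma>"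
proof -
  obtain K where K: "0 \<le> K" "\<And>t z z' b b'. t \<in> {0..T} \<Longrightarrow> norm (Qm (xh t) (u t) z' b' - Qm (xh t) (u t) z b)
     \<le> K * (norm (z' - z) * (norm z' + norm z) + norm (b' - b) * norm z' + norm b * norm (z' - z))" using Qm_difference by blast
  obtain Mz where Mz: "\<And>t. t \<in> {0..T} \<Longrightarrow> norm (z t) \<le> Mz" using sol_continuous_bounded[OF z] by blast
  have Mz0: "0 \<le> Mz" using order_trans[OF norm_ge_zero Mz[of 0]] T by simp
  define Iv where "Iv = integral {0..T} (\<lambda>t. norm (v t))"
  have vi: "(\<lambda>t. norm (v t)) integrable_on {0..T}" using v by (simp add: absolutely_integrable_on_def)
  have Iv: "0 \<le> Iv" unfolding Iv_def by (intro Henstock_Kurzweil_Integration.integral_nonneg vi) auto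
  define c where "c = 2 * L * exp (2 * L * T)"
  have c: "0 \<le> c" using L(1) by (simp add: c_def)
  define G where "G = 2 * exp (2 * L * T) * (K * (c * (2 * Mz + 1) * T + (Mz + 1) + c * Iv))"
  have G: "0 \<le> G" using K(1) c Mz0 Iv T by (simp add: G_def)
  \<comment> \<open>The first bound makes c \<eta> at most 1, hence |z'| at most Mz + 1; the second
    makes the collected error G \<eta> at most \<sigma>.\<close>
  define \<eta> where "\<eta> = min (1 / (c + 1)) (\<sigma> / (G + 1))"
  show thesis
  proof (rule that[of \<eta>])
    show \<eta>: "0 < \<eta>" using c G \<sigma> by (simp add: \<eta>_def)
    fix v' z' s' assume v': "v' absolutely_integrable_on {0..T}" and z': "lin.sol (\<lambda>t. Bm (xh t) (v' t)) z'"
      and s': "lin.sol (\<lambda>t. Qm (xh t) (u t) (z' t) (v' t)) s'" and le: "integral {0..T} (\<lambda>t. norm (v' t - v t)) \<le> \<eta>"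
    have di: "(\<lambda>t. norm (v' t - v t)) integrable_on {0..T}"
      using set_integral_diff(1)[OF v' v] by (simp add: absolutely_integrable_on_def)
    have D: "norm (z' t - z t) \<le> c * \<eta>" if t: "t \<in> {0..T}" for t
    proof -
      have sd: "lin.sol (\<lambda>t. Bm (xh t) (v' t) + (-1) *\<^sub>R Bm (xh t) (v t)) (\<lambda>t. z' t + (-1) *\<^sub>R z t)"
        by (intro lin.sol_add lin.sol_scaleR z z')
      have "norm (z' t + (-1) *\<^sub>R z t) \<le> 2 * integral {0..T} (\<lambda>t. norm (Bm (xh t) (v' t) + (-1) *\<^sub>R Bm (xh t) (v t))) * exp (2 * L * T)"
        by (rule lin.sol_bound[OF sd t])
      also have "integral {0..T} (\<lambda>t. norm (Bm (xh t) (v' t) + (-1) *\<^sub>R Bm (xh t) (v t))) \<le> integral {0..T} (\<lambda>t. L * norm (v' t - v t))"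
      proof (rule integral_le)
        show "(\<lambda>t. norm (Bm (xh t) (v' t) + (-1) *\<^sub>R Bm (xh t) (v t))) integrable_on {0..T}"
          using lin.solD(1)[OF sd] by (simp add: absolutely_integrable_on_def)
        show "(\<lambda>t. L * norm (v' t - v t)) integrable_on {0..T}" by (intro integrable_on_mult_right di)
        show "norm (Bm (xh t) (v' t) + (-1) *\<^sub>R Bm (xh t) (v t)) \<le> L * norm (v' t - v t)" if "t \<in> {0..T}" for t
        proof -
          have "Bm (xh t) (v' t) + (-1) *\<^sub>R Bm (xh t) (v t) = Bm (xh t) (v' t - v t)"
            by (simp add: Bm_def algebra_simps sum_subtractf)
          then show ?thesis using L(3)[OF that] by metis
        qed
      qed
      also have "integral {0..T} (\<lambda>t. L * norm (v' t - v t)) = L * integral {0..T} (\<lambda>t. norm (v' t - v t))" by simp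
      also have "2 * (L * integral {0..T} (\<lambda>t. norm (v' t - v t))) * exp (2 * L * T) \<le> 2 * (L * \<eta>) * exp (2 * L * T)"
        using L(1) le by (intro mult_right_mono mult_left_mono) auto
      finally show ?thesis by (simp add: c_def mult_ac)
    qed
    have "c * \<eta> \<le> c * (1 / (c + 1))" using c by (intro mult_left_mono) (auto simp: \<eta>_def)
    also have "\<dots> \<le> 1" using c by (simp add: field_simps)
    finally have c1: "c * \<eta> \<le> 1" .
    have z'b: "norm (z' t) \<le> Mz + 1" if t: "t \<in> {0..T}" for t
      using norm_triangle_mono[OF Mz[OF t] order_trans[OF D[OF t] c1]] by simp
    have sd: "lin.sol (\<lambda>t. Qm (xh t) (u t) (z' t) (v' t) + (-1) *\<^sub>R Qm (xh t) (u t) (z t) (v t)) (\<lambda>t. s' t + (-1) *\<^sub>R s t)"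
      by (intro lin.sol_add lin.sol_scaleR s s')
    have "norm (s' T + (-1) *\<^sub>R s T) \<le> 2 * integral {0..T} (\<lambda>t. norm (Qm (xh t) (u t) (z' t) (v' t) + (-1) *\<^sub>R Qm (xh t) (u t) (z t) (v t))) * exp (2 * L * T)"
      by (rule lin.sol_bound[OF sd]) (use T in auto)
    also have "integral {0..T} (\<lambda>t. norm (Qm (xh t) (u t) (z' t) (v' t) + (-1) *\<^sub>R Qm (xh t) (u t) (z t) (v t)))
      \<le> integral {0..T} (\<lambda>t. K * ((c * \<eta>) * (2 * Mz + 1)) + (K * (Mz + 1)) * norm (v' t - v t) + (K * (c * \<eta>)) * norm (v t))"
    proof (rule integral_le)
      show "(\<lambda>t. norm (Qm (xh t) (u t) (z' t) (v' t) + (-1) *\<^sub>R Qm (xh t) (u t) (z t) (v t))) integrable_on {0..T}"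
        using lin.solD(1)[OF sd] by (simp add: absolutely_integrable_on_def)
      show "(\<lambda>t. K * ((c * \<eta>) * (2 * Mz + 1)) + (K * (Mz + 1)) * norm (v' t - v t) + (K * (c * \<eta>)) * norm (v t)) integrable_on {0..T}"
        by (intro Henstock_Kurzweil_Integration.integrable_add integrable_on_mult_right di vi) auto
      fix t assume t: "t \<in> {0..T}"
      have "norm (Qm (xh t) (u t) (z' t) (v' t) + (-1) *\<^sub>R Qm (xh t) (u t) (z t) (v t))
         \<le> K * (norm (z' t - z t) * (norm (z' t) + norm (z t)) + norm (v' t - v t) * norm (z' t) + norm (v t) * norm (z' t - z t))"
        using K(2)[OF t] by simp
      also have "\<dots> \<le> K * ((c * \<eta>) * ((Mz + 1) + Mz) + norm (v' t - v t) * (Mz + 1) + norm (v t) * (c * \<eta>))"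
        using D[OF t] Mz[OF t] z'b[OF t] K(1) c \<eta> Mz0 by (intro mult_left_mono add_mono mult_mono) auto
      also have "\<dots> = K * ((c * \<eta>) * (2 * Mz + 1)) + (K * (Mz + 1)) * norm (v' t - v t) + (K * (c * \<eta>)) * norm (v t)"
        by (simp add: algebra_simps)
      finally show "norm (Qm (xh t) (u t) (z' t) (v' t) + (-1) *\<^sub>R Qm (xh t) (u t) (z t) (v t)) \<le> K * ((c * \<eta>) * (2 * Mz + 1)) + (K * (Mz + 1)) * norm (v' t - v t) + (K * (c * \<eta>)) * norm (v t)" .
    qed
    also have "\<dots> = K * ((c * \<eta>) * (2 * Mz + 1)) * T + (K * (Mz + 1)) * integral {0..T} (\<lambda>t. norm (v' t - v t)) + (K * (c * \<eta>)) * Iv"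
    proof -
      have "((\<lambda>t. K * ((c * \<eta>) * (2 * Mz + 1)) + (K * (Mz + 1)) * norm (v' t - v t) + (K * (c * \<eta>)) * norm (v t)) has_integral
         measure lborel {0..T} *\<^sub>R (K * ((c * \<eta>) * (2 * Mz + 1))) + (K * (Mz + 1)) * integral {0..T} (\<lambda>t. norm (v' t - v t)) + (K * (c * \<eta>)) * integral {0..T} (\<lambda>t. norm (v t))) {0..T}"
        using T by (intro has_integral_add has_integral_mult_right integrable_integral di vi has_integral_const_real)
      then show ?thesis using T by (simp add: integral_unique Iv_def mult.commute)
    qed
    also have "\<dots> \<le> K * ((c * \<eta>) * (2 * Mz + 1)) * T + (K * (Mz + 1)) * \<eta> + (K * (c * \<eta>)) * Iv"
      using mult_left_mono[OF le, of "K * (Mz + 1)"] K(1) Mz0 by simp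
    also have "2 * \<dots> * exp (2 * L * T) = G * \<eta>" by (simp add: G_def algebra_simps)
    also have "\<dots> \<le> G * (\<sigma> / (G + 1))" using G by (intro mult_left_mono) (auto simp: \<eta>_def)
    also have "\<dots> \<le> \<sigma>" using G \<sigma> by (simp add: field_simps)
    finally show "norm (s' T - s T) \<le> \<sigma>" by simp
  qed
qed

(* For v interior and w inward, u + eps*v + eps^2*w is nonnegative for all small eps > 0. *)
definition interior_controls :: "(real \<Rightarrow> real^'m) set" where
  "interior_controls = {v. v \<in> borel_measurable (lebesgue_on {0..T}) \<and> (\<exists>M. \<forall>t\<in>{0..T}. norm (v t) \<le> M) \<and>
     (\<exists>d>0. \<forall>t\<in>{0..T}. \<forall>i. u t $ i < d \<longrightarrow> v t $ i = 0)}"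

definition inward_controls :: "(real \<Rightarrow> real^'m) set" where
  "inward_controls = {w. w \<in> borel_measurable (lebesgue_on {0..T}) \<and> (\<exists>M. \<forall>t\<in>{0..T}. norm (w t) \<le> M) \<and>
     (\<exists>d>0. \<forall>t\<in>{0..T}. \<forall>i. u t $ i < d \<longrightarrow> 0 \<le> w t $ i)}"

lemma interior_controlsI:
  assumes "v \<in> borel_measurable (lebesgue_on {0..T})" "\<And>t. t \<in> {0..T} \<Longrightarrow> norm (v t) \<le> M" "0 < d"
    "\<And>t i. t \<in> {0..T} \<Longrightarrow> u t $ i < d \<Longrightarrow> v t $ i = 0"
  shows "v \<in> interior_controls"
  using assms unfolding interior_controls_def by blast

lemma inward_controlsI:
  assumes "v \<in> borel_measurable (lebesgue_on {0..T})" "\<And>t. t \<in> {0..T} \<Longrightarrow> norm (v t) \<le> M" "0 < d"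
    "\<And>t i. t \<in> {0..T} \<Longrightarrow> u t $ i < d \<Longrightarrow> 0 \<le> v t $ i"
  shows "v \<in> inward_controls"
  using assms unfolding inward_controls_def by blast

lemma interior_controls_add:
  assumes "v \<in> interior_controls" "w \<in> interior_controls" shows "(\<lambda>t. v t + w t) \<in> interior_controls"
proof -
  obtain M1 d1 where 1: "v \<in> borel_measurable (lebesgue_on {0..T})" "\<And>t. t\<in>{0..T} \<Longrightarrow> norm (v t) \<le> M1" "d1 > 0"
    "\<And>t i. t\<in>{0..T} \<Longrightarrow> u t $ i < d1 \<Longrightarrow> v t $ i = 0" using assms unfolding interior_controls_def by blast
  obtain M2 d2 where 2: "w \<in> borel_measurable (lebesgue_on {0..T})" "\<And>t. t\<in>{0..T} \<Longrightarrow> norm (w t) \<le> M2" "d2 > 0"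
    "\<And>t i. t\<in>{0..T} \<Longrightarrow> u t $ i < d2 \<Longrightarrow> w t $ i = 0" using assms unfolding interior_controls_def by blast
  show ?thesis
    by (rule interior_controlsI[where M="M1 + M2" and d="min d1 d2"]) (use 1 2 in \<open>auto intro: norm_triangle_mono\<close>)
qed

lemma interior_controls_scaleR:
  assumes "v \<in> interior_controls" shows "(\<lambda>t. c *\<^sub>R v t) \<in> interior_controls"
proof -
  obtain M1 d1 where 1: "v \<in> borel_measurable (lebesgue_on {0..T})" "\<And>t. t\<in>{0..T} \<Longrightarrow> norm (v t) \<le> M1" "d1 > 0"
    "\<And>t i. t\<in>{0..T} \<Longrightarrow> u t $ i < d1 \<Longrightarrow> v t $ i = 0" using assms unfolding interior_controls_def by blast
  show ?thesis
    by (rule interior_controlsI[where M="\<bar>c\<bar> * M1" and d=d1]) (use 1 in \<open>auto intro: mult_left_mono\<close>)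
qed

lemma inward_controls_add:
  assumes "v \<in> inward_controls" "w \<in> inward_controls" shows "(\<lambda>t. v t + w t) \<in> inward_controls"
proof -
  obtain M1 d1 where 1: "v \<in> borel_measurable (lebesgue_on {0..T})" "\<And>t. t\<in>{0..T} \<Longrightarrow> norm (v t) \<le> M1" "d1 > 0"
    "\<And>t i. t\<in>{0..T} \<Longrightarrow> u t $ i < d1 \<Longrightarrow> 0 \<le> v t $ i" using assms unfolding inward_controls_def by blast
  obtain M2 d2 where 2: "w \<in> borel_measurable (lebesgue_on {0..T})" "\<And>t. t\<in>{0..T} \<Longrightarrow> norm (w t) \<le> M2" "d2 > 0"
    "\<And>t i. t\<in>{0..T} \<Longrightarrow> u t $ i < d2 \<Longrightarrow> 0 \<le> w t $ i" using assms unfolding inward_controls_def by blast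
  show ?thesis
    by (rule inward_controlsI[where M="M1 + M2" and d="min d1 d2"]) (use 1 2 in \<open>auto intro: norm_triangle_mono\<close>)
qed

lemma inward_controls_scaleR:
  assumes "v \<in> inward_controls" "0 \<le> c" shows "(\<lambda>t. c *\<^sub>R v t) \<in> inward_controls"
proof -
  obtain M1 d1 where 1: "v \<in> borel_measurable (lebesgue_on {0..T})" "\<And>t. t\<in>{0..T} \<Longrightarrow> norm (v t) \<le> M1" "d1 > 0"
    "\<And>t i. t\<in>{0..T} \<Longrightarrow> u t $ i < d1 \<Longrightarrow> 0 \<le> v t $ i" using assms unfolding inward_controls_def by blast
  show ?thesis
    by (rule inward_controlsI[where M="\<bar>c\<bar> * M1" and d=d1]) (use 1 assms(2) in \<open>auto intro: mult_left_mono\<close>)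
qed

lemma zero_controls: "(\<lambda>_. 0) \<in> interior_controls" "(\<lambda>_. 0) \<in> inward_controls"
  by (rule interior_controlsI[where M=0 and d=1] inward_controlsI[where M=0 and d=1]; simp)+

lemma controls_abs_int:
  "v \<in> interior_controls \<Longrightarrow> v absolutely_integrable_on {0..T}"
  "v \<in> inward_controls \<Longrightarrow> v absolutely_integrable_on {0..T}"
  unfolding interior_controls_def inward_controls_def using absolutely_integrable_bounded_measurable by blast+

text \<open>Coordinate i is kept only where u_i is at least 1 / (k + 1) and |v| is at most k. Since
  v_i = 0 almost everywhere on the zeros of u_i, the truncations converge pointwise, and |v|
  dominates them.\<close>

lemma interior_controls_dense:
  assumes v: "v absolutely_integrable_on {0..T}" and N: "negligible N"
    and v0: "\<And>t i. t \<in> {0..T} - N \<Longrightarrow> u t $ i = 0 \<Longrightarrow> v t $ i = 0" and u0: "\<And>t i. t \<in> {0..T} \<Longrightarrow> 0 \<le> u t $ i" and e: "0 < e"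
  obtains w where "w \<in> interior_controls" "integral {0..T} (\<lambda>t. norm (w t - v t)) \<le> e"
proof -
  \<comment> \<open>Resetting v to 0 on N makes v_i vanish at every time where u_i does, so that the
    truncations converge at every time.\<close>
  define v' where "v' t = (if t \<in> N then 0 else v t)" for t
  have v': "v' absolutely_integrable_on {0..T}"
    by (rule absolutely_integrable_spike[OF v N]) (auto simp: v'_def)
  have v'm: "v' \<in> borel_measurable (lebesgue_on {0..T})"
    by (rule absolutely_integrable_imp_borel_measurable[OF v']) auto
  note [measurable] = v'm borel_measurable_vec_nth[OF v'm] borel_measurable_vec_nth[OF u_meas]
  define w where "w k t = (\<chi> i. if 1 / (real k + 1) \<le> u t $ i \<and> norm (v' t) \<le> real k then v' t $ i else 0)" for k t
  have wm: "w k \<in> borel_measurable (lebesgue_on {0..T})" for k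
    by (rule borel_measurable_vecI) (simp add: w_def)
  have wle: "norm (w k t) \<le> norm (v' t)" for k t
    by (rule norm_le_componentwise_cart) (simp add: w_def)
  have wk: "norm (w k t) \<le> real k" for k t
  proof (cases "norm (v' t) \<le> real k")
    case True then show ?thesis using wle order_trans by blast
  next
    case False
    then have "w k t = 0" by (simp add: w_def vec_eq_iff)
    then show ?thesis by simp
  qed
  have wV: "w k \<in> interior_controls" for k
    by (rule interior_controlsI[where M="real k" and d="1 / (real k + 1)", OF wm wk]) (auto simp: w_def)
  have wi: "(\<lambda>t. norm (w k t - v' t)) integrable_on {0..T}" for k
    using set_integral_diff(1)[OF controls_abs_int(1)[OF wV] v'] by (simp add: absolutely_integrable_on_def)
  have "(\<lambda>k. integral {0..T} (\<lambda>t. norm (w k t - v' t))) \<longlonglongrightarrow> integral {0..T} (\<lambda>t. 0)"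
  proof (rule dominated_convergence(2)[where h="\<lambda>t. 2 * norm (v' t)", OF wi])
    show "(\<lambda>t. 2 * norm (v' t)) integrable_on {0..T}" using v' by (intro integrable_on_mult_right) (simp add: absolutely_integrable_on_def)
    show "norm (norm (w k t - v' t)) \<le> 2 * norm (v' t)" for k t
      using norm_triangle_ineq4[of "w k t" "v' t"] wle[of k t] by simp
    fix t assume t: "t \<in> {0..T}"
    have "(\<lambda>k. w k t $ i) \<longlonglongrightarrow> v' t $ i" for i
    proof (cases "u t $ i = 0 \<or> t \<in> N")
      case True
      then have "v' t $ i = 0" using v0[of t i] t by (auto simp: v'_def)
      then show ?thesis by (simp add: w_def cong: if_cong)
    next
      case False
      then have pos: "0 < u t $ i" using u0[OF t, of i] by simp
      have "eventually (\<lambda>k. 1 / (real k + 1) < u t $ i) sequentially"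
        using order_tendstoD(2)[OF lim_1_over_n[where 'a=real, THEN LIMSEQ_Suc] pos] by (simp add: add.commute)
      moreover have "eventually (\<lambda>k. norm (v' t) \<le> real k) sequentially"
        using eventually_ge_at_top[of "nat \<lceil>norm (v' t)\<rceil>"] by eventually_elim linarith
      ultimately have "eventually (\<lambda>k. w k t $ i = v' t $ i) sequentially"
        by eventually_elim (simp add: w_def)
      then show ?thesis by (rule tendsto_eventually)
    qed
    then have "(\<lambda>k. w k t) \<longlonglongrightarrow> v' t" by (rule vec_tendstoI)
    then show "(\<lambda>k. norm (w k t - v' t)) \<longlonglongrightarrow> 0" by (simp add: LIM_zero tendsto_norm_zero)
  qed
  then have "eventually (\<lambda>k. integral {0..T} (\<lambda>t. norm (w k t - v' t)) < e) sequentially"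
    using e by (intro order_tendstoD(2)) auto
  then obtain k where k: "integral {0..T} (\<lambda>t. norm (w k t - v' t)) < e" by (auto simp: eventually_sequentially)
  have "integral {0..T} (\<lambda>t. norm (w k t - v' t)) = integral {0..T} (\<lambda>t. norm (w k t - v t))"
    by (rule integral_spike[OF N]) (auto simp: v'_def)
  then show thesis using k by (intro that[OF wV[of k]]) simp
qed

text \<open>Both conclusions come from testing with controls that move a single coordinate. Together
  they say that H, affine in the control, is minimised over the orthant at u for almost every
  time.\<close>

lemma switching_function_signs:
  assumes \<psi>: "continuous_on {0..T} \<psi>" and u0: "\<And>t i. t \<in> {0..T} \<Longrightarrow> 0 \<le> u t $ i"
    and ge: "\<And>w. w \<in> inward_controls \<Longrightarrow> 0 \<le> integral {0..T} (\<lambda>t. \<psi> t \<bullet> Bm (xh t) (w t))"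
  shows "\<And>t. t \<in> {0..T} \<Longrightarrow> 0 \<le> \<psi> t \<bullet> f i (xh t)"
    "AE t in lebesgue_on {0..T}. u t $ i * (\<psi> t \<bullet> f i (xh t)) = 0"
proof -
  define g where "g t = \<psi> t \<bullet> f i (xh t)" for t
  have gc: "continuous_on {0..T} g" unfolding g_def
    by (intro continuous_intros \<psi> continuous_on_compose2[OF cont(3) xh_cont]) auto
  have gm: "g \<in> borel_measurable (lebesgue_on {0..T})" by (intro continuous_imp_measurable_on_sets_lebesgue gc) auto
  note [measurable] = gm borel_measurable_vec_nth[OF u_meas]
  have "bounded (g ` {0..T})" by (intro compact_imp_bounded compact_continuous_image gc) auto
  then obtain M where M: "M > 0" "\<And>t. t \<in> {0..T} \<Longrightarrow> \<bar>g t\<bar> \<le> M" unfolding bounded_pos by auto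
  have Bax: "\<psi> t \<bullet> Bm (xh t) (axis i a) = g t * a" for t a
  proof -
    have "Bm (xh t) (axis i a) = (\<Sum>j\<in>UNIV. if j = i then a *\<^sub>R f i (xh t) else 0)"
      unfolding Bm_def by (rule sum.cong) (auto simp: axis_def)
    then show ?thesis by (simp add: g_def)
  qed
  have test: "0 \<le> integral {0..T} (\<lambda>t. g t * a t)"
    if am: "a \<in> borel_measurable (lebesgue_on {0..T})" and bd: "\<And>t. t \<in> {0..T} \<Longrightarrow> \<bar>a t\<bar> \<le> M'" and d: "0 < d"
      and pos: "\<And>t. t \<in> {0..T} \<Longrightarrow> u t $ i < d \<Longrightarrow> 0 \<le> a t" for a M' d
  proof -
    have "(\<lambda>t. axis i (a t)) \<in> inward_controls"
    proof (rule inward_controlsI[where M=M' and d=d])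
      show "(\<lambda>t. axis i (a t)) \<in> borel_measurable (lebesgue_on {0..T})"
        by (rule borel_measurable_vecI) (use am in \<open>simp add: axis_def\<close>)
      have "norm (axis i (a t)) = \<bar>a t\<bar>" for t
        by (simp add: norm_eq_sqrt_inner inner_axis axis_nth)
      then show "norm (axis i (a t)) \<le> M'" if "t \<in> {0..T}" for t using bd that by simp
      show "0 \<le> axis i (a t) $ j" if "t \<in> {0..T}" "u t $ j < d" for t j
        using pos that by (auto simp: axis_def)
    qed (rule d)
    from ge[OF this] show ?thesis by (simp add: Bax)
  qed
  \<comment> \<open>The negative part of g is itself an admissible direction, being nonnegative. Its
    square integrates to 0, and continuity of g extends the conclusion to every t.\<close>
  have "0 \<le> integral {0..T} (\<lambda>t. g t * max 0 (- g t))"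
    by (rule test[of _ M 1]) (use M in force)+
  also have "integral {0..T} (\<lambda>t. g t * max 0 (- g t)) = integral {0..T} (\<lambda>t. - (max 0 (- g t))\<^sup>2)"
    by (rule integral_cong) (auto simp: max_def power2_eq_square)
  finally have "integral {0..T} (\<lambda>t. (max 0 (- g t))\<^sup>2) \<le> 0" by simp
  moreover have "0 \<le> integral {0..T} (\<lambda>t. (max 0 (- g t))\<^sup>2)"
    by (intro Henstock_Kurzweil_Integration.integral_nonneg integrable_continuous_real continuous_intros gc) auto
  ultimately have "integral {0..T} (\<lambda>t. (max 0 (- g t))\<^sup>2) = 0" by simp
  then have "\<forall>t\<in>{0..T}. (max 0 (- g t))\<^sup>2 = 0"
    by (subst (asm) Equivalence_Lebesgue_Henstock_Integration.integral_eq_0_iff) (use T gc in \<open>auto intro!: continuous_intros\<close>)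
  then show g0: "0 \<le> \<psi> t \<bullet> f i (xh t)" if "t \<in> {0..T}" for t
    using that by (fastforce simp: g_def[symmetric] max_def split: if_splits)
  define h where "h t = u t $ i * (g t)\<^sup>2" for t
  have ub: "\<bar>u t $ i\<bar> \<le> Mu" if "t \<in> {0..T}" for t
    using u_bound[OF that] component_le_norm_cart[of "u t" i] by linarith
  have g2: "(g t)\<^sup>2 \<le> M\<^sup>2" if "t \<in> {0..T}" for t using M(2)[OF that] M(1) by (simp add: abs_le_square_iff[symmetric])
  have ha: "h absolutely_integrable_on {0..T}"
  proof (rule absolutely_integrable_bounded_measurable[where M="Mu * M\<^sup>2"])
    show "h \<in> borel_measurable (lebesgue_on {0..T})" unfolding h_def by measurable
    show "norm (h t) \<le> Mu * M\<^sup>2" if "t \<in> {0..T}" for t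
      unfolding h_def real_norm_def abs_mult using ub[OF that] g2[OF that] Mu by (intro mult_mono) auto
  qed
  have "integral {0..T} h \<le> 0"
  proof (rule field_le_epsilon)
    fix e :: real assume e: "0 < e"
    define d where "d = e / (M\<^sup>2 * T + 1)"
    have pT: "0 < M\<^sup>2 * T + 1" using T by (intro add_nonneg_pos) auto
    have d: "d > 0" using e pT by (simp add: d_def)
    \<comment> \<open>A nonpositive direction is admissible only where u_i is bounded away from 0.
      The shift by d makes a vanish where u_i < d; it costs at most d M^2 per unit of time, which is
      at most e in total.\<close>
    define a where "a t = - g t * max 0 (u t $ i - d)" for t
    have am: "a \<in> borel_measurable (lebesgue_on {0..T})" unfolding a_def by measurable
    have ab: "\<bar>a t\<bar> \<le> M * Mu" if "t \<in> {0..T}" for t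
      unfolding a_def abs_mult using ub[OF that] M(2)[OF that] M(1) d Mu by (intro mult_mono) auto
    have gai: "(\<lambda>t. g t * a t) absolutely_integrable_on {0..T}"
    proof (rule absolutely_integrable_bounded_measurable[where M="M * (M * Mu)"])
      show "(\<lambda>t. g t * a t) \<in> borel_measurable (lebesgue_on {0..T})" using am by measurable
      show "norm (g t * a t) \<le> M * (M * Mu)" if "t \<in> {0..T}" for t
        unfolding real_norm_def abs_mult using ab[OF that] M(2)[OF that] M(1) by (intro mult_mono) auto
    qed
    have "0 \<le> integral {0..T} (\<lambda>t. g t * a t)"
      by (rule test[OF am ab d]) (auto simp: a_def)
    moreover have "integral {0..T} h + integral {0..T} (\<lambda>t. g t * a t) = integral {0..T} (\<lambda>t. h t + g t * a t)"
      by (rule Henstock_Kurzweil_Integration.integral_add[symmetric]) (use ha gai in \<open>auto simp: absolutely_integrable_on_def\<close>)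
    moreover have "integral {0..T} (\<lambda>t. h t + g t * a t) \<le> integral {0..T} (\<lambda>t. d * M\<^sup>2)"
    proof (rule integral_le)
      show "(\<lambda>t. h t + g t * a t) integrable_on {0..T}"
        using ha gai by (intro Henstock_Kurzweil_Integration.integrable_add) (auto simp: absolutely_integrable_on_def)
      fix t assume t: "t \<in> {0..T}"
      have "h t + g t * a t = (u t $ i - max 0 (u t $ i - d)) * (g t)\<^sup>2"
        by (simp add: h_def a_def algebra_simps power2_eq_square)
      also have "\<dots> \<le> d * M\<^sup>2" using g2[OF t] d u0[OF t, of i] by (intro mult_mono) auto
      finally show "h t + g t * a t \<le> d * M\<^sup>2" .
    qed auto
    moreover have "integral {0..T} (\<lambda>t. d * M\<^sup>2) \<le> e"
    proof -
      have "integral {0..T} (\<lambda>t. d * M\<^sup>2) = (M\<^sup>2 * T) * d" using T by simp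
      also have "\<dots> \<le> (M\<^sup>2 * T + 1) * d" using d by (intro mult_right_mono) auto
      also have "\<dots> = e" using pT by (simp add: d_def)
      finally show ?thesis .
    qed
    ultimately show "integral {0..T} h \<le> 0 + e" by linarith
  qed
  then have "AE t in lebesgue_on {0..T}. h t = 0"
    by (rule integral_nonneg_eq_0_imp_AE[OF ha, rotated]) (simp add: h_def u0)
  then show "AE t in lebesgue_on {0..T}. u t $ i * (\<psi> t \<bullet> f i (xh t)) = 0"
    by (rule AE_mp) (auto intro!: AE_I2 simp: h_def g_def)
qed

end

section \<open>From an interior point of the second-order increments to a better feasible
  trajectory\<close>

section \<open>Feasible improvement\<close>

lemma finite_uniform_threshold:
  assumes "finite I" "\<And>i. i \<in> I \<Longrightarrow> \<exists>e>0. \<forall>\<epsilon>. 0 < \<epsilon> \<and> \<epsilon> \<le> e \<longrightarrow> P i \<epsilon>"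
  shows "\<exists>e>(0::real). \<forall>i\<in>I. \<forall>\<epsilon>. 0 < \<epsilon> \<and> \<epsilon> \<le> e \<longrightarrow> P i \<epsilon>"
  using assms
proof (induction I rule: finite_induct)
  case empty
  then show ?case by (auto intro!: exI[of _ 1])
next
  case (insert i I)
  obtain e1 where "e1 > 0" "\<forall>j\<in>I. \<forall>\<epsilon>. 0 < \<epsilon> \<and> \<epsilon> \<le> e1 \<longrightarrow> P j \<epsilon>" using insert.IH insert.prems by blast
  moreover obtain e2 where "e2 > 0" "\<forall>\<epsilon>. 0 < \<epsilon> \<and> \<epsilon> \<le> e2 \<longrightarrow> P i \<epsilon>" using insert.prems by blast
  ultimately show ?case by (intro exI[of _ "min e1 e2"]) auto
qed

text \<open>The constraint functions are twice differentiable with no continuity of the second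
  derivative assumed. At a single point q, differentiability of g' is already the near linearity
  that the expansion asks for.\<close>

lemma second_order_expansion_at_point:
  fixes g :: "'a::real_normed_vector \<Rightarrow> 'b::real_normed_vector"
  assumes g: "\<And>x. (g has_derivative blinfun_apply (g' x)) (at x)" "\<And>x. (g' has_derivative blinfun_apply (g'' x)) (at x)"
    and \<sigma>: "0 < \<sigma>" and M: "0 \<le> M"
  shows "\<exists>e>0. \<forall>\<epsilon>. 0 < \<epsilon> \<and> \<epsilon> \<le> e \<longrightarrow> (\<forall>z \<zeta>. norm z \<le> M \<longrightarrow> norm \<zeta> \<le> M \<longrightarrow>
     norm (g (q + \<epsilon> *\<^sub>R z + \<epsilon>\<^sup>2 *\<^sub>R \<zeta>) - g q - \<epsilon> *\<^sub>R g' q z - \<epsilon>\<^sup>2 *\<^sub>R (g' q \<zeta> + (1/2) *\<^sub>R g'' q z z)) \<le> \<sigma> * \<epsilon>\<^sup>2)"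
proof -
  have unif: "\<exists>r>0. \<forall>x\<in>{q}. \<forall>y. norm y \<le> r \<longrightarrow> norm (g' (x + y) - g' x - blinfun_apply (g'' x) y) \<le> d * norm y" if d: "0 < d" for d
  proof -
    obtain r where r: "r > 0" "\<forall>y. norm (y - q) < r \<longrightarrow> norm (g' y - g' q - blinfun_apply (g'' q) (y - q)) \<le> d * norm (y - q)"
      using g(2)[of q] d unfolding has_derivative_at_alt by blast
    then have "norm (g' (q + y) - g' q - blinfun_apply (g'' q) y) \<le> d * norm y" if "norm y \<le> r / 2" for y
      using r(2)[rule_format, of "q + y"] r(1) that by simp
    then show ?thesis using r(1) by (intro exI[of _ "r / 2"]) auto
  qed
  show ?thesis
  proof (rule second_order_expansion[where X="{q}" and f=g and f'=g' and f''=g'' and K="norm (g'' q)", OF g(1) unif _ \<sigma> M])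
    show "norm (g'' x) \<le> norm (g'' q)" if "x \<in> {q}" for x using that by simp
    fix e :: real
    assume "0 < e" and "\<And>\<epsilon> x z \<zeta>. 0 < \<epsilon> \<Longrightarrow> \<epsilon> \<le> e \<Longrightarrow> x \<in> {q} \<Longrightarrow> norm z \<le> M \<Longrightarrow> norm \<zeta> \<le> M \<Longrightarrow>
      norm (g (x + \<epsilon> *\<^sub>R z + \<epsilon>\<^sup>2 *\<^sub>R \<zeta>) - g x - \<epsilon> *\<^sub>R g' x z - \<epsilon>\<^sup>2 *\<^sub>R (g' x \<zeta> + (1/2) *\<^sub>R g'' x z z)) \<le> \<sigma> * \<epsilon>\<^sup>2"
    then show ?thesis by (intro exI[of _ e]) simp
  qed
qed

lemma second_order_expansion_family:
  fixes g :: "'i \<Rightarrow> 'a::real_normed_vector \<Rightarrow> 'b::real_normed_vector"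
  assumes I: "finite I" and g: "\<And>i x. i \<in> I \<Longrightarrow> (g i has_derivative blinfun_apply (g' i x)) (at x)"
      "\<And>i x. i \<in> I \<Longrightarrow> (g' i has_derivative blinfun_apply (g'' i x)) (at x)"
    and \<sigma>: "0 < \<sigma>" and M: "0 \<le> M"
  shows "\<exists>e>0. \<forall>i\<in>I. \<forall>\<epsilon>. 0 < \<epsilon> \<and> \<epsilon> \<le> e \<longrightarrow> (\<forall>z \<zeta>. norm z \<le> M \<longrightarrow> norm \<zeta> \<le> M \<longrightarrow>
     norm (g i (q + \<epsilon> *\<^sub>R z + \<epsilon>\<^sup>2 *\<^sub>R \<zeta>) - g i q - \<epsilon> *\<^sub>R g' i q z - \<epsilon>\<^sup>2 *\<^sub>R (g' i q \<zeta> + (1/2) *\<^sub>R g'' i q z z)) \<le> \<sigma> * \<epsilon>\<^sup>2)"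
  by (rule finite_uniform_threshold[OF I]) (rule second_order_expansion_at_point[OF g \<sigma> M]; assumption)

context control_system
begin

definition reachable_cone :: "(real^'n) set" where
  "reachable_cone = {y T |w y. w \<in> inward_controls \<and> lin.sol (\<lambda>t. Bm (xh t) (w t)) y}"

lemma sol_Bm_add_scaleR:
  assumes "lin.sol (\<lambda>t. Bm (xh t) (v t)) y" "lin.sol (\<lambda>t. Bm (xh t) (w t)) x"
  shows "lin.sol (\<lambda>t. Bm (xh t) (v t + w t)) (\<lambda>t. y t + x t)"
    "lin.sol (\<lambda>t. Bm (xh t) (c *\<^sub>R v t)) (\<lambda>t. c *\<^sub>R y t)"
proof -
  have "Bm x (p + q) = Bm x p + Bm x q" "Bm x (c *\<^sub>R p) = c *\<^sub>R Bm x p" for x p q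
    by (simp_all add: Bm_def algebra_simps sum.distrib scaleR_sum_right)
  then show "lin.sol (\<lambda>t. Bm (xh t) (v t + w t)) (\<lambda>t. y t + x t)"
    "lin.sol (\<lambda>t. Bm (xh t) (c *\<^sub>R v t)) (\<lambda>t. c *\<^sub>R y t)"
    using lin.sol_add[OF assms] lin.sol_scaleR[OF assms(1), of c] by simp_all
qed

lemma sol_Bm_sum:
  assumes "finite Q" "\<And>q. q \<in> Q \<Longrightarrow> lin.sol (\<lambda>t. Bm (xh t) (w q t)) (y q)"
  shows "lin.sol (\<lambda>t. Bm (xh t) (\<Sum>q\<in>Q. c q *\<^sub>R w q t)) (\<lambda>t. \<Sum>q\<in>Q. c q *\<^sub>R y q t)"
proof -
  have "Bm x (\<Sum>q\<in>Q. c q *\<^sub>R p q) = (\<Sum>q\<in>Q. c q *\<^sub>R Bm x (p q))" for x p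
  proof -
    have "linear (Bm x)" by (rule linearI) (simp_all add: Bm_def algebra_simps sum.distrib scaleR_sum_right)
    then show ?thesis by (simp add: linear_sum linear_cmul)
  qed
  then show ?thesis using lin.sol_sum[OF assms, where c=c] by simp
qed

lemma reachable_cone: "convex reachable_cone" "0 \<in> reachable_cone" "\<And>x t. x \<in> reachable_cone \<Longrightarrow> 0 \<le> t \<Longrightarrow> t *\<^sub>R x \<in> reachable_cone"
proof -
  have add: "x + y \<in> reachable_cone" if xy: "x \<in> reachable_cone" "y \<in> reachable_cone" for x y
  proof -
    obtain w1 y1 where 1: "x = y1 T" "w1 \<in> inward_controls" "lin.sol (\<lambda>t. Bm (xh t) (w1 t)) y1" using xy(1) unfolding reachable_cone_def by blast
    obtain w2 y2 where 2: "y = y2 T" "w2 \<in> inward_controls" "lin.sol (\<lambda>t. Bm (xh t) (w2 t)) y2" using xy(2) unfolding reachable_cone_def by blast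
    show ?thesis unfolding reachable_cone_def using inward_controls_add[OF 1(2) 2(2)] sol_Bm_add_scaleR(1)[OF 1(3) 2(3)] 1(1) 2(1)
      by (intro CollectI exI[of _ "\<lambda>t. w1 t + w2 t"] exI[of _ "\<lambda>t. y1 t + y2 t"]) auto
  qed
  show sc: "t *\<^sub>R x \<in> reachable_cone" if x: "x \<in> reachable_cone" and t: "0 \<le> t" for x t
  proof -
    obtain w1 y1 where 1: "x = y1 T" "w1 \<in> inward_controls" "lin.sol (\<lambda>t. Bm (xh t) (w1 t)) y1" using x unfolding reachable_cone_def by blast
    show ?thesis unfolding reachable_cone_def using inward_controls_scaleR[OF 1(2) t] sol_Bm_add_scaleR(2)[OF 1(3) 1(3), of t] 1(1)
      by (intro CollectI exI[of _ "\<lambda>r. t *\<^sub>R w1 r"] exI[of _ "\<lambda>r. t *\<^sub>R y1 r"]) auto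
  qed
  show "convex reachable_cone" unfolding convex_alt using add sc by auto
  have "lin.sol (\<lambda>t. Bm (xh t) 0) (\<lambda>_. 0)" using lin.sol_0 by (simp add: Bm_def)
  then show "0 \<in> reachable_cone" unfolding reachable_cone_def using zero_controls(2) by force
qed

lemma sum_scaleR_norm_bound:
  fixes w :: "'q \<Rightarrow> 'v::real_normed_vector"
  assumes "\<And>q. q \<in> Q \<Longrightarrow> norm (w q) \<le> M q"
  shows "norm (\<Sum>q\<in>Q. c q *\<^sub>R w q) \<le> (\<Sum>q\<in>Q. \<bar>c q\<bar> * M q)"
  using assms by (intro sum_norm_le) (simp add: mult_left_mono)

text \<open>\<open>int\<close> provides slack r in every inequality, which the errors cannot use up,
  so that only the equalities have to be hit exactly by a fixed point argument. Independence of the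
  b j then reads off each \<eta> j = 0 from the vanishing of their combination.\<close>

lemma feasible_improvement:
  fixes \<phi> :: "'i \<Rightarrow> real^'n \<Rightarrow> real" and \<eta> :: "'j \<Rightarrow> real^'n \<Rightarrow> real"
    and \<phi>' :: "'i \<Rightarrow> (real^'n) \<Rightarrow> (real^'n) \<Rightarrow>\<^sub>L real" and \<eta>' :: "'j \<Rightarrow> (real^'n) \<Rightarrow> (real^'n) \<Rightarrow>\<^sub>L real"
  assumes u0: "\<And>t i. t \<in> {0..T} \<Longrightarrow> 0 \<le> u t $ i"
    and I: "finite I" and J: "finite J"
    and \<phi>: "\<And>i x. i \<in> I \<Longrightarrow> (\<phi> i has_derivative blinfun_apply (\<phi>' i x)) (at x)"
       "\<And>i x. i \<in> I \<Longrightarrow> (\<phi>' i has_derivative blinfun_apply (\<phi>'' i x)) (at x)" "\<And>i. i \<in> I \<Longrightarrow> \<phi> i (xh T) = 0"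
    and \<eta>: "\<And>j x. j \<in> J \<Longrightarrow> (\<eta> j has_derivative blinfun_apply (\<eta>' j x)) (at x)"
       "\<And>j x. j \<in> J \<Longrightarrow> (\<eta>' j has_derivative blinfun_apply (\<eta>'' j x)) (at x)" "\<And>j. j \<in> J \<Longrightarrow> \<eta> j (xh T) = 0"
    and a: "\<And>i y. i \<in> I \<Longrightarrow> blinfun_apply (\<phi>' i (xh T)) y = a i \<bullet> y"
    and b: "\<And>j y. j \<in> J \<Longrightarrow> blinfun_apply (\<eta>' j (xh T)) y = b j \<bullet> y"
    and indep: "\<And>y. (\<Sum>j\<in>J. y j *\<^sub>R b j) = 0 \<Longrightarrow> \<forall>j\<in>J. y j = 0"
    and v: "v absolutely_integrable_on {0..T}" and N: "negligible N"
    and v0: "\<And>t i. t \<in> {0..T} - N \<Longrightarrow> u t $ i = 0 \<Longrightarrow> v t $ i = 0"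
    and z: "lin.sol (\<lambda>t. Bm (xh t) (v t)) z" and s: "lin.sol (\<lambda>t. Qm (xh t) (u t) (z t) (v t)) s"
    and az: "\<And>i. i \<in> I \<Longrightarrow> a i \<bullet> z T \<le> 0" and bz: "\<And>j. j \<in> J \<Longrightarrow> b j \<bullet> z T = 0"
    and r: "0 < r" and int: "\<And>p. norm p \<le> r \<Longrightarrow> \<exists>\<rho>\<in>reachable_cone. \<exists>\<kappa>. (\<forall>j\<in>J. b j \<bullet> \<kappa> = 0) \<and>
      (\<Sum>j\<in>J. (b j \<bullet> \<rho> + (b j \<bullet> s T + (1/2) * \<eta>'' j (xh T) (z T) (z T))) *\<^sub>R b j) + \<kappa> = p \<and>
      (\<forall>i\<in>I. a i \<bullet> \<rho> + (a i \<bullet> s T + (1/2) * \<phi>'' i (xh T) (z T) (z T)) \<le> - r)"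
    and e: "0 < e"
  obtains X U where "U \<in> borel_measurable (lebesgue_on {0..T})" "\<And>t i. t \<in> {0..T} \<Longrightarrow> 0 \<le> U t $ i"
    "\<And>t. t \<in> {0..T} \<Longrightarrow> norm (U t - u t) \<le> e" "continuous_on {0..T} X"
    "\<And>t. t \<in> {0..T} \<Longrightarrow> X t = x0 + integral {0..t} (\<lambda>r. dyn f0 f (X r) (U r))"
    "\<And>t. t \<in> {0..T} \<Longrightarrow> norm (X t - xh t) \<le> e" "\<And>i. i \<in> I \<Longrightarrow> \<phi> i (X T) < 0" "\<And>j. j \<in> J \<Longrightarrow> \<eta> j (X T) = 0"
proof -
  define c where "c i = a i \<bullet> s T + (1/2) * \<phi>'' i (xh T) (z T) (z T)" for i
  define d where "d j = b j \<bullet> s T + (1/2) * \<eta>'' j (xh T) (z T) (z T)" for j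
  \<comment> \<open>A single constant that bounds every gradient and also the sum of all |b
    j|.\<close>
  define Ka where "Ka = 1 + (\<Sum>i\<in>I. norm (a i)) + (\<Sum>j\<in>J. norm (b j))"
  have sn: "0 \<le> (\<Sum>i\<in>I. norm (a i))" "0 \<le> (\<Sum>j\<in>J. norm (b j))" by (auto intro: sum_nonneg)
  have Ka: "1 \<le> Ka" using sn by (simp add: Ka_def)
  have aK: "norm (a i) \<le> Ka" if "i \<in> I" for i
    using member_le_sum[of i I "\<lambda>i. norm (a i)"] I that sn by (simp add: Ka_def)
  have bK: "norm (b j) \<le> Ka" if "j \<in> J" for j
    using member_le_sum[of j J "\<lambda>j. norm (b j)"] J that sn by (simp add: Ka_def)
  \<comment> \<open>Error budget: each constraint is off by at most 3 Ka \<sigma>, and weighting the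
    equalities by |b j| costs another factor Ka. The choice makes this exactly r / 2 and leaves the
    other half of r for the net.\<close>
  define \<sigma> where "\<sigma> = r / (6 * Ka\<^sup>2)"
  have Ka2: "1 \<le> Ka\<^sup>2" "Ka \<le> Ka\<^sup>2" using Ka by (simp_all add: power2_eq_square mult_ge1_I)
  have \<sigma>: "0 < \<sigma>" unfolding \<sigma>_def using r Ka2 by (intro divide_pos_pos) auto
  have \<sigma>K: "3 * Ka * \<sigma> * Ka = r / 2" using Ka by (simp add: \<sigma>_def power2_eq_square field_simps)
  have \<sigma>K': "3 * Ka * \<sigma> \<le> r / 2"
  proof -
    have "3 * Ka * \<sigma> * 1 \<le> 3 * Ka * \<sigma> * Ka" using Ka \<sigma> by (intro mult_left_mono) auto
    then show ?thesis using \<sigma>K by simp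
  qed
  obtain \<tau> where \<tau>: "0 < \<tau>" "\<And>v' z' s'. v' absolutely_integrable_on {0..T} \<Longrightarrow> lin.sol (\<lambda>t. Bm (xh t) (v' t)) z' \<Longrightarrow>
     lin.sol (\<lambda>t. Qm (xh t) (u t) (z' t) (v' t)) s' \<Longrightarrow> integral {0..T} (\<lambda>t. norm (v' t - v t)) \<le> \<tau> \<Longrightarrow> norm (s' T - s T) \<le> \<sigma>"
    using second_order_endpoint_continuous[OF v z s \<sigma>] by blast
  have linB: "linear (Bm (xh t))" for t by (rule linearI) (simp_all add: Bm_def algebra_simps sum.distrib scaleR_sum_right)
  \<comment> \<open>The replacement direction: truncated, with unchanged endpoint, and so close to v
    in L1 that the second-order endpoint moves by at most \<sigma>.\<close>
  obtain v' z' where v': "v' \<in> interior_controls" "lin.sol (\<lambda>t. Bm (xh t) (v' t)) z'" "z' T = z T" "integral {0..T} (\<lambda>t. norm (v' t - v t)) \<le> \<tau>"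
  proof (rule lin.dense_controls_attain_endpoint[where B="\<lambda>t. Bm (xh t)" and V=interior_controls and K=L and z=z and ?v0.0=v and e=\<tau>])
    show "\<exists>w\<in>interior_controls. integral {0..T} (\<lambda>t. norm (w t - v t)) \<le> e" if "0 < e" for e
      using interior_controls_dense[OF v N v0 u0 that] by blast
  qed (use linB L z v \<tau> zero_controls interior_controls_add interior_controls_scaleR controls_abs_int Bm_abs_int[OF xh_cont] in auto)
  have v'i: "v' absolutely_integrable_on {0..T}" by (rule controls_abs_int(1)[OF v'(1)])
  obtain s' where s': "lin.sol (\<lambda>t. Qm (xh t) (u t) (z' t) (v' t)) s'"
    using lin.sol_exists[OF Qm_abs_int[OF xh_cont lin.solD(2)[OF v'(2)] u_int v'i]] by blast
  have s's: "norm (s' T - s T) \<le> \<sigma>" by (rule \<tau>(2)[OF v'i v'(2) s' v'(4)])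
  obtain Mv dv where Mv: "v' \<in> borel_measurable (lebesgue_on {0..T})" "\<And>t. t \<in> {0..T} \<Longrightarrow> norm (v' t) \<le> Mv" "0 < dv"
    "\<And>t i. t \<in> {0..T} \<Longrightarrow> u t $ i < dv \<Longrightarrow> v' t $ i = 0" using v'(1) unfolding interior_controls_def by blast
  define K where "K = cball (0::real^'n) r"
  have Kc: "compact K" and r2: "0 < r / 2" using r by (auto simp: K_def)
  obtain Q cq where Q: "finite Q" "Q \<subseteq> K" "\<And>q. continuous_on K (cq q)" "\<And>q p. p \<in> K \<Longrightarrow> 0 \<le> cq q p"
    "\<And>p. p \<in> K \<Longrightarrow> (\<Sum>q\<in>Q. cq q p) = 1" "\<And>p. p \<in> K \<Longrightarrow> norm ((\<Sum>q\<in>Q. cq q p *\<^sub>R q) - p) \<le> r / 2"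
    using partition_of_unity_finite_net[OF Kc r2] by blast
  define P where "P q w y \<kappa> M d0 \<longleftrightarrow> w \<in> borel_measurable (lebesgue_on {0..T}) \<and> (\<forall>t\<in>{0..T}. norm (w t) \<le> M) \<and> 0 < d0 \<and>
     (\<forall>t\<in>{0..T}. \<forall>i. u t $ i < d0 \<longrightarrow> 0 \<le> w t $ i) \<and> lin.sol (\<lambda>t. Bm (xh t) (w t)) y \<and> (\<forall>j\<in>J. b j \<bullet> \<kappa> = 0) \<and>
      (\<Sum>j\<in>J. (b j \<bullet> y T + d j) *\<^sub>R b j) + \<kappa> = q \<and> (\<forall>i\<in>I. a i \<bullet> y T + c i \<le> - r)" for q w y \<kappa> M d0
  have "\<forall>q\<in>Q. \<exists>w y \<kappa> M d0. P q w y \<kappa> M d0"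
  proof
    fix q assume "q \<in> Q"
    then have "norm q \<le> r" using Q(2) by (auto simp: K_def)
    from int[OF this, folded c_def d_def] obtain \<rho> \<kappa> where k: "\<rho> \<in> reachable_cone" "\<forall>j\<in>J. b j \<bullet> \<kappa> = 0"
      "(\<Sum>j\<in>J. (b j \<bullet> \<rho> + d j) *\<^sub>R b j) + \<kappa> = q" "\<forall>i\<in>I. a i \<bullet> \<rho> + c i \<le> - r" by blast
    from k(1) obtain w y where w: "\<rho> = y T" "w \<in> inward_controls" "lin.sol (\<lambda>t. Bm (xh t) (w t)) y" unfolding reachable_cone_def by blast
    from w(2) obtain M d0 where "w \<in> borel_measurable (lebesgue_on {0..T})" "\<forall>t\<in>{0..T}. norm (w t) \<le> M" "0 < d0"
     "\<forall>t\<in>{0..T}. \<forall>i. u t $ i < d0 \<longrightarrow> 0 \<le> w t $ i" unfolding inward_controls_def by blast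
    with k w show "\<exists>w y \<kappa> M d0. P q w y \<kappa> M d0" unfolding P_def by blast
  qed
  then obtain wq yq \<kappa> Mq dq where "\<And>q. q \<in> Q \<Longrightarrow> P q (wq q) (yq q) (\<kappa> q) (Mq q) (dq q)" by metis
  then have q: "\<And>q. q \<in> Q \<Longrightarrow> wq q \<in> borel_measurable (lebesgue_on {0..T})"
     "\<And>q t. q \<in> Q \<Longrightarrow> t \<in> {0..T} \<Longrightarrow> norm (wq q t) \<le> Mq q" "\<And>q. q \<in> Q \<Longrightarrow> 0 < dq q"
     "\<And>q t i. q \<in> Q \<Longrightarrow> t \<in> {0..T} \<Longrightarrow> u t $ i < dq q \<Longrightarrow> 0 \<le> wq q t $ i"
     "\<And>q. q \<in> Q \<Longrightarrow> lin.sol (\<lambda>t. Bm (xh t) (wq q t)) (yq q)" "\<And>q j. q \<in> Q \<Longrightarrow> j \<in> J \<Longrightarrow> b j \<bullet> \<kappa> q = 0"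
      "\<And>q. q \<in> Q \<Longrightarrow> (\<Sum>j\<in>J. (b j \<bullet> yq q T + d j) *\<^sub>R b j) + \<kappa> q = q"
     "\<And>q i. q \<in> Q \<Longrightarrow> i \<in> I \<Longrightarrow> a i \<bullet> yq q T + c i \<le> - r"
    unfolding P_def by blast+
  define w where "w p t = (\<Sum>q\<in>Q. cq q p *\<^sub>R wq q t)" for p t
  define y where "y p t = (\<Sum>q\<in>Q. cq q p *\<^sub>R yq q t)" for p t
  have c1: "cq q p \<le> 1" if "p \<in> K" "q \<in> Q" for q p
    using member_le_sum[of q Q "\<lambda>q. cq q p"] Q(1,4,5) that by simp
  have Mq0: "0 \<le> Mq q" if "q \<in> Q" for q using order_trans[OF norm_ge_zero q(2)[OF that, of 0]] T by simp
  define M where "M = max Mv (\<Sum>q\<in>Q. Mq q)"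
  have wM: "norm (w p t) \<le> M" if p: "p \<in> K" and t: "t \<in> {0..T}" for p t
  proof -
    have "norm (w p t) \<le> (\<Sum>q\<in>Q. \<bar>cq q p\<bar> * Mq q)" unfolding w_def using q(2) t by (intro sum_scaleR_norm_bound) auto
    also have "\<dots> \<le> (\<Sum>q\<in>Q. 1 * Mq q)" using c1[OF p] Q(4)[OF p] Mq0 by (intro sum_mono mult_right_mono) auto
    finally show ?thesis by (simp add: M_def)
  qed
  have vM: "norm (v' t) \<le> M" if "t \<in> {0..T}" for t using Mv(2)[OF that] by (simp add: M_def)
  have M0: "0 \<le> M" using order_trans[OF norm_ge_zero vM[of 0]] T by simp
  have wmeas: "w p \<in> borel_measurable (lebesgue_on {0..T})" for p
    unfolding w_def[abs_def] by (intro borel_measurable_sum borel_measurable_scaleR borel_measurable_const q(1))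
  have ysol: "lin.sol (\<lambda>t. Bm (xh t) (w p t)) (y p)" for p
    unfolding w_def y_def[abs_def] by (rule sol_Bm_sum[OF Q(1) q(5)])
  have wcont: "\<exists>d>0. \<forall>p'\<in>K. dist p' p < d \<longrightarrow> (\<forall>t\<in>{0..T}. norm (w p' t - w p t) \<le> e)" if p: "p \<in> K" and e: "0 < e" for p e
  proof -
    define G where "G p' = (\<Sum>q\<in>Q. \<bar>cq q p' - cq q p\<bar> * Mq q)" for p'
    have "continuous_on K G" unfolding G_def by (intro continuous_intros Q(3))
    then obtain d where d: "d > 0" "\<And>p'. p' \<in> K \<Longrightarrow> dist p' p < d \<Longrightarrow> dist (G p') (G p) < e"
      unfolding continuous_on_iff using p e by metis
    have "norm (w p' t - w p t) \<le> e" if p': "p' \<in> K" "dist p' p < d" and t: "t \<in> {0..T}" for p' t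
    proof -
      have "w p' t - w p t = (\<Sum>q\<in>Q. (cq q p' - cq q p) *\<^sub>R wq q t)" by (simp add: w_def scaleR_diff_left sum_subtractf)
      also have "norm \<dots> \<le> G p'" unfolding G_def using q(2) t by (intro sum_scaleR_norm_bound) auto
      also have "G p' \<le> e" using d(2)[OF p'] by (simp add: dist_real_def G_def)
      finally show ?thesis .
    qed
    then show ?thesis using d(1) by blast
  qed
  obtain Mz where Mz: "\<And>t. t \<in> {0..T} \<Longrightarrow> norm (z' t) \<le> Mz" using sol_continuous_bounded[OF v'(2)] by blast
  obtain Ms where Ms: "\<And>t. t \<in> {0..T} \<Longrightarrow> norm (s' t) \<le> Ms" using sol_continuous_bounded[OF s'] by blast
  define My where "My = 2 * (L * M * T) * exp (2 * L * T)"
  have My: "norm (y p t) \<le> My" if "p \<in> K" "t \<in> {0..T}" for p t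
    unfolding My_def by (rule sol_Bm_bound[OF ysol wM]) (use that in auto)
  define M' where "M' = max Mz (Ms + My + \<sigma>)"
  have Tin: "T \<in> {0..T}" using T by simp
  have Mz0: "0 \<le> Mz" using order_trans[OF norm_ge_zero Mz[OF Tin]] .
  have M'0: "0 \<le> M'" using Mz0 by (simp add: M'_def)
  have "\<exists>e>0. \<forall>i\<in>I. \<forall>\<epsilon>. 0 < \<epsilon> \<and> \<epsilon> \<le> e \<longrightarrow> (\<forall>z \<zeta>. norm z \<le> M' \<longrightarrow> norm \<zeta> \<le> M' \<longrightarrow>
     norm (\<phi> i (xh T + \<epsilon> *\<^sub>R z + \<epsilon>\<^sup>2 *\<^sub>R \<zeta>) - \<phi> i (xh T) - \<epsilon> *\<^sub>R \<phi>' i (xh T) z - \<epsilon>\<^sup>2 *\<^sub>R (\<phi>' i (xh T) \<zeta> + (1/2) *\<^sub>R \<phi>'' i (xh T) z z)) \<le> \<sigma> * \<epsilon>\<^sup>2)"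
    by (rule second_order_expansion_family[OF I _ _ \<sigma> M'0]) (rule \<phi>(1) \<phi>(2); assumption)+
  then obtain e\<phi> where e\<phi>: "e\<phi> > 0" "\<And>i \<epsilon> zz \<zeta>. i \<in> I \<Longrightarrow> 0 < \<epsilon> \<Longrightarrow> \<epsilon> \<le> e\<phi> \<Longrightarrow> norm zz \<le> M' \<Longrightarrow> norm \<zeta> \<le> M' \<Longrightarrow>
     norm (\<phi> i (xh T + \<epsilon> *\<^sub>R zz + \<epsilon>\<^sup>2 *\<^sub>R \<zeta>) - \<phi> i (xh T) - \<epsilon> *\<^sub>R \<phi>' i (xh T) zz - \<epsilon>\<^sup>2 *\<^sub>R (\<phi>' i (xh T) \<zeta> + (1/2) *\<^sub>R \<phi>'' i (xh T) zz zz)) \<le> \<sigma> * \<epsilon>\<^sup>2"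
    by blast
  have "\<exists>e>0. \<forall>j\<in>J. \<forall>\<epsilon>. 0 < \<epsilon> \<and> \<epsilon> \<le> e \<longrightarrow> (\<forall>z \<zeta>. norm z \<le> M' \<longrightarrow> norm \<zeta> \<le> M' \<longrightarrow>
     norm (\<eta> j (xh T + \<epsilon> *\<^sub>R z + \<epsilon>\<^sup>2 *\<^sub>R \<zeta>) - \<eta> j (xh T) - \<epsilon> *\<^sub>R \<eta>' j (xh T) z - \<epsilon>\<^sup>2 *\<^sub>R (\<eta>' j (xh T) \<zeta> + (1/2) *\<^sub>R \<eta>'' j (xh T) z z)) \<le> \<sigma> * \<epsilon>\<^sup>2)"
    by (rule second_order_expansion_family[OF J _ _ \<sigma> M'0]) (rule \<eta>(1) \<eta>(2); assumption)+
  then obtain e\<eta> where e\<eta>: "e\<eta> > 0" "\<And>j \<epsilon> zz \<zeta>. j \<in> J \<Longrightarrow> 0 < \<epsilon> \<Longrightarrow> \<epsilon> \<le> e\<eta> \<Longrightarrow> norm zz \<le> M' \<Longrightarrow> norm \<zeta> \<le> M' \<Longrightarrow>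
     norm (\<eta> j (xh T + \<epsilon> *\<^sub>R zz + \<epsilon>\<^sup>2 *\<^sub>R \<zeta>) - \<eta> j (xh T) - \<epsilon> *\<^sub>R \<eta>' j (xh T) zz - \<epsilon>\<^sup>2 *\<^sub>R (\<eta>' j (xh T) \<zeta> + (1/2) *\<^sub>R \<eta>'' j (xh T) zz zz)) \<le> \<sigma> * \<epsilon>\<^sup>2"
    by blast
  define G where "G \<epsilon> \<longleftrightarrow> (\<exists>X. continuous_on K (\<lambda>p. X p T) \<and>
     (\<forall>p\<in>K. continuous_on {0..T} (X p) \<and> (\<forall>t\<in>{0..T}.
        X p t = x0 + integral {0..t} (\<lambda>r. dyn f0 f (X p r) (u r + \<epsilon> *\<^sub>R v' r + \<epsilon>\<^sup>2 *\<^sub>R w p r)) \<and>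
        norm (X p t - (xh t + \<epsilon> *\<^sub>R z' t + \<epsilon>\<^sup>2 *\<^sub>R (s' t + y p t))) \<le> \<sigma> * \<epsilon>\<^sup>2)))" for \<epsilon>
  obtain e1 where e1: "0 < e1" "\<And>\<epsilon>. 0 < \<epsilon> \<Longrightarrow> \<epsilon> \<le> e1 \<Longrightarrow> G \<epsilon>"
  proof -
    note that' = that
    show thesis
  proof (rule perturbed_trajectories[where K=K and w=w and y=y and v=v' and z=z' and s=s' and M=M, OF \<sigma> Mv(1) vM v'(2) s' wmeas _ ysol, folded G_def])
    show "norm (w p t) \<le> M" if "p \<in> K" "t \<in> {0..T}" for p t using that by (rule wM)
    show "\<exists>d>0. \<forall>p'\<in>K. dist p' p < d \<longrightarrow> (\<forall>t\<in>{0..T}. norm (w p' t - w p t) \<le> e)" if "p \<in> K" "0 < e" for p e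
      using that by (rule wcont)
    show thesis if "0 < e1" "\<And>\<epsilon>. 0 < \<epsilon> \<Longrightarrow> \<epsilon> \<le> e1 \<Longrightarrow> G \<epsilon>" for e1
      using that by (rule that')
  qed
  qed
  have "\<exists>d0>0. \<forall>q\<in>Q. \<forall>\<epsilon>. 0 < \<epsilon> \<and> \<epsilon> \<le> d0 \<longrightarrow> \<epsilon> \<le> dq q"
    by (rule finite_uniform_threshold[OF Q(1)]) (use q(3) in blast)
  then obtain d1 where d1: "d1 > 0" "\<And>q. q \<in> Q \<Longrightarrow> d1 \<le> dq q" by auto
  \<comment> \<open>Below this level of u_i the direction v' vanishes and every chosen control
    points inwards.\<close>
  define d0 where "d0 = min dv d1"
  have d0: "d0 > 0" "d0 \<le> dv" "\<And>q. q \<in> Q \<Longrightarrow> d0 \<le> dq q" using d1 Mv(3) by (force simp: d0_def)+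
  \<comment> \<open>\<epsilon> B bounds the size of the control perturbation through 2 M, and the
    distance from X p to xh through the remaining terms.\<close>
  define B where "B = 2 * M + Mz + Ms + My + \<sigma> + 1"
  have Ms0: "0 \<le> Ms" using order_trans[OF norm_ge_zero Ms[OF Tin]] .
  have My0: "0 \<le> My" using L(1) M0 T by (simp add: My_def)
  have B: "B > 0" using M0 Mz0 Ms0 My0 \<sigma> by (simp add: B_def)
  define \<epsilon> where "\<epsilon> = Min {1, e\<phi>, e\<eta>, e1, d0 / B, e / B}"
  have "\<epsilon> \<in> {1, e\<phi>, e\<eta>, e1, d0 / B, e / B}" unfolding \<epsilon>_def by (rule Min_in) auto
  then have \<epsilon>: "0 < \<epsilon>" using e\<phi>(1) e\<eta>(1) e1(1) d0(1) B e by auto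
  have \<epsilon>': "\<epsilon> \<le> 1" "\<epsilon> \<le> e\<phi>" "\<epsilon> \<le> e\<eta>" "\<epsilon> \<le> e1" "\<epsilon> \<le> d0 / B" "\<epsilon> \<le> e / B" unfolding \<epsilon>_def by (rule Min_le; simp)+
  have \<epsilon>B: "\<epsilon> * B \<le> d0" "\<epsilon> * B \<le> e" using \<epsilon>'(5,6) B by (auto simp: pos_le_divide_eq)
  have \<epsilon>2: "0 < \<epsilon>\<^sup>2" "\<epsilon>\<^sup>2 \<le> \<epsilon>" using \<epsilon> \<epsilon>' by (auto simp: power2_eq_square)
  obtain X where Xc: "continuous_on K (\<lambda>p. X p T)" and X: "\<And>p. p \<in> K \<Longrightarrow> continuous_on {0..T} (X p)"
    "\<And>p t. p \<in> K \<Longrightarrow> t \<in> {0..T} \<Longrightarrow> X p t = x0 + integral {0..t} (\<lambda>r. dyn f0 f (X p r) (u r + \<epsilon> *\<^sub>R v' r + \<epsilon>\<^sup>2 *\<^sub>R w p r))"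
    "\<And>p t. p \<in> K \<Longrightarrow> t \<in> {0..T} \<Longrightarrow> norm (X p t - (xh t + \<epsilon> *\<^sub>R z' t + \<epsilon>\<^sup>2 *\<^sub>R (s' t + y p t))) \<le> \<sigma> * \<epsilon>\<^sup>2"
    using e1(2)[OF \<epsilon> \<epsilon>'(4)] unfolding G_def by blast
  \<comment> \<open>The actual second-order coefficient of the endpoint. In this exact form of X p T
    the first-order term is z T, so the expansions of \<phi> and \<eta> apply with the critical
    direction; z' T = z T keeps \<zeta> p within \<sigma> of s' T + y p T.\<close>
  define \<zeta> where "\<zeta> p = (1 / \<epsilon>\<^sup>2) *\<^sub>R (X p T - xh T - \<epsilon> *\<^sub>R z T)" for p
  have X\<zeta>: "X p T = xh T + \<epsilon> *\<^sub>R z T + \<epsilon>\<^sup>2 *\<^sub>R \<zeta> p" for p using \<epsilon> by (simp add: \<zeta>_def)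
  have \<zeta>1: "norm (\<zeta> p - (s' T + y p T)) \<le> \<sigma>" if p: "p \<in> K" for p
  proof -
    have "\<zeta> p - (s' T + y p T) = (1 / \<epsilon>\<^sup>2) *\<^sub>R (X p T - (xh T + \<epsilon> *\<^sub>R z T + \<epsilon>\<^sup>2 *\<^sub>R (s' T + y p T)))"
      using \<epsilon> by (simp add: \<zeta>_def algebra_simps)
    then have "norm (\<zeta> p - (s' T + y p T)) = (1 / \<epsilon>\<^sup>2) * norm (X p T - (xh T + \<epsilon> *\<^sub>R z T + \<epsilon>\<^sup>2 *\<^sub>R (s' T + y p T)))"
      by simp
    also have "\<dots> \<le> (1 / \<epsilon>\<^sup>2) * (\<sigma> * \<epsilon>\<^sup>2)" using X(3)[OF p Tin] by (intro mult_left_mono) (auto simp: v'(3))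
    finally show ?thesis using \<epsilon> by simp
  qed
  have zM: "norm (z T) \<le> M'" using Mz[OF Tin] by (simp add: v'(3) M'_def)
  have \<zeta>M: "norm (\<zeta> p) \<le> M'" if p: "p \<in> K" for p
    using norm_triangle_mono[OF \<zeta>1[OF p] norm_triangle_mono[OF Ms[OF Tin] My[OF p Tin]]] by (simp add: M'_def)
  \<comment> \<open>One \<sigma> comes from the remainder of the trajectory, the other from
    exchanging s' T for s T.\<close>
  have \<zeta>2: "norm (\<zeta> p - (s T + y p T)) \<le> 2 * \<sigma>" if p: "p \<in> K" for p
  proof -
    have "\<zeta> p - (s T + y p T) = (\<zeta> p - (s' T + y p T)) + (s' T - s T)" by simp
    then show ?thesis using norm_triangle_mono[OF \<zeta>1[OF p] s's] by (simp only: mult_2)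
  qed
  have inner_est: "\<bar>l \<bullet> \<zeta> p - l \<bullet> (s T + y p T)\<bar> \<le> Ka * (2 * \<sigma>)" if p: "p \<in> K" and l: "norm l \<le> Ka" for l p
  proof -
    have "\<bar>l \<bullet> \<zeta> p - l \<bullet> (s T + y p T)\<bar> = \<bar>l \<bullet> (\<zeta> p - (s T + y p T))\<bar>" by (simp add: inner_diff_right)
    also have "\<dots> \<le> norm l * norm (\<zeta> p - (s T + y p T))" by (rule Cauchy_Schwarz_ineq2)
    also have "\<dots> \<le> Ka * (2 * \<sigma>)" using l \<zeta>2[OF p] Ka by (intro mult_mono) auto
    finally show ?thesis .
  qed
  have K\<sigma>: "Ka * (2 * \<sigma>) + \<sigma> \<le> 3 * Ka * \<sigma>" using Ka \<sigma> by (simp add: algebra_simps)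
  have y\<phi>: "a i \<bullet> y p T + c i \<le> - r" if p: "p \<in> K" and i: "i \<in> I" for i p
  proof -
    have "(\<Sum>q\<in>Q. cq q p * (a i \<bullet> yq q T + c i)) \<le> (\<Sum>q\<in>Q. cq q p * (- r))"
      using q(8)[OF _ i] Q(4)[OF p] by (intro sum_mono mult_left_mono) auto
    moreover have "(\<Sum>q\<in>Q. cq q p * (a i \<bullet> yq q T + c i)) = a i \<bullet> y p T + (\<Sum>q\<in>Q. cq q p) * c i"
      by (simp add: y_def inner_sum_right distrib_left sum.distrib sum_distrib_right)
    moreover have "(\<Sum>q\<in>Q. cq q p * (- r)) = (\<Sum>q\<in>Q. cq q p) * (- r)" by (simp only: sum_distrib_right)
    ultimately show ?thesis using Q(5)[OF p] by simp
  qed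
  \<comment> \<open>The first-order term is nonpositive for a critical direction, so it can only
    help, and the slack r exceeds the second-order error.\<close>
  have \<phi>neg: "\<phi> i (X p T) < 0" if p: "p \<in> K" and i: "i \<in> I" for i p
  proof -
    have "\<bar>\<phi> i (X p T) - \<epsilon> * (a i \<bullet> z T) - \<epsilon>\<^sup>2 * (a i \<bullet> \<zeta> p + (1/2) * \<phi>'' i (xh T) (z T) (z T))\<bar> \<le> \<sigma> * \<epsilon>\<^sup>2"
      using e\<phi>(2)[OF i \<epsilon> \<epsilon>'(2) zM \<zeta>M[OF p]] by (simp add: X\<zeta>[symmetric] \<phi>(3)[OF i] a[OF i])
    then have "\<phi> i (X p T) \<le> \<epsilon> * (a i \<bullet> z T) + \<epsilon>\<^sup>2 * (a i \<bullet> \<zeta> p + (1/2) * \<phi>'' i (xh T) (z T) (z T)) + \<sigma> * \<epsilon>\<^sup>2" by linarith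
    also have "\<dots> \<le> 0 + \<epsilon>\<^sup>2 * (- r + Ka * (2 * \<sigma>)) + \<sigma> * \<epsilon>\<^sup>2"
    proof -
      have 1: "\<epsilon> * (a i \<bullet> z T) \<le> 0" using az[OF i] \<epsilon> by (simp add: mult_nonneg_nonpos)
      have 2: "a i \<bullet> \<zeta> p + (1/2) * \<phi>'' i (xh T) (z T) (z T) \<le> - r + Ka * (2 * \<sigma>)"
        using inner_est[OF p aK[OF i]] y\<phi>[OF p i] by (simp add: c_def inner_add_right)
      show ?thesis using 1 mult_left_mono[OF 2, of "\<epsilon>\<^sup>2"] by simp
    qed
    also have "\<dots> = \<epsilon>\<^sup>2 * ((Ka * (2 * \<sigma>) + \<sigma>) - r)" by (simp add: algebra_simps)
    also have "\<dots> < 0" using K\<sigma> \<sigma>K' r \<epsilon>2(1) by (intro mult_pos_neg) auto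
    finally show ?thesis .
  qed
  have \<eta>est: "\<bar>\<eta> j (X p T) / \<epsilon>\<^sup>2 - (b j \<bullet> y p T + d j)\<bar> \<le> 3 * Ka * \<sigma>" if p: "p \<in> K" and j: "j \<in> J" for j p
  proof -
    have "\<bar>\<eta> j (X p T) - \<epsilon>\<^sup>2 * (b j \<bullet> \<zeta> p + (1/2) * \<eta>'' j (xh T) (z T) (z T))\<bar> \<le> \<sigma> * \<epsilon>\<^sup>2"
      using e\<eta>(2)[OF j \<epsilon> \<epsilon>'(3) zM \<zeta>M[OF p]] by (simp add: X\<zeta>[symmetric] \<eta>(3)[OF j] b[OF j] bz[OF j])
    moreover have "\<eta> j (X p T) - \<epsilon>\<^sup>2 * (b j \<bullet> \<zeta> p + (1/2) * \<eta>'' j (xh T) (z T) (z T)) = \<epsilon>\<^sup>2 * (\<eta> j (X p T) / \<epsilon>\<^sup>2 - (b j \<bullet> \<zeta> p + (1/2) * \<eta>'' j (xh T) (z T) (z T)))"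
      using \<epsilon>2 by (simp add: right_diff_distrib)
    ultimately have "\<epsilon>\<^sup>2 * \<bar>\<eta> j (X p T) / \<epsilon>\<^sup>2 - (b j \<bullet> \<zeta> p + (1/2) * \<eta>'' j (xh T) (z T) (z T))\<bar> \<le> \<epsilon>\<^sup>2 * \<sigma>"
      by (simp add: abs_mult mult.commute)
    then have "\<bar>\<eta> j (X p T) / \<epsilon>\<^sup>2 - (b j \<bullet> \<zeta> p + (1/2) * \<eta>'' j (xh T) (z T) (z T))\<bar> \<le> \<sigma>"
      using \<epsilon>2(1) by (rule mult_left_le_imp_le)
    then show ?thesis using inner_est[OF p bK[OF j]] K\<sigma> by (simp add: d_def inner_add_right)
  qed
  \<comment> \<open>The increment actually realised at p, encoded as in \<open>int\<close>: the
    equality values divided by \<epsilon>^2 as a combination of the b j, plus the orthogonal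
    component. It misses the target p by at most r / 2 from the net and r / 2 from the
    errors.\<close>
  define F where "F p = (\<Sum>q\<in>Q. cq q p *\<^sub>R \<kappa> q) + (\<Sum>j\<in>J. (\<eta> j (X p T) / \<epsilon>\<^sup>2) *\<^sub>R b j)" for p
  have Fp: "norm (F p - p) \<le> r" if p: "p \<in> K" for p
  proof -
    have "(\<Sum>q\<in>Q. cq q p *\<^sub>R q) = (\<Sum>q\<in>Q. cq q p *\<^sub>R ((\<Sum>j\<in>J. (b j \<bullet> yq q T + d j) *\<^sub>R b j) + \<kappa> q))"
      by (rule sum.cong) (simp_all add: q(7))
    also have "\<dots> = (\<Sum>q\<in>Q. \<Sum>j\<in>J. (cq q p * (b j \<bullet> yq q T + d j)) *\<^sub>R b j) + (\<Sum>q\<in>Q. cq q p *\<^sub>R \<kappa> q)"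
      by (simp add: scaleR_add_right sum.distrib scaleR_sum_right)
    also have "(\<Sum>q\<in>Q. \<Sum>j\<in>J. (cq q p * (b j \<bullet> yq q T + d j)) *\<^sub>R b j) = (\<Sum>j\<in>J. (\<Sum>q\<in>Q. cq q p * (b j \<bullet> yq q T + d j)) *\<^sub>R b j)"
      by (subst sum.swap) (simp add: scaleR_sum_left)
    also have "\<dots> = (\<Sum>j\<in>J. (b j \<bullet> y p T + d j) *\<^sub>R b j)"
    proof (rule sum.cong)
      fix j assume "j \<in> J"
      have "(\<Sum>q\<in>Q. cq q p * (b j \<bullet> yq q T + d j)) = b j \<bullet> y p T + (\<Sum>q\<in>Q. cq q p) * d j"
        by (simp add: y_def inner_sum_right distrib_left sum.distrib sum_distrib_right)
      then show "(\<Sum>q\<in>Q. cq q p * (b j \<bullet> yq q T + d j)) *\<^sub>R b j = (b j \<bullet> y p T + d j) *\<^sub>R b j" using Q(5)[OF p] by simp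
    qed simp
    finally have "F p - p = ((\<Sum>q\<in>Q. cq q p *\<^sub>R q) - p) + (\<Sum>j\<in>J. (\<eta> j (X p T) / \<epsilon>\<^sup>2 - (b j \<bullet> y p T + d j)) *\<^sub>R b j)"
      by (simp add: F_def scaleR_diff_left sum_subtractf)
    also have "norm \<dots> \<le> r / 2 + (\<Sum>j\<in>J. 3 * Ka * \<sigma> * norm (b j))"
    proof (intro norm_triangle_mono Q(6)[OF p] sum_norm_le)
      fix j assume j: "j \<in> J"
      show "norm ((\<eta> j (X p T) / \<epsilon>\<^sup>2 - (b j \<bullet> y p T + d j)) *\<^sub>R b j) \<le> 3 * Ka * \<sigma> * norm (b j)"
        unfolding norm_scaleR using \<eta>est[OF p j] by (intro mult_right_mono) auto
    qed
    also have "(\<Sum>j\<in>J. 3 * Ka * \<sigma> * norm (b j)) = 3 * Ka * \<sigma> * (\<Sum>j\<in>J. norm (b j))" by (simp only: sum_distrib_left)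
    also have "3 * Ka * \<sigma> * (\<Sum>j\<in>J. norm (b j)) \<le> 3 * Ka * \<sigma> * Ka"
      using sn Ka \<sigma> by (intro mult_left_mono) (auto simp: Ka_def)
    finally show ?thesis using \<sigma>K by simp
  qed
  have \<eta>c: "continuous_on K (\<lambda>p. \<eta> j (X p T))" if "j \<in> J" for j
  proof -
    have "continuous_on UNIV (\<eta> j)" using \<eta>(1)[OF that] has_derivative_continuous by (blast intro: continuous_at_imp_continuous_on)
    then show ?thesis by (rule continuous_on_compose2[OF _ Xc]) auto
  qed
  have "continuous_on K F"
    unfolding F_def
    by (intro continuous_on_add continuous_on_sum continuous_on_scaleR continuous_on_divide continuous_on_const Q(3) \<eta>c) (use \<epsilon> in auto)
  \<comment> \<open>A continuous map that moves no point of the ball by more than its radius attains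
    the centre.\<close>
  then have "\<exists>p\<in>cball 0 r. F p = 0"
    by (intro brouwer_surjective_cball[where S="{0}"]) (use r Fp in \<open>auto simp: K_def norm_minus_commute\<close>)
  then obtain p where p: "p \<in> K" "F p = 0" by (auto simp: K_def)
  \<comment> \<open>k is orthogonal to every b j, yet F p = 0 makes it a combination of them; hence
    k = 0 and the combination vanishes.\<close>
  define k where "k = (\<Sum>q\<in>Q. cq q p *\<^sub>R \<kappa> q)"
  have perp: "b j \<bullet> k = 0" if "j \<in> J" for j unfolding k_def using q(6) that by (simp add: inner_sum_right)
  have "k = - (\<Sum>j\<in>J. (\<eta> j (X p T) / \<epsilon>\<^sup>2) *\<^sub>R b j)"
    using p(2) unfolding F_def k_def[symmetric] by (simp only: eq_neg_iff_add_eq_0)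
  then have "k \<bullet> k = k \<bullet> (- (\<Sum>j\<in>J. (\<eta> j (X p T) / \<epsilon>\<^sup>2) *\<^sub>R b j))"
    by (rule arg_cong)
  also have "\<dots> = 0" using perp by (simp add: inner_sum_right inner_commute)
  finally have "k = 0" by simp
  then have "(\<Sum>j\<in>J. (\<eta> j (X p T) / \<epsilon>\<^sup>2) *\<^sub>R b j) = 0" using p(2) by (simp add: F_def k_def)
  from indep[OF this] have \<eta>0: "\<eta> j (X p T) = 0" if "j \<in> J" for j using that \<epsilon> by auto
  define U where "U t = u t + \<epsilon> *\<^sub>R v' t + \<epsilon>\<^sup>2 *\<^sub>R w p t" for t
  have n1: "norm (\<epsilon> *\<^sub>R v' t) \<le> \<epsilon> * M" "norm (\<epsilon>\<^sup>2 *\<^sub>R w p t) \<le> \<epsilon> * M" if "t \<in> {0..T}" for t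
  proof -
    show "norm (\<epsilon> *\<^sub>R v' t) \<le> \<epsilon> * M" unfolding norm_scaleR using \<epsilon> vM[OF that] by (intro mult_mono) auto
    show "norm (\<epsilon>\<^sup>2 *\<^sub>R w p t) \<le> \<epsilon> * M" unfolding norm_scaleR using less_imp_le[OF \<epsilon>] \<epsilon>2(2) wM[OF p(1) that] by (intro mult_mono) auto
  qed
  have BM: "\<epsilon> * M + \<epsilon> * M \<le> \<epsilon> * B" using \<epsilon> Mz0 Ms0 My0 \<sigma> by (simp add: B_def distrib_left[symmetric])
  show thesis
  proof (rule that[of U "X p"])
    show "U \<in> borel_measurable (lebesgue_on {0..T})"
      unfolding U_def[abs_def] by (intro borel_measurable_add borel_measurable_scaleR borel_measurable_const u_meas Mv(1) wmeas)
    show "continuous_on {0..T} (X p)" by (rule X(1)[OF p(1)])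
    show "X p t = x0 + integral {0..t} (\<lambda>r. dyn f0 f (X p r) (U r))" if "t \<in> {0..T}" for t
      unfolding U_def by (rule X(2)[OF p(1) that])
    show "\<phi> i (X p T) < 0" if "i \<in> I" for i by (rule \<phi>neg[OF p(1) that])
    show "\<eta> j (X p T) = 0" if "j \<in> J" for j by (rule \<eta>0[OF that])
    fix t assume t: "t \<in> {0..T}"
    have "norm (U t - u t) \<le> \<epsilon> * M + \<epsilon> * M"
      using norm_triangle_mono[OF n1[OF t]] by (simp add: U_def)
    then show "norm (U t - u t) \<le> e" using BM \<epsilon>B by linarith
    show "0 \<le> U t $ i" for i
    \<comment> \<open>Where u_i is small, v' vanishes and w p is nonnegative; elsewhere u_i is at
      least d0, which is no less than the whole perturbation.\<close>
    proof (cases "u t $ i < d0")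
      case True
      have "v' t $ i = 0" using Mv(4)[OF t, of i] True d0(2) by simp
      moreover have "0 \<le> w p t $ i"
        unfolding w_def sum_component vector_scaleR_component real_scaleR_def
      proof (intro sum_nonneg mult_nonneg_nonneg)
        fix q' assume q': "q' \<in> Q"
        show "0 \<le> cq q' p" by (rule Q(4)[OF p(1)])
        show "0 \<le> wq q' t $ i" using q(4)[OF q' t, of i] True d0(3)[OF q'] by simp
      qed
      ultimately show ?thesis using u0[OF t, of i] by (simp add: U_def)
    next
      case False
      have "\<bar>(\<epsilon> *\<^sub>R v' t) $ i\<bar> \<le> \<epsilon> * M" "\<bar>(\<epsilon>\<^sup>2 *\<^sub>R w p t) $ i\<bar> \<le> \<epsilon> * M"
        using n1[OF t] component_le_norm_cart order_trans by blast+
      moreover have "U t $ i = u t $ i + (\<epsilon> *\<^sub>R v' t) $ i + (\<epsilon>\<^sup>2 *\<^sub>R w p t) $ i" by (simp add: U_def)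
      ultimately show ?thesis using False BM \<epsilon>B by linarith
    qed
    have "norm (\<epsilon> *\<^sub>R z' t) \<le> \<epsilon> * Mz" unfolding norm_scaleR using \<epsilon> Mz[OF t] by (intro mult_mono) auto
    moreover have "norm (\<epsilon>\<^sup>2 *\<^sub>R (s' t + y p t)) \<le> \<epsilon> * (Ms + My)" unfolding norm_scaleR
      using less_imp_le[OF \<epsilon>] \<epsilon>2(2) norm_triangle_mono[OF Ms[OF t] My[OF p(1) t]] by (intro mult_mono) auto
    moreover have "norm (X p t - (xh t + \<epsilon> *\<^sub>R z' t + \<epsilon>\<^sup>2 *\<^sub>R (s' t + y p t))) \<le> \<epsilon> * \<sigma>"
    proof -
      have "\<sigma> * \<epsilon>\<^sup>2 \<le> \<epsilon> * \<sigma>" using \<sigma> \<epsilon>2 by simp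
      then show ?thesis using X(3)[OF p(1) t] by linarith
    qed
    ultimately have "norm ((X p t - (xh t + \<epsilon> *\<^sub>R z' t + \<epsilon>\<^sup>2 *\<^sub>R (s' t + y p t))) + (\<epsilon> *\<^sub>R z' t + \<epsilon>\<^sup>2 *\<^sub>R (s' t + y p t))) \<le> \<epsilon> * \<sigma> + (\<epsilon> * Mz + \<epsilon> * (Ms + My))"
      by (intro norm_triangle_mono)
    then have "norm (X p t - xh t) \<le> \<epsilon> * \<sigma> + (\<epsilon> * Mz + \<epsilon> * (Ms + My))" by (simp add: algebra_simps)
    also have "\<dots> = \<epsilon> * (\<sigma> + Mz + Ms + My)" by (simp add: algebra_simps)
    also have "\<dots> \<le> \<epsilon> * B" using \<epsilon> M0 by (intro mult_left_mono) (auto simp: B_def)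
    finally show "norm (X p t - xh t) \<le> e" using \<epsilon>B by linarith
  qed
qed

end

section \<open>Multipliers from separating coefficients, and the return to the almost-everywhere
  formulation\<close>

section \<open>The second-order necessary condition\<close>

text \<open>Gradients as vectors: they can then enter the separation argument and serve as the final
  value of the adjoint.\<close>

lemma blinfun_real_representation:
  fixes \<Phi> :: "'a::euclidean_space \<Rightarrow>\<^sub>L real"
  shows "blinfun_apply \<Phi> z = (\<Sum>e\<in>Basis. blinfun_apply \<Phi> e *\<^sub>R e) \<bullet> z"
proof -
  have "blinfun_apply \<Phi> z = blinfun_apply \<Phi> (\<Sum>e\<in>Basis. (z \<bullet> e) *\<^sub>R e)" by (simp add: euclidean_representation)
  also have "\<dots> = (\<Sum>e\<in>Basis. (z \<bullet> e) * blinfun_apply \<Phi> e)" by (simp add: blinfun.sum_right blinfun.scaleR_right)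
  also have "\<dots> = (\<Sum>e\<in>Basis. blinfun_apply \<Phi> e *\<^sub>R e) \<bullet> z"
    unfolding inner_sum_left by (intro sum.cong) (auto simp: inner_commute)
  finally show ?thesis .
qed

lemma L2_on_imp_absolutely_integrable:
  assumes "L2_on T v" shows "v absolutely_integrable_on {0..T}"
proof (rule measurable_bounded_by_integrable_imp_absolutely_integrable[where g="\<lambda>t. 1 + (norm (v t))\<^sup>2"])
  show "v \<in> borel_measurable (lebesgue_on {0..T})" using assms by (simp add: L2_on_def)
  have "(\<lambda>t. (norm (v t))\<^sup>2) integrable_on {0..T}" using assms by (intro integrable_on_lebesgue_on) (auto simp: L2_on_def)
  then show "(\<lambda>t. 1 + (norm (v t))\<^sup>2) integrable_on {0..T}" by (intro Henstock_Kurzweil_Integration.integrable_add) auto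
  fix t
  have "0 \<le> (norm (v t) - 1)\<^sup>2" by simp
  then have "2 * norm (v t) \<le> 1 + (norm (v t))\<^sup>2" by (simp add: power2_eq_square algebra_simps)
  then show "norm (v t) \<le> 1 + (norm (v t))\<^sup>2" using norm_ge_zero[of "v t"] by linarith
qed auto

lemma Linf_on_imp_absolutely_integrable:
  assumes "Linf_on T v" shows "v absolutely_integrable_on {0..T}"
proof -
  obtain C where m: "v \<in> borel_measurable (lebesgue_on {0..T})" and C: "AE t in lebesgue_on {0..T}. norm (v t) \<le> C"
    using assms by (auto simp: Linf_on_def)
  obtain N where N: "negligible N" "\<And>t. t \<in> {0..T} - N \<Longrightarrow> norm (v t) \<le> C"
    using C by (subst (asm) AE_lebesgue_on_iff_negligible) auto
  have fin: "finite_measure (lebesgue_on {0..T})" by (simp add: finite_measure_lebesgue_on)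
  have "integrable (lebesgue_on {0..T}) v"
    by (rule finite_measure.integrable_const_bound[OF fin C m])
  then show ?thesis by (simp add: set_integrable_def integrable_restrict_space)
qed

context control_system
begin

lemma Amat_eq_DA: "uh t = u t \<Longrightarrow> Amat f0' f' xh uh t z = DA (xh t) (u t) z"
  by (simp add: Amat_def DA_def)

text \<open>c is the gradient of the weighted endpoint function. Duality turns its nonnegativity on
  \<open>reachable_cone\<close> into nonnegativity of the integral of \<psi> . B w for all inward w,
  and the signs of the switching functions then give the minimum condition in
  \<open>Lam\<close>.\<close>

lemma multiplier_in_Lam:
  assumes u0: "\<And>t i. t \<in> {0..T} \<Longrightarrow> 0 \<le> u t $ i" and N: "negligible N" and uh: "\<And>t. t \<in> {0..T} - N \<Longrightarrow> uh t = u t"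
    and norm1: "(\<Sum>i\<le>d\<phi>. \<bar>\<alpha> i\<bar>) + (\<Sum>j\<in>{1..d\<eta>}. \<bar>\<beta> j\<bar>) = 1"
    and \<alpha>: "\<forall>i\<le>d\<phi>. 0 \<le> \<alpha> i" "\<forall>i>d\<phi>. \<alpha> i = 0" and \<beta>: "\<forall>j. j \<notin> {1..d\<eta>} \<longrightarrow> \<beta> j = 0"
    and c: "\<And>z. c \<bullet> z = lprime d\<phi> \<phi>' d\<eta> \<eta>' \<alpha> \<beta> (xh T) z"
    and ge: "\<And>\<rho>. \<rho> \<in> reachable_cone \<Longrightarrow> 0 \<le> c \<bullet> \<rho>"
  obtains \<psi> where "(\<alpha>, \<beta>, \<psi>) \<in> Lam T f0 f f0' f' d\<phi> \<phi>' d\<eta> \<eta>' xh uh"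
    "\<And>h y. lin.sol h y \<Longrightarrow> c \<bullet> y T = integral {0..T} (\<lambda>t. \<psi> t \<bullet> h t)"
proof -
  obtain \<psi> where \<psi>: "continuous_on {0..T} \<psi>" "\<psi> T = c" "\<And>t. t \<in> {0..T} \<Longrightarrow> \<psi> t = \<psi> 0 + integral {0..t} (\<lambda>s. - lin.adj s (\<psi> s))"
    using lin.adjoint_exists[of c] by blast
  have dual: "c \<bullet> y T = integral {0..T} (\<lambda>t. \<psi> t \<bullet> h t)" if "lin.sol h y" for h y
    using lin.duality[OF \<psi>(1,3) that] \<psi>(2) by simp
  have pos: "0 \<le> integral {0..T} (\<lambda>t. \<psi> t \<bullet> Bm (xh t) (w t))" if w: "w \<in> inward_controls" for w
  proof -
    obtain y where y: "lin.sol (\<lambda>t. Bm (xh t) (w t)) y"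
      using lin.sol_exists[OF Bm_abs_int[OF xh_cont controls_abs_int(2)[OF w]]] by blast
    have "y T \<in> reachable_cone" unfolding reachable_cone_def using w y by blast
    from ge[OF this] dual[OF y] show ?thesis by simp
  qed
  have signs1: "0 \<le> \<psi> t \<bullet> f i (xh t)" if "t \<in> {0..T}" for t i
    by (rule switching_function_signs(1)[OF \<psi>(1)]) (use u0 pos that in auto)
  have signs2: "AE t in lebesgue_on {0..T}. u t $ i * (\<psi> t \<bullet> f i (xh t)) = 0" for i
    by (rule switching_function_signs(2)[OF \<psi>(1)]) (simp_all add: u0 pos)
  have AEuh: "AE t in lebesgue_on {0..T}. uh t = u t" using N uh by (subst AE_lebesgue_on_iff_negligible) auto
  have "(\<lambda>s. - lin.adj s (\<psi> s)) integrable_on {0..T}"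
    using lin.adj_int[OF \<psi>(1)] unfolding absolutely_integrable_on_def by (intro integrable_neg) blast
  from integral_equation_imp_AE_derivative[OF this \<psi>(3)]
  have d: "AE t in lebesgue_on {0..T}. (\<psi> has_vector_derivative - lin.adj t (\<psi> t)) (at t within {0..T})" .
  have AE1: "AE t in lebesgue_on {0..T}. \<exists>w. (\<psi> has_vector_derivative w) (at t within {0..T})
         \<and> (\<forall>z. w \<bullet> z = - (\<psi> t \<bullet> Amat f0' f' xh uh t z))"
    using d AEuh AE_space
  proof eventually_elim
    case (elim t)
    then have t: "t \<in> {0..T}" by (simp add: space_restrict_space)
    show ?case using elim Amat_eq_DA[of uh t] lin.adj_inner[OF t] by (intro exI[of _ "- lin.adj t (\<psi> t)"]) simp
  qed
  have "AE t in lebesgue_on {0..T}. \<forall>i\<in>UNIV. u t $ i * (\<psi> t \<bullet> f i (xh t)) = 0"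
    using signs2 by (subst AE_finite_all) auto
  then have AE2: "AE t in lebesgue_on {0..T}. \<forall>v. (\<forall>i. 0 \<le> v $ i) \<longrightarrow>
         \<psi> t \<bullet> dyn f0 f (xh t) (uh t) \<le> \<psi> t \<bullet> dyn f0 f (xh t) v"
    using AEuh AE_space
  proof eventually_elim
    case (elim t)
    then have t: "t \<in> {0..T}" by (simp add: space_restrict_space)
    show ?case
    proof (intro allI impI)
      fix v :: "real^'m" assume v: "\<forall>i. 0 \<le> v $ i"
      have dyn: "\<psi> t \<bullet> dyn f0 f (xh t) w = \<psi> t \<bullet> f0 (xh t) + (\<Sum>i\<in>UNIV. w $ i * (\<psi> t \<bullet> f i (xh t)))" for w
        by (simp add: dyn_def inner_add_right inner_sum_right)
      have "(\<Sum>i\<in>UNIV. uh t $ i * (\<psi> t \<bullet> f i (xh t))) = 0" using elim by (intro sum.neutral) simp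
      moreover have "0 \<le> (\<Sum>i\<in>UNIV. v $ i * (\<psi> t \<bullet> f i (xh t)))" using v signs1[OF t] by (intro sum_nonneg mult_nonneg_nonneg) auto
      ultimately show "\<psi> t \<bullet> dyn f0 f (xh t) (uh t) \<le> \<psi> t \<bullet> dyn f0 f (xh t) v" by (simp add: dyn)
    qed
  qed
  have "(\<alpha>, \<beta>, \<psi>) \<in> Lam T f0 f f0' f' d\<phi> \<phi>' d\<eta> \<eta>' xh uh"
    unfolding Lam_def mem_Collect_eq case_prod_conv
    using norm1 \<alpha> \<beta> lin.adjoint_lipschitz[OF \<psi>(1,3)] AE1 AE2 c \<psi>(2) by simp
  then show thesis by (rule that) (rule dual)
qed

text \<open>s solves the linearised system with source \<open>Qm\<close>, which already contains the
  factor 1/2 and the mixed term of Omega. Duality therefore identifies c . s T with the integral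
  part, and the weighted second-order increment of the endpoint constraints is Omega itself.\<close>

lemma Omega_eq:
  assumes N: "negligible N" and uh: "\<And>t. t \<in> {0..T} - N \<Longrightarrow> uh t = u t"
    and dual: "\<And>h y. lin.sol h y \<Longrightarrow> c \<bullet> y T = integral {0..T} (\<lambda>t. \<psi> t \<bullet> h t)"
    and s: "lin.sol (\<lambda>t. Qm (xh t) (u t) (z t) (v t)) s"
  shows "Omega T f' f0'' f'' d\<phi> \<phi>'' d\<eta> \<eta>'' xh uh (\<alpha>, \<beta>, \<psi>) z v
     = (1/2) * lsecond d\<phi> \<phi>'' d\<eta> \<eta>'' \<alpha> \<beta> (xh T) (z T) (z T) + c \<bullet> s T"
proof -
  have "integral {0..T} (\<lambda>t.
        \<psi> t \<bullet> (blinfun_apply (blinfun_apply (f0'' (xh t)) (z t)) (z t)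
            + (\<Sum>i\<in>UNIV. (uh t $ i) *\<^sub>R blinfun_apply (blinfun_apply (f'' i (xh t)) (z t)) (z t)))
      + 2 * (\<Sum>i\<in>UNIV. v t $ i * (\<psi> t \<bullet> blinfun_apply (f' i (xh t)) (z t))))
    = integral {0..T} (\<lambda>t. 2 * (\<psi> t \<bullet> Qm (xh t) (u t) (z t) (v t)))"
    by (rule integral_spike[OF N]) (auto simp: uh Qm_def inner_add_right inner_sum_right algebra_simps)
  also have "\<dots> = 2 * (c \<bullet> s T)" unfolding dual[OF s] by simp
  finally show ?thesis by (simp add: Omega_def)
qed

text \<open>Returns from the integral form to the Sobolev and almost-everywhere form of the problem.
  The velocity is bounded because \<open>dyn\<close> at control 0 is f0 and \<open>dyn\<close> is
  Lipschitz in the control over bounded states.\<close>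

lemma trajectory_feasible:
  assumes U: "U \<in> borel_measurable (lebesgue_on {0..T})" "\<And>t. t \<in> {0..T} \<Longrightarrow> norm (U t) \<le> M" "\<And>t i. t \<in> {0..T} \<Longrightarrow> 0 \<le> U t $ i"
    and X: "continuous_on {0..T} X" "\<And>t. t \<in> {0..T} \<Longrightarrow> X t = x0 + integral {0..t} (\<lambda>r. dyn f0 f (X r) (U r))"
    and endpoint: "\<And>i. i \<in> {1..d\<phi>} \<Longrightarrow> \<phi> i (X T) \<le> 0" "\<And>j. j \<in> {1..d\<eta>} \<Longrightarrow> \<eta> j (X T) = 0"
  shows "feasible T x0 f0 f d\<phi> \<phi> d\<eta> \<eta> X U"
proof -
  have Ui: "U absolutely_integrable_on {0..T}" by (rule absolutely_integrable_bounded_measurable[OF U(1,2)])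
  define g where "g r = dyn f0 f (X r) (U r)" for r
  have gi: "g absolutely_integrable_on {0..T}" unfolding g_def by (rule dyn_abs_int[OF X(1) Ui])
  have Xg: "X t = x0 + integral {0..t} g" if "t \<in> {0..T}" for t using X(2)[OF that] unfolding g_def .
  have X0: "X 0 = x0" using Xg[of 0] T by simp
  have "bounded (X ` {0..T})" by (intro compact_imp_bounded compact_continuous_image X) auto
  then obtain R where R: "\<And>t. t \<in> {0..T} \<Longrightarrow> norm (X t) \<le> R" by (meson bounded_iff image_eqI)
  obtain K where K: "0 \<le> K" "\<And>x a b. norm x \<le> R \<Longrightarrow> norm (dyn f0 f x a - dyn f0 f x b) \<le> K * norm (a - b)"
    by (rule dyn_lipschitz[where R=R]) (rule that)
  obtain K0 where K0: "\<And>x. x \<in> cball 0 R \<Longrightarrow> norm (f0 x) \<le> K0" using bounded_on_cball[OF cont(1), where R=R] by blast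
  have gb: "norm (g t) \<le> K * M + K0" if t: "t \<in> {0..T}" for t
  proof -
    have "norm (g t - dyn f0 f (X t) 0) \<le> K * norm (U t - 0)" unfolding g_def by (rule K(2)[OF R[OF t]])
    also have "\<dots> \<le> K * M" using U(2)[OF t] K(1) by (simp add: mult_left_mono)
    finally have 1: "norm (g t - f0 (X t)) \<le> K * M" by (simp add: dyn_def)
    have 2: "norm (f0 (X t)) \<le> K0" using K0 R[OF t] by simp
    show ?thesis using norm_triangle_mono[OF 1 2] by simp
  qed
  have gL: "Linf_on T g" unfolding Linf_on_def
    using absolutely_integrable_imp_borel_measurable[OF gi] gb by (auto intro!: AE_I2 exI[of _ "K * M + K0"] simp: space_restrict_space)
  show ?thesis unfolding feasible_def
  proof (intro conjI ballI)
    show "W1inf_on T X" unfolding W1inf_on_def using gL Xg unfolding X0 by blast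
    show "Linf_on T U" unfolding Linf_on_def using U by (auto intro!: AE_I2 exI[of _ M] simp: space_restrict_space)
    have "g integrable_on {0..T}" using gi by (simp add: absolutely_integrable_on_def)
    from integral_equation_imp_AE_derivative[OF this Xg]
    show "AE t in lebesgue_on {0..T}. (X has_vector_derivative dyn f0 f (X t) (U t)) (at t within {0..T})" by (simp add: g_def)
    show "AE t in lebesgue_on {0..T}. \<forall>i. 0 \<le> U t $ i" using U(3) by (auto intro!: AE_I2 simp: space_restrict_space)
  qed (use X0 endpoint in auto)
qed

text \<open>Carries the finite-dimensional dichotomy over to the control problem. The distance e is
  free, so that a descent trajectory can be placed in any neighbourhood of the reference
  pair.\<close>

lemma second_order_alternative:
  fixes \<phi> \<eta> :: "nat \<Rightarrow> real^'n \<Rightarrow> real"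
  assumes u0: "\<And>t i. t \<in> {0..T} \<Longrightarrow> 0 \<le> u t $ i" and N: "negligible N" and uh: "\<And>t. t \<in> {0..T} - N \<Longrightarrow> uh t = u t"
    and \<phi>: "\<And>i x. i \<le> d\<phi> \<Longrightarrow> (\<phi> i has_derivative blinfun_apply (\<phi>' i x)) (at x)"
              "\<And>i x. i \<le> d\<phi> \<Longrightarrow> (\<phi>' i has_derivative blinfun_apply (\<phi>'' i x)) (at x)" "\<And>i. i \<le> d\<phi> \<Longrightarrow> \<phi> i (xh T) = 0"
    and \<eta>: "\<And>j x. j \<in> {1..d\<eta>} \<Longrightarrow> (\<eta> j has_derivative blinfun_apply (\<eta>' j x)) (at x)"
              "\<And>j x. j \<in> {1..d\<eta>} \<Longrightarrow> (\<eta>' j has_derivative blinfun_apply (\<eta>'' j x)) (at x)" "\<And>j. j \<in> {1..d\<eta>} \<Longrightarrow> \<eta> j (xh T) = 0"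
    and v: "v absolutely_integrable_on {0..T}" and N': "negligible N'"
    and v0: "\<And>t i. t \<in> {0..T} - N' \<Longrightarrow> u t $ i = 0 \<Longrightarrow> v t $ i = 0"
    and z: "lin.sol (\<lambda>t. Bm (xh t) (v t)) z"
    and \<phi>z: "\<And>i. i \<le> d\<phi> \<Longrightarrow> blinfun_apply (\<phi>' i (xh T)) (z T) \<le> 0" and \<eta>z: "\<And>j. j \<in> {1..d\<eta>} \<Longrightarrow> blinfun_apply (\<eta>' j (xh T)) (z T) = 0"
    and e: "0 < e"
  obtains (multiplier) lm where "lm \<in> Lam T f0 f f0' f' d\<phi> \<phi>' d\<eta> \<eta>' xh uh" "0 \<le> Omega T f' f0'' f'' d\<phi> \<phi>'' d\<eta> \<eta>'' xh uh lm z v"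
  | (descent) X U where "feasible T x0 f0 f d\<phi> \<phi> d\<eta> \<eta> X U" "\<And>t. t \<in> {0..T} \<Longrightarrow> norm (X t - xh t) \<le> e"
      "\<And>t. t \<in> {0..T} \<Longrightarrow> norm (U t - u t) \<le> e" "\<phi> 0 (X T) < 0"
proof -
  define a where "a i = (\<Sum>e\<in>Basis. blinfun_apply (\<phi>' i (xh T)) e *\<^sub>R e)" for i
  define b where "b j = (\<Sum>e\<in>Basis. blinfun_apply (\<eta>' j (xh T)) e *\<^sub>R e)" for j
  have a: "blinfun_apply (\<phi>' i (xh T)) y = a i \<bullet> y" for i y unfolding a_def by (rule blinfun_real_representation)
  have b: "blinfun_apply (\<eta>' j (xh T)) y = b j \<bullet> y" for j y unfolding b_def by (rule blinfun_real_representation)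
  obtain s where s: "lin.sol (\<lambda>t. Qm (xh t) (u t) (z t) (v t)) s"
    using lin.sol_exists[OF Qm_abs_int[OF xh_cont lin.solD(2)[OF z] u_int v]] by blast
  \<comment> \<open>Shared by the degenerate and the regular case: coefficients that satisfy the two
    inequalities are extended by 0 outside their index ranges, as \<open>Lam\<close> demands, and
    completed by \<psi>.\<close>
  have from_coefficients: thesis
    if norm1: "(\<Sum>i\<le>d\<phi>. \<bar>\<alpha> i\<bar>) + (\<Sum>j\<in>{1..d\<eta>}. \<bar>\<beta> j\<bar>) = 1" and \<alpha>: "\<And>i. i \<le> d\<phi> \<Longrightarrow> 0 \<le> \<alpha> i"
      and ge: "\<And>\<rho>. \<rho> \<in> reachable_cone \<Longrightarrow> 0 \<le> (\<Sum>i\<le>d\<phi>. \<alpha> i * (a i \<bullet> \<rho>)) + (\<Sum>j\<in>{1..d\<eta>}. \<beta> j * (b j \<bullet> \<rho>))"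
      and ge0: "0 \<le> (\<Sum>i\<le>d\<phi>. \<alpha> i * (a i \<bullet> s T + (1/2) * \<phi>'' i (xh T) (z T) (z T)))
         + (\<Sum>j\<in>{1..d\<eta>}. \<beta> j * (b j \<bullet> s T + (1/2) * \<eta>'' j (xh T) (z T) (z T)))" for \<alpha> \<beta>
  proof -
    define \<alpha>' where "\<alpha>' i = (if i \<le> d\<phi> then \<alpha> i else 0)" for i
    define \<beta>' where "\<beta>' j = (if j \<in> {1..d\<eta>} then \<beta> j else 0)" for j
    define c where "c = (\<Sum>i\<le>d\<phi>. \<alpha> i *\<^sub>R a i) + (\<Sum>j\<in>{1..d\<eta>}. \<beta> j *\<^sub>R b j)"
    have c: "c \<bullet> y = (\<Sum>i\<le>d\<phi>. \<alpha> i * (a i \<bullet> y)) + (\<Sum>j\<in>{1..d\<eta>}. \<beta> j * (b j \<bullet> y))" for y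
      by (simp add: c_def inner_add_left inner_sum_left)
    have lp: "c \<bullet> y = lprime d\<phi> \<phi>' d\<eta> \<eta>' \<alpha>' \<beta>' (xh T) y" for y
      unfolding c lprime_def by (intro arg_cong2[where f="(+)"] sum.cong) (auto simp: a b \<alpha>'_def \<beta>'_def)
    have n': "(\<Sum>i\<le>d\<phi>. \<bar>\<alpha>' i\<bar>) + (\<Sum>j\<in>{1..d\<eta>}. \<bar>\<beta>' j\<bar>) = 1"
      unfolding norm1[symmetric] by (intro arg_cong2[where f="(+)"] sum.cong) (auto simp: \<alpha>'_def \<beta>'_def)
    have \<alpha>'s: "\<forall>i\<le>d\<phi>. 0 \<le> \<alpha>' i" "\<forall>i>d\<phi>. \<alpha>' i = 0" "\<forall>j. j \<notin> {1..d\<eta>} \<longrightarrow> \<beta>' j = 0"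
      using \<alpha> by (auto simp: \<alpha>'_def \<beta>'_def)
    have geR: "0 \<le> c \<bullet> \<rho>" if "\<rho> \<in> reachable_cone" for \<rho> using ge[OF that] by (simp add: c)
    obtain \<psi> where \<psi>: "(\<alpha>', \<beta>', \<psi>) \<in> Lam T f0 f f0' f' d\<phi> \<phi>' d\<eta> \<eta>' xh uh"
      "\<And>h y. lin.sol h y \<Longrightarrow> c \<bullet> y T = integral {0..T} (\<lambda>t. \<psi> t \<bullet> h t)"
      using multiplier_in_Lam[OF u0 N uh n' \<alpha>'s lp geR] by blast
    have "lsecond d\<phi> \<phi>'' d\<eta> \<eta>'' \<alpha>' \<beta>' (xh T) (z T) (z T) = (\<Sum>i\<le>d\<phi>. \<alpha> i * \<phi>'' i (xh T) (z T) (z T)) + (\<Sum>j\<in>{1..d\<eta>}. \<beta> j * \<eta>'' j (xh T) (z T) (z T))"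
      unfolding lsecond_def by (intro arg_cong2[where f="(+)"] sum.cong) (auto simp: \<alpha>'_def \<beta>'_def)
    moreover have "Omega T f' f0'' f'' d\<phi> \<phi>'' d\<eta> \<eta>'' xh uh (\<alpha>', \<beta>', \<psi>) z v
        = (1/2) * lsecond d\<phi> \<phi>'' d\<eta> \<eta>'' \<alpha>' \<beta>' (xh T) (z T) (z T) + c \<bullet> s T"
      by (rule Omega_eq[OF N _ _ s]) (rule uh \<psi>(2); assumption)+
    ultimately have "Omega T f' f0'' f'' d\<phi> \<phi>'' d\<eta> \<eta>'' xh uh (\<alpha>', \<beta>', \<psi>) z v =
       (\<Sum>i\<le>d\<phi>. \<alpha> i * (a i \<bullet> s T + (1/2) * \<phi>'' i (xh T) (z T) (z T)))
         + (\<Sum>j\<in>{1..d\<eta>}. \<beta> j * (b j \<bullet> s T + (1/2) * \<eta>'' j (xh T) (z T) (z T)))"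
      by (simp add: c distrib_left sum.distrib sum_distrib_left sum_divide_distrib)
    with ge0 \<psi>(1) show thesis by (intro multiplier) auto
  qed
  show thesis
  proof (cases "\<forall>y. (\<Sum>j\<in>{1..d\<eta>}. y j *\<^sub>R b j) = 0 \<longrightarrow> (\<forall>j\<in>{1..d\<eta>}. y j = 0)")
    case False
    then obtain y j0 where y: "(\<Sum>j\<in>{1..d\<eta>}. y j *\<^sub>R b j) = 0" and j0: "j0 \<in> {1..d\<eta>}" "y j0 \<noteq> 0" by blast
    define n where "n = (\<Sum>j\<in>{1..d\<eta>}. \<bar>y j\<bar>)"
    have n: "0 < n" unfolding n_def by (rule sum_pos2[of _ j0]) (use j0 in auto)
    define D where "D = (\<Sum>j\<in>{1..d\<eta>}. y j * \<eta>'' j (xh T) (z T) (z T))"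
    \<comment> \<open>The gradients cancel in a dependence, so Omega reduces to half of its
      quadratic form, a multiple of D; \<sigma> selects the orientation that makes it nonnegative,
      and n normalises.\<close>
    define \<sigma> :: real where "\<sigma> = (if D \<ge> 0 then 1 else -1)"
    define \<beta> where "\<beta> j = \<sigma> / n * y j" for j
    have \<sigma>: "\<bar>\<sigma>\<bar> = 1" "0 \<le> \<sigma> * D" by (auto simp: \<sigma>_def)
    have \<beta>0: "(\<Sum>j\<in>{1..d\<eta>}. \<beta> j * (b j \<bullet> \<rho>)) = 0" for \<rho>
    proof -
      have "(\<Sum>j\<in>{1..d\<eta>}. \<beta> j * (b j \<bullet> \<rho>)) = \<sigma> / n * ((\<Sum>j\<in>{1..d\<eta>}. y j *\<^sub>R b j) \<bullet> \<rho>)"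
        by (simp add: \<beta>_def inner_sum_left sum_distrib_left mult_ac)
      then show ?thesis unfolding y by simp
    qed
    show thesis
    proof (rule from_coefficients[of "\<lambda>_. 0" \<beta>])
      have "(\<Sum>j\<in>{1..d\<eta>}. \<bar>\<beta> j\<bar>) = (\<bar>\<sigma>\<bar> / n) * n"
        unfolding n_def sum_distrib_left using n by (intro sum.cong) (auto simp: \<beta>_def abs_mult n_def)
      then show "(\<Sum>i\<le>d\<phi>. \<bar>0\<bar>) + (\<Sum>j\<in>{1..d\<eta>}. \<bar>\<beta> j\<bar>) = 1" using n \<sigma> by simp
      have "(\<Sum>j\<in>{1..d\<eta>}. \<beta> j * (b j \<bullet> s T + (1/2) * \<eta>'' j (xh T) (z T) (z T)))
         = (\<Sum>j\<in>{1..d\<eta>}. \<beta> j * (b j \<bullet> s T)) + (\<sigma> * D) / (2 * n)"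
        by (simp add: distrib_left sum.distrib \<beta>_def D_def sum_distrib_left sum_divide_distrib mult_ac)
      then show "0 \<le> (\<Sum>i\<le>d\<phi>. 0 * (a i \<bullet> s T + (1/2) * \<phi>'' i (xh T) (z T) (z T)))
         + (\<Sum>j\<in>{1..d\<eta>}. \<beta> j * (b j \<bullet> s T + (1/2) * \<eta>'' j (xh T) (z T) (z T)))"
        using \<sigma>(2) n by (simp add: \<beta>0[unfolded One_nat_def])
    qed (use \<beta>0 in auto)
  next
    case True
    define cc where "cc i = a i \<bullet> s T + (1/2) * \<phi>'' i (xh T) (z T) (z T)" for i
    define dd where "dd j = b j \<bullet> s T + (1/2) * \<eta>'' j (xh T) (z T) (z T)" for j
    show thesis
    proof (rule cone_constraint_alternative[of "{..d\<phi>}" "{1..d\<eta>}" reachable_cone a b cc dd])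
      fix \<alpha> \<beta>
      assume "\<forall>i\<in>{..d\<phi>}. 0 \<le> \<alpha> i" "(\<Sum>i\<le>d\<phi>. \<bar>\<alpha> i\<bar>) + (\<Sum>j\<in>{1..d\<eta>}. \<bar>\<beta> j\<bar>) = 1"
        "\<And>\<rho>. \<rho> \<in> reachable_cone \<Longrightarrow> 0 \<le> (\<Sum>i\<le>d\<phi>. \<alpha> i * (a i \<bullet> \<rho>)) + (\<Sum>j\<in>{1..d\<eta>}. \<beta> j * (b j \<bullet> \<rho>))"
        "0 \<le> (\<Sum>i\<le>d\<phi>. \<alpha> i * cc i) + (\<Sum>j\<in>{1..d\<eta>}. \<beta> j * dd j)"
      then show thesis by (intro from_coefficients[of \<alpha> \<beta>]) (auto simp: cc_def dd_def)
    next
      fix r :: real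
      assume r: "0 < r" and int: "\<And>p. norm p \<le> r \<Longrightarrow> \<exists>\<rho>\<in>reachable_cone. \<exists>\<kappa>. (\<forall>j\<in>{1..d\<eta>}. b j \<bullet> \<kappa> = 0) \<and>
        (\<Sum>j\<in>{1..d\<eta>}. (b j \<bullet> \<rho> + dd j) *\<^sub>R b j) + \<kappa> = p \<and> (\<forall>i\<in>{..d\<phi>}. a i \<bullet> \<rho> + cc i \<le> - r)"
      obtain X U where XU: "U \<in> borel_measurable (lebesgue_on {0..T})" "\<And>t i. t \<in> {0..T} \<Longrightarrow> 0 \<le> U t $ i"
        "\<And>t. t \<in> {0..T} \<Longrightarrow> norm (U t - u t) \<le> e" "continuous_on {0..T} X"
        "\<And>t. t \<in> {0..T} \<Longrightarrow> X t = x0 + integral {0..t} (\<lambda>r. dyn f0 f (X r) (U r))"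
        "\<And>t. t \<in> {0..T} \<Longrightarrow> norm (X t - xh t) \<le> e" "\<And>i. i \<in> {..d\<phi>} \<Longrightarrow> \<phi> i (X T) < 0" "\<And>j. j \<in> {1..d\<eta>} \<Longrightarrow> \<eta> j (X T) = 0"
      proof -
        note that' = that
        show thesis
        proof (rule feasible_improvement[where I="{..d\<phi>}" and J="{1..d\<eta>}" and a=a and b=b and s=s and z=z and v=v and r=r and e=e and N=N'
             and \<phi>=\<phi> and \<phi>'=\<phi>' and \<phi>''=\<phi>'' and \<eta>=\<eta> and \<eta>'=\<eta>' and \<eta>''=\<eta>'', OF u0])
          show "a i \<bullet> z T \<le> 0" if "i \<in> {..d\<phi>}" for i using \<phi>z[of i] that by (simp add: a)
          show "b j \<bullet> z T = 0" if "j \<in> {1..d\<eta>}" for j using \<eta>z[OF that] by (simp add: b)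
          show "\<forall>j\<in>{1..d\<eta>}. y j = 0" if "(\<Sum>j\<in>{1..d\<eta>}. y j *\<^sub>R b j) = 0" for y using True that by blast
          show "\<exists>\<rho>\<in>reachable_cone. \<exists>\<kappa>. (\<forall>j\<in>{1..d\<eta>}. b j \<bullet> \<kappa> = 0) \<and>
            (\<Sum>j\<in>{1..d\<eta>}. (b j \<bullet> \<rho> + (b j \<bullet> s T + (1/2) * \<eta>'' j (xh T) (z T) (z T))) *\<^sub>R b j) + \<kappa> = p \<and>
            (\<forall>i\<in>{..d\<phi>}. a i \<bullet> \<rho> + (a i \<bullet> s T + (1/2) * \<phi>'' i (xh T) (z T) (z T)) \<le> - r)" if "norm p \<le> r" for p
            using int[OF that] unfolding cc_def dd_def .
        qed (use \<phi> \<eta> a b v N' v0 z s r e that' in \<open>auto\<close>)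
      qed
      have Ub: "norm (U t) \<le> e + Mu" if "t \<in> {0..T}" for t
        using norm_triangle_mono[OF XU(3)[OF that] u_bound[OF that]] by simp
      have "feasible T x0 f0 f d\<phi> \<phi> d\<eta> \<eta> X U"
        by (rule trajectory_feasible[OF XU(1) Ub XU(2,4,5)]) (use XU(7,8) in \<open>auto intro: less_imp_le\<close>)
      then show thesis using XU(3,6,7) by (intro descent) auto
    qed (use reachable_cone in auto)
  qed
qed

end

text \<open>Clamping each coordinate to the interval from 0 to |C| turns almost-everywhere bounds
  into bounds at every time and changes the control only on a null set.\<close>

lemma AE_eq_clamped_control:
  fixes uh :: "real \<Rightarrow> real^'m"
  assumes uh: "Linf_on T uh" and nonneg: "AE t in lebesgue_on {0..T}. \<forall>i. 0 \<le> uh t $ i"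
  obtains u M N where "u \<in> borel_measurable (lebesgue_on {0..T})" "\<And>t. norm (u t) \<le> M" "\<And>t i. 0 \<le> u t $ i"
    "negligible N" "\<And>t. t \<in> {0..T} - N \<Longrightarrow> uh t = u t"
proof -
  obtain C where m: "uh \<in> borel_measurable (lebesgue_on {0..T})" and C: "AE t in lebesgue_on {0..T}. norm (uh t) \<le> C"
    using uh by (auto simp: Linf_on_def)
  have "AE t in lebesgue_on {0..T}. norm (uh t) \<le> C \<and> (\<forall>i. 0 \<le> uh t $ i)" using C nonneg by eventually_elim auto
  then obtain N where N: "negligible N" "\<forall>t\<in>{0..T} - N. norm (uh t) \<le> C \<and> (\<forall>i. 0 \<le> uh t $ i)"
    by (subst (asm) AE_lebesgue_on_iff_negligible) auto
  define u where "u t = (\<chi> i. max 0 (min \<bar>C\<bar> (uh t $ i)))" for t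
  note [measurable] = borel_measurable_vec_nth[OF m]
  show thesis
  proof (rule that[of u "\<Sum>i\<in>(UNIV::'m set). \<bar>C\<bar>" N])
    show "u \<in> borel_measurable (lebesgue_on {0..T})" by (rule borel_measurable_vecI) (simp add: u_def)
    show "norm (u t) \<le> (\<Sum>i\<in>(UNIV::'m set). \<bar>C\<bar>)" for t
      by (rule order_trans[OF norm_le_l1_cart sum_mono]) (simp add: u_def)
    show "0 \<le> u t $ i" for t i by (simp add: u_def)
    show "uh t = u t" if "t \<in> {0..T} - N" for t
    proof -
      have "uh t $ i \<le> \<bar>C\<bar>" "0 \<le> uh t $ i" for i
        using N(2) that component_le_norm_cart[of "uh t" i] by (smt (verit, ccfv_threshold))+
      then show ?thesis by (simp add: vec_eq_iff u_def)
    qed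
  qed (rule N(1))
qed

theorem mainTheorem3:
  fixes T :: real and x0 :: "(real^'n)"
    and f0 :: "(real^'n) \<Rightarrow> (real^'n)" and f :: "'m::finite \<Rightarrow> (real^'n) \<Rightarrow> (real^'n)"
    and f0' :: "(real^'n) \<Rightarrow> (real^'n) \<Rightarrow>\<^sub>L (real^'n)" and f' :: "'m \<Rightarrow> (real^'n) \<Rightarrow> (real^'n) \<Rightarrow>\<^sub>L (real^'n)"
    and f0'' :: "(real^'n) \<Rightarrow> (real^'n) \<Rightarrow>\<^sub>L (real^'n) \<Rightarrow>\<^sub>L (real^'n)"
    and f'' :: "'m \<Rightarrow> (real^'n) \<Rightarrow> (real^'n) \<Rightarrow>\<^sub>L (real^'n) \<Rightarrow>\<^sub>L (real^'n)"
    and d\<phi> d\<eta> :: nat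
    and \<phi> \<eta> :: "nat \<Rightarrow> (real^'n) \<Rightarrow> real"
    and \<phi>' \<eta>' :: "nat \<Rightarrow> (real^'n) \<Rightarrow> (real^'n) \<Rightarrow>\<^sub>L real"
    and \<phi>'' \<eta>'' :: "nat \<Rightarrow> (real^'n) \<Rightarrow> (real^'n) \<Rightarrow>\<^sub>L (real^'n) \<Rightarrow>\<^sub>L real"
    and xh :: "real \<Rightarrow> (real^'n)" and uh :: "real \<Rightarrow> (real^'m)"
  assumes T_pos: "0 < T"
    and f0_C2: "\<And>x. (f0 has_derivative blinfun_apply (f0' x)) (at x)"
               "\<And>x. (f0' has_derivative blinfun_apply (f0'' x)) (at x)"
               "continuous_on UNIV f0''"
    and f_C2: "\<And>i x. (f i has_derivative blinfun_apply (f' i x)) (at x)"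
              "\<And>i x. (f' i has_derivative blinfun_apply (f'' i x)) (at x)"
              "\<And>i. continuous_on UNIV (f'' i)"
    and \<phi>_D2: "\<And>i x. i \<le> d\<phi> \<Longrightarrow> (\<phi> i has_derivative blinfun_apply (\<phi>' i x)) (at x)"
              "\<And>i x. i \<le> d\<phi> \<Longrightarrow> (\<phi>' i has_derivative blinfun_apply (\<phi>'' i x)) (at x)"
    and \<eta>_D2: "\<And>j x. j \<in> {1..d\<eta>} \<Longrightarrow> (\<eta> j has_derivative blinfun_apply (\<eta>' j x)) (at x)"
              "\<And>j x. j \<in> {1..d\<eta>} \<Longrightarrow> (\<eta>' j has_derivative blinfun_apply (\<eta>'' j x)) (at x)"
    and feas: "feasible T x0 f0 f d\<phi> \<phi> d\<eta> \<eta> xh uh"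
    and active: "\<And>i. i \<le> d\<phi> \<Longrightarrow> \<phi> i (xh T) = 0"
    and assumption1: "\<And>i. AE t in lebesgue_on {0..T}.
          (t \<in> I0 T (Lam T f0 f f0' f' d\<phi> \<phi>' d\<eta> \<eta>' xh uh) f xh i \<longleftrightarrow> uh t $ i = 0)"
    and wmin: "weak_min T x0 f0 f d\<phi> \<phi> d\<eta> \<eta> xh uh"
  shows "\<forall>(z, v) \<in> C2 T (Lam T f0 f f0' f' d\<phi> \<phi>' d\<eta> \<eta>' xh uh) f f0' f' d\<phi> \<phi>' d\<eta> \<eta>' xh uh.
           \<exists>lm \<in> Lam T f0 f f0' f' d\<phi> \<phi>' d\<eta> \<eta>' xh uh.
             0 \<le> Omega T f' f0'' f'' d\<phi> \<phi>'' d\<eta> \<eta>'' xh uh lm z v"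
proof (intro ballI, clarify)
  note frhs = feas[unfolded feasible_def]
  from frhs have xW: "W1inf_on T xh" and uL: "Linf_on T uh" and xd: "AE t in lebesgue_on {0..T}. (xh has_vector_derivative dyn f0 f (xh t) (uh t)) (at t within {0..T})"
    and xh0: "xh 0 = x0" and un: "AE t in lebesgue_on {0..T}. \<forall>i. 0 \<le> uh t $ i" and \<eta>0: "\<forall>j\<in>{1..d\<eta>}. \<eta> j (xh T) = 0"
    by blast+
  obtain u Mu N where u: "u \<in> borel_measurable (lebesgue_on {0..T})" "\<And>t. norm (u t) \<le> Mu" "\<And>t i. 0 \<le> u t $ i"
    "negligible N" "\<And>t. t \<in> {0..T} - N \<Longrightarrow> uh t = u t" by (rule AE_eq_clamped_control[OF uL un]) blast
  obtain w where w: "Linf_on T w" "\<And>t. t \<in> {0..T} \<Longrightarrow> xh t = xh 0 + integral {0..t} w" using xW unfolding W1inf_on_def by blast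
  have wi: "w integrable_on {0..T}" using Linf_on_imp_absolutely_integrable[OF w(1)] by (simp add: absolutely_integrable_on_def)
  obtain N1 where N1: "negligible N1" "\<And>t. t \<in> {0..T} - N1 \<Longrightarrow> w t = dyn f0 f (xh t) (uh t)"
    using AE_derivative_imp_integral_equation[OF T_pos wi w(2) xd] by blast
  have xhc: "continuous_on {0..T} xh"
    by (rule continuous_on_eq[OF _ w(2)[symmetric]]) (auto intro!: continuous_intros indefinite_integral_continuous_1 wi)
  have xheq: "xh t = x0 + integral {0..t} (\<lambda>s. dyn f0 f (xh s) (u s))" if t: "t \<in> {0..T}" for t
  proof -
    have "integral {0..t} w = integral {0..t} (\<lambda>s. dyn f0 f (xh s) (u s))"
      by (rule integral_spike[OF negligible_Un[OF N1(1) u(4)]]) (use N1(2) u(5) t in auto)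
    then show ?thesis using w(2)[OF t] xh0 by simp
  qed
  interpret control_system f0 f f0' f' f0'' f'' T Mu x0 xh u
    by unfold_locales (fact f0_C2 f_C2 T_pos u(1) xhc | rule u(2) | erule xheq)+
  fix z v
  assume C2: "(z, v) \<in> C2 T (Lam T f0 f f0' f' d\<phi> \<phi>' d\<eta> \<eta>' xh uh) f f0' f' d\<phi> \<phi>' d\<eta> \<eta>' xh uh"
  then have zW: "W12_on T z" and vL: "L2_on T v"
    and vI: "\<And>i. AE t in lebesgue_on {0..T}. t \<in> I0 T (Lam T f0 f f0' f' d\<phi> \<phi>' d\<eta> \<eta>' xh uh) f xh i \<longrightarrow> v t $ i = 0"
    and zd: "AE t in lebesgue_on {0..T}. (z has_vector_derivative (Amat f0' f' xh uh t (z t) + Bmat f xh t (v t))) (at t within {0..T})"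
    and z0: "z 0 = 0" and z\<phi>: "\<And>i. i \<le> d\<phi> \<Longrightarrow> blinfun_apply (\<phi>' i (xh T)) (z T) \<le> 0"
    and z\<eta>: "\<And>j. j \<in> {1..d\<eta>} \<Longrightarrow> blinfun_apply (\<eta>' j (xh T)) (z T) = 0"
    unfolding C2_def by auto
  have va: "v absolutely_integrable_on {0..T}" by (rule L2_on_imp_absolutely_integrable[OF vL])
  obtain wz where wz: "L2_on T wz" "\<And>t. t \<in> {0..T} \<Longrightarrow> z t = z 0 + integral {0..t} wz" using zW unfolding W12_on_def by blast
  have wzi: "wz integrable_on {0..T}" using L2_on_imp_absolutely_integrable[OF wz(1)] by (simp add: absolutely_integrable_on_def)
  obtain N2 where N2: "negligible N2" "\<And>t. t \<in> {0..T} - N2 \<Longrightarrow> wz t = Amat f0' f' xh uh t (z t) + Bmat f xh t (v t)"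
    using AE_derivative_imp_integral_equation[OF T_pos wzi wz(2) zd] by blast
  have z: "lin.sol (\<lambda>t. Bm (xh t) (v t)) z"
    unfolding lin.sol_def
  proof (intro conjI ballI)
    show "(\<lambda>t. Bm (xh t) (v t)) absolutely_integrable_on {0..T}" by (rule Bm_abs_int[OF xh_cont va])
    show "continuous_on {0..T} z"
      by (rule continuous_on_eq[OF _ wz(2)[symmetric]]) (auto intro!: continuous_intros indefinite_integral_continuous_1 wzi)
    fix t assume t: "t \<in> {0..T}"
    have "integral {0..t} wz = integral {0..t} (\<lambda>s. DA (xh s) (u s) (z s) + Bm (xh s) (v s))"
      by (rule integral_spike[OF negligible_Un[OF N2(1) u(4)]])
        (use N2(2) u(5) t in \<open>auto simp: Amat_eq_DA Bmat_def Bm_def\<close>)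
    then show "z t = integral {0..t} (\<lambda>s. DA (xh s) (u s) (z s) + Bm (xh s) (v s))" using wz(2)[OF t] z0 by simp
  qed
  \<comment> \<open>Assumption 1 enters here: almost every zero of uh_i lies in the set
    \<open>I0\<close> of index i, where a critical direction has v_i = 0.\<close>
  have "AE t in lebesgue_on {0..T}. uh t $ i = 0 \<longrightarrow> v t $ i = 0" for i
    using vI[of i] assumption1[of i] by eventually_elim auto
  then have "AE t in lebesgue_on {0..T}. \<forall>i\<in>UNIV. uh t $ i = 0 \<longrightarrow> v t $ i = 0" by (subst AE_finite_all) auto
  then obtain N3 where N3: "negligible N3" "\<forall>t\<in>{0..T} - N3. \<forall>i\<in>UNIV. uh t $ i = 0 \<longrightarrow> v t $ i = 0"
    by (subst (asm) AE_lebesgue_on_iff_negligible) auto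
  have v0: "v t $ i = 0" if "t \<in> {0..T} - (N \<union> N3)" "u t $ i = 0" for t i
    using N3(2) u(5)[of t] that by auto
  from wmin obtain \<epsilon> where \<epsilon>: "0 < \<epsilon>" "\<And>x u. feasible T x0 f0 f d\<phi> \<phi> d\<eta> \<eta> x u \<Longrightarrow> (SUP t\<in>{0..T}. norm (x t - xh t)) < \<epsilon> \<Longrightarrow>
        esssup (lebesgue_on {0..T}) (\<lambda>t. ereal (norm (u t - uh t))) < ereal \<epsilon> \<Longrightarrow> \<phi> 0 (xh T) \<le> \<phi> 0 (x T)"
    unfolding weak_min_def by blast
  \<comment> \<open>Half of \<epsilon>, because the bounds obtained are non-strict while weak
    minimality asks for strict ones.\<close>
  have e: "0 < \<epsilon> / 2" using \<epsilon>(1) by simp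
  show "\<exists>lm \<in> Lam T f0 f f0' f' d\<phi> \<phi>' d\<eta> \<eta>' xh uh.
             0 \<le> Omega T f' f0'' f'' d\<phi> \<phi>'' d\<eta> \<eta>'' xh uh lm z v"
  proof (rule second_order_alternative[OF u(3) u(4,5) \<phi>_D2 active \<eta>_D2 \<eta>0[rule_format] va negligible_Un[OF u(4) N3(1)] v0 z z\<phi> z\<eta> e])
    fix X U
    assume F: "feasible T x0 f0 f d\<phi> \<phi> d\<eta> \<eta> X U" and Xe: "\<And>t. t \<in> {0..T} \<Longrightarrow> norm (X t - xh t) \<le> \<epsilon> / 2"
      and Ue: "\<And>t. t \<in> {0..T} \<Longrightarrow> norm (U t - u t) \<le> \<epsilon> / 2" and neg: "\<phi> 0 (X T) < 0"
    have "(SUP t\<in>{0..T}. norm (X t - xh t)) \<le> \<epsilon> / 2" by (rule cSUP_least) (use T_pos Xe in auto)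
    moreover have "esssup (lebesgue_on {0..T}) (\<lambda>t. ereal (norm (U t - uh t))) \<le> ereal (\<epsilon> / 2)"
    proof (rule esssup_I)
      have "U \<in> borel_measurable (lebesgue_on {0..T})" "uh \<in> borel_measurable (lebesgue_on {0..T})"
        using F uL by (auto simp: feasible_def Linf_on_def)
      then show "(\<lambda>t. ereal (norm (U t - uh t))) \<in> borel_measurable (lebesgue_on {0..T})" by measurable
      show "AE t in lebesgue_on {0..T}. ereal (norm (U t - uh t)) \<le> ereal (\<epsilon> / 2)"
        using u(4,5) Ue by (subst AE_lebesgue_on_iff_negligible) auto
    qed
    moreover have "ereal (\<epsilon> / 2) < ereal \<epsilon>" using \<epsilon>(1) by simp
    ultimately have "\<phi> 0 (xh T) \<le> \<phi> 0 (X T)" using \<epsilon>(1) by (intro \<epsilon>(2)[OF F]) (auto intro: le_less_trans)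
    \<comment> \<open>The cost is 0 at the reference endpoint, so a negative cost nearby contradicts
      minimality and rules out the descent branch.\<close>
    then show ?thesis using neg active[of 0] by simp
  qed (assumption | erule bexI[rotated], assumption)+
qed

end
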